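(* Let $\beta\in\{1,2\}$ and let $\mathcal T\ge 2N$ be positive integers. Let $O$ be a random $\mathcal T\times\mathcal T$ matrix distributed according to the uniform (Haar) measure on the group of real orthogonal matrices of determinant $1$ if $\beta=1$, or on the group of complex unitary matrices if $\beta=2$. Let $A$ be the top-left $N\times N$ corner of $O$. Then $$M=(I_N+A)(2I_N+A+A^* )^{-1}(I_N+A^* )$$ is distributed as the $N\times N$ real symmetric ($\beta=1$) or complex Hermitian ($\beta=2$) random matrix with density proportional to $$\det(M)^{\frac\beta2(\mathcal T-N)+\beta-2}\det(I_N-M)^{\frac\beta2(\mathcal T-2N+1)-1},\qquad 0\le M\le I_N,$$ with respect to Lebesgue measure on symmetric/Hermitian matrices.
   Context: $A^*$ is the transpose (conjugate transpose when $\beta=2$); $0\le M\le I_N$ means $M$ and $I_N-M$ are non-negative definite. *)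

theory Defs
  imports "HOL-Analysis.Analysis" "HOL-Probability.Probability"
begin

text \<open>All matrices are complex matrices indexed by finite types. For beta = 1 the
relevant matrices have real entries (real orthogonal / real symmetric); for beta = 2
they are general complex (unitary / Hermitian).\<close>

definition mat_adj :: "complex^'n^'m \<Rightarrow> complex^'m^'n" where
  "mat_adj A = (\<chi> i j. cnj (A $ j $ i))"

definition real_matrix :: "complex^'n^'m \<Rightarrow> bool" where
  "real_matrix A \<longleftrightarrow> (\<forall>i j. Im (A $ i $ j) = 0)"

definition haar_group :: "nat \<Rightarrow> (complex^'t^'t) set" where
  "haar_group \<beta> =
     (if \<beta> = 1 then {Q. real_matrix Q \<and> Q ** mat_adj Q = mat 1 \<and> det Q = 1}
      else {Q. Q ** mat_adj Q = mat 1})"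

definition is_haar_prob :: "(complex^'t^'t) set \<Rightarrow> (complex^'t^'t) measure \<Rightarrow> bool" where
  "is_haar_prob G \<mu> \<longleftrightarrow>
     prob_space \<mu> \<and> space \<mu> = G \<and> sets \<mu> = sets (restrict_space borel G) \<and>
     (\<forall>U\<in>G. distr \<mu> \<mu> (\<lambda>Q. U ** Q) = \<mu>)"

text \<open>Top-left N x N corner of a (N+K) x (N+K) matrix: the index type of size T = N + K
is the sum type, whose first block of indices is Inl.\<close>
definition corner :: "complex^('n::finite + 'k::finite)^('n + 'k) \<Rightarrow> complex^'n^'n" where
  "corner Q = (\<chi> i j. Q $ Inl i $ Inl j)"

definition Mmap :: "complex^'n^'n \<Rightarrow> complex^'n^'n" where
  "Mmap A = (mat 1 + A) ** matrix_inv (mat 2 + A + mat_adj A) ** (mat 1 + mat_adj A)"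

definition herm_form :: "complex^'n^'n \<Rightarrow> complex^'n \<Rightarrow> complex" where
  "herm_form M x = (\<Sum>i\<in>UNIV. \<Sum>j\<in>UNIV. cnj (x $ i) * M $ i $ j * x $ j)"

definition nonneg_def :: "complex^'n^'n \<Rightarrow> bool" where
  "nonneg_def M \<longleftrightarrow> (\<forall>x. Im (herm_form M x) = 0 \<and> 0 \<le> Re (herm_form M x))"

text \<open>Lebesgue measure on real symmetric (beta = 1) / complex Hermitian (beta = 2) matrices,
as the image of Lebesgue measure on the independent real coordinates
(diagonal entries, real parts (and for beta = 2 imaginary parts) of upper entries).\<close>
definition herm_param_index :: "nat \<Rightarrow> ('n::{finite,linorder} \<times> 'n) set" where
  "herm_param_index \<beta> = (if \<beta> = 1 then {(i, j). i \<le> j} else UNIV)"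

definition herm_of_param :: "nat \<Rightarrow> ('n::{finite,linorder} \<times> 'n \<Rightarrow> real) \<Rightarrow> ((complex, 'n) vec, 'n) vec" where
  "herm_of_param \<beta> p = (\<chi> i j.
      if i = j then complex_of_real (p (i, i))
      else if i < j then Complex (p (i, j)) (if \<beta> = 2 then p (j, i) else 0)
      else Complex (p (j, i)) (if \<beta> = 2 then - p (i, j) else 0))"

definition herm_lebesgue :: "nat \<Rightarrow> ((complex, 'n::{finite,linorder}) vec, 'n) vec measure" where
  "herm_lebesgue \<beta> =
     distr (PiM (herm_param_index \<beta>) (\<lambda>_. lborel)) borel (herm_of_param \<beta>)"

definition jacobi_density :: "nat \<Rightarrow> nat \<Rightarrow> complex^'n^'n \<Rightarrow> real" where
  "jacobi_density \<beta> T M =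
     (let N = CARD('n) in
      if nonneg_def M \<and> nonneg_def (mat 1 - M) then
        Re (det M) powr (real \<beta> / 2 * (real T - real N) + real \<beta> - 2) *
        Re (det (mat 1 - M)) powr (real \<beta> / 2 * (real T - 2 * real N + 1) - 1)
      else 0)"

end

theory Submission
  imports Defs
begin

text \<open>
Uniqueness of invariant measures replaces the computation of Jacobians throughout; all constants are
dropped. The factor by which a Lebesgue measure scales under an action of \<open>GL_N\<close> is a character which
is trivial on unitary matrices, hence a power of \<open>|det g|\<close> whose exponent is found from dilations.

Let \<open>T = N + K\<close>, let \<open>V\<close> be the first \<open>N\<close> columns of the Haar matrix \<open>Q\<close>, and let \<open>g\<close> be distributed by the
(infinite) Haar measure of \<open>GL_N\<close>, independently of \<open>Q\<close>. The laws of \<open>X = V g\<close> and of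
\<open>det(X^* X)^(-\<beta> T/2) dX\<close> are invariant under the same transitive group action, so they agree. In the
blocks \<open>X = (X1, X2)\<close>, the law of \<open>X2^* X2\<close> under \<open>dX2\<close> is a power of the determinant times Lebesgue
measure on the cone of positive definite matrices, since that cone is a homogeneous space of \<open>GL_N\<close>
as well. With \<open>S = X^* X = g^* g\<close> and \<open>X1 = A g\<close> the joint law of \<open>(X1, S)\<close> factorizes, and the corner
\<open>A\<close> has density \<open>det(1 - A^* A)^r\<close>, where \<open>r = \<beta>/2 (T - 2N + 1) - 1\<close>.

Now put \<open>B = (1 + A)^(-1)\<close>. Then \<open>M = (B + B^*)^(-1)\<close> and
\<open>1 - A^* A = (B^(-1))^* (B + B^* - 1) B^(-1)\<close>. Inversion preserves the Haar measure of \<open>GL_N\<close>, so the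
density of \<open>B\<close> is \<open>det(B + B^* - 1)^r |det B|^(-2 \<beta> N - 2 r)\<close>. Writing \<open>S = B + B^* = g^* g\<close> and
\<open>B - B^* = g^* K g\<close>, the integral over the skew-Hermitian \<open>K\<close> only contributes a power of \<open>det S\<close>, and
\<open>S\<close> is replaced by \<open>M = S^(-1)\<close> using that inversion preserves the invariant measure of the cone.
\<close>

subsection \<open>Measures determined by their invariance\<close>

text \<open>All measures live on the Borel sets of full complex matrix spaces, and membership in a
  subspace, group or cone is only an almost-everywhere statement. The real and the complex case then
  share one proof. Uniqueness rests on Tonelli: a double integral over a space and the group acting
  on it is evaluated in both orders. This requires unimodularity and a test set with positive finite
  orbit integral; bounds on the trace and the determinant of \<open>mat_adj g ** g\<close> provide
  such sets. Two obstacles shape the rest. Roots of positive matrices must depend measurably on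
  them; Gram--Schmidt achieves this, and its root differs from any other by a unitary factor that
  the invariance of the laws removes. The integral over the skew-Hermitian part might diverge; it
  enters as one unknown constant, whose finiteness follows at the very end because the law of
  \<open>M\<close> has mass one. The number \<open>\<beta> (N - 1) + 2\<close> that recurs in the
  exponents is twice the real dimension of the space of Hermitian (or real symmetric) matrices,
  divided by \<open>N\<close>.\<close>

lemma nn_integral_swap_borel:
  fixes M :: "'a::second_countable_topology measure" and N :: "'b::second_countable_topology measure"
  assumes M: "sigma_finite_measure M" "sets M = sets borel"
    and N: "sigma_finite_measure N" "sets N = sets borel"
    and f: "(\<lambda>(x, y). f x y) \<in> borel_measurable borel"
  shows "(\<integral>\<^sup>+x. \<integral>\<^sup>+y. f x y \<partial>N \<partial>M) = (\<integral>\<^sup>+y. \<integral>\<^sup>+x. f x y \<partial>M \<partial>N)"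
proof -
  interpret pair_sigma_finite M N
    using M N by (simp add: pair_sigma_finite_def)
  have "sets (M \<Otimes>\<^sub>M N) = sets borel"
    using M N by (simp add: borel_prod[symmetric] cong: sets_pair_measure_cong)
  then have "(\<lambda>(x, y). f x y) \<in> borel_measurable (M \<Otimes>\<^sub>M N)"
    using f by (simp cong: measurable_cong_sets)
  from Fubini[OF this] show ?thesis by simp
qed

lemma borel_measurable_nn_integral_param:
  fixes N :: "'b::second_countable_topology measure"
    and f :: "'a::second_countable_topology \<Rightarrow> 'b \<Rightarrow> ennreal"
  assumes N: "sigma_finite_measure N" "sets N = sets borel"
    and f: "(\<lambda>(x, y). f x y) \<in> borel_measurable borel"
  shows "(\<lambda>x. \<integral>\<^sup>+y. f x y \<partial>N) \<in> borel_measurable borel"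
proof -
  interpret sigma_finite_measure N by fact
  have "sets (borel \<Otimes>\<^sub>M N) = sets (borel :: ('a \<times> 'b) measure)"
    using N by (simp add: borel_prod[symmetric] cong: sets_pair_measure_cong)
  then have "(\<lambda>(x, y). f x y) \<in> borel_measurable (borel \<Otimes>\<^sub>M N)"
    using f by (simp cong: measurable_cong_sets)
  then show ?thesis by (rule borel_measurable_nn_integral)
qed

lemma sigma_finite_measure_pos_finite_set:
  assumes "sigma_finite_measure M" "emeasure M (space M) \<noteq> 0"
  obtains E where "E \<in> sets M" "0 < emeasure M E" "emeasure M E < \<infinity>"
proof -
  interpret sigma_finite_measure M by fact
  obtain A :: "nat \<Rightarrow> _" where A: "range A \<subseteq> sets M" "(\<Union>i. A i) = space M" "\<And>i. emeasure M (A i) \<noteq> \<infinity>"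
    using sigma_finite by blast
  have "\<exists>i. emeasure M (A i) \<noteq> 0"
  proof (rule ccontr)
    assume "\<nexists>i. emeasure M (A i) \<noteq> 0"
    then have "\<And>i. A i \<in> null_sets M" using A by auto
    then have "(\<Union>i. A i) \<in> null_sets M" by (rule null_sets_UN)
    then show False using A assms by (metis null_setsD1)
  qed
  then obtain i where "emeasure M (A i) \<noteq> 0" by blast
  then show ?thesis using A that[of "A i"]
    by (metis infinity_ennreal_def not_gr_zero range_subsetD top.not_eq_extremum)
qed

text \<open>The double integral of \<open>f(x) h(p x)\<close> over \<open>\<nu>\<close> and \<open>P\<close> is computed in both orders.\<close>
lemma orbit_integral_swap:
  fixes P :: "'p::second_countable_topology measure" and \<nu> :: "'x::second_countable_topology measure"
    and f h :: "'x \<Rightarrow> ennreal"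
  assumes P: "sigma_finite_measure P" "sets P = sets borel"
    and \<nu>: "sigma_finite_measure \<nu>" "sets \<nu> = sets borel"
    and a: "(\<lambda>(p, x). a p x) \<in> borel \<rightarrow>\<^sub>M borel" and a': "(\<lambda>(p, x). a' p x) \<in> borel \<rightarrow>\<^sub>M borel"
    and f[measurable]: "f \<in> borel_measurable borel" and h[measurable]: "h \<in> borel_measurable borel"
    and inv: "AE p in P. (\<integral>\<^sup>+x. f x * h (a p x) \<partial>\<nu>) = (\<integral>\<^sup>+x. f (a' p x) * h x \<partial>\<nu>)"
    and k: "AE x in \<nu>. (\<integral>\<^sup>+p. h (a p x) \<partial>P) = k"
    and k': "AE x in \<nu>. (\<integral>\<^sup>+p. f (a' p x) \<partial>P) = k'"
  shows "k * (\<integral>\<^sup>+x. f x \<partial>\<nu>) = k' * (\<integral>\<^sup>+x. h x \<partial>\<nu>)"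
proof -
  have B: "borel \<Otimes>\<^sub>M borel = (borel :: ('p \<times> 'x) measure)" "borel \<Otimes>\<^sub>M borel = (borel :: ('x \<times> 'p) measure)"
    by (simp_all add: borel_prod)
  have [measurable]: "(\<lambda>z. a (fst z) (snd z)) \<in> borel \<rightarrow>\<^sub>M borel" "(\<lambda>z. a' (fst z) (snd z)) \<in> borel \<rightarrow>\<^sub>M borel"
    using a a' by (simp_all add: case_prod_beta')
  have sw: "(\<lambda>z::'x \<times> 'p. (snd z, fst z)) \<in> borel \<rightarrow>\<^sub>M borel"
    by (intro borel_measurable_continuous_onI continuous_intros)
  have [measurable]: "fst \<in> borel \<rightarrow>\<^sub>M (borel::'p measure)" "snd \<in> borel \<rightarrow>\<^sub>M (borel::'p measure)"
     "(fst :: 'p \<times> 'x \<Rightarrow> _) \<in> borel \<rightarrow>\<^sub>M borel" "(snd :: 'p \<times> 'x \<Rightarrow> _) \<in> borel \<rightarrow>\<^sub>M borel"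
     "(fst :: 'x \<times> 'p \<Rightarrow> _) \<in> borel \<rightarrow>\<^sub>M borel" "(snd :: 'x \<times> 'p \<Rightarrow> _) \<in> borel \<rightarrow>\<^sub>M borel"
    by (intro borel_measurable_continuous_onI continuous_intros)+
  have ap: "(\<lambda>p. a p x) \<in> borel \<rightarrow>\<^sub>M borel" "(\<lambda>p. a' p x) \<in> borel \<rightarrow>\<^sub>M borel" for x
  proof -
    have "(\<lambda>p. (p, x)) \<in> borel \<rightarrow>\<^sub>M (borel :: ('p \<times> 'x) measure)"
      by (intro borel_measurable_continuous_onI continuous_intros)
    from measurable_compose[OF this a] measurable_compose[OF this a']
    show "(\<lambda>p. a p x) \<in> borel \<rightarrow>\<^sub>M borel" "(\<lambda>p. a' p x) \<in> borel \<rightarrow>\<^sub>M borel" by simp_all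
  qed
  have m1: "(\<lambda>p. h (a p x)) \<in> borel_measurable P" "(\<lambda>p. f (a' p x)) \<in> borel_measurable P" for x
    using measurable_compose[OF ap(1) h] measurable_compose[OF ap(2) f] P by (simp_all cong: measurable_cong_sets)
  have fn: "f \<in> borel_measurable \<nu>" "h \<in> borel_measurable \<nu>" using f h \<nu> by (simp_all cong: measurable_cong_sets)
  have m2: "(\<lambda>(x, p). f x * h (a p x)) \<in> borel_measurable borel"
  proof -
    have "(\<lambda>z::'x \<times> 'p. h (a (snd z) (fst z))) \<in> borel_measurable borel"
      using measurable_compose[OF measurable_compose[OF sw a] h] by simp
    then show ?thesis unfolding case_prod_beta' by measurable
  qed
  have m3: "(\<lambda>(p, x). f (a' p x) * h x) \<in> borel_measurable borel"
    unfolding case_prod_beta' by measurable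
  have "k * (\<integral>\<^sup>+x. f x \<partial>\<nu>) = (\<integral>\<^sup>+x. k * f x \<partial>\<nu>)"
    by (simp add: nn_integral_cmult fn)
  also have "\<dots> = (\<integral>\<^sup>+x. f x * (\<integral>\<^sup>+p. h (a p x) \<partial>P) \<partial>\<nu>)"
    using k by (intro nn_integral_cong_AE) (auto simp: mult.commute)
  also have "\<dots> = (\<integral>\<^sup>+x. (\<integral>\<^sup>+p. f x * h (a p x) \<partial>P) \<partial>\<nu>)"
    using m1 by (simp add: nn_integral_cmult)
  also have "\<dots> = (\<integral>\<^sup>+p. (\<integral>\<^sup>+x. f x * h (a p x) \<partial>\<nu>) \<partial>P)"
    using P \<nu> m2 by (intro nn_integral_swap_borel)
  also have "\<dots> = (\<integral>\<^sup>+p. (\<integral>\<^sup>+x. f (a' p x) * h x \<partial>\<nu>) \<partial>P)"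
    using inv by (rule nn_integral_cong_AE)
  also have "\<dots> = (\<integral>\<^sup>+x. (\<integral>\<^sup>+p. f (a' p x) * h x \<partial>P) \<partial>\<nu>)"
    using P \<nu> m3 by (intro nn_integral_swap_borel)
  also have "\<dots> = (\<integral>\<^sup>+x. (\<integral>\<^sup>+p. f (a' p x) \<partial>P) * h x \<partial>\<nu>)"
    using m1 by (simp add: nn_integral_multc)
  also have "\<dots> = (\<integral>\<^sup>+x. k' * h x \<partial>\<nu>)"
    using k' by (intro nn_integral_cong_AE) auto
  also have "\<dots> = k' * (\<integral>\<^sup>+x. h x \<partial>\<nu>)"
    by (simp add: nn_integral_cmult fn)
  finally show ?thesis .
qed

text \<open>The cross identity fixes a ratio once it can be cancelled. The function \<open>a\<close>
  is positive and finite for \<open>\<kappa>\<close>, \<open>b\<close> for \<open>\<nu>\<close>; the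
  identity at this pair makes \<open>\<nu> a\<close> positive and finite as well, and the constant
  is the quotient at \<open>a\<close>.\<close>

lemma proportional_of_swap:
  fixes \<kappa> \<nu> :: "('a \<Rightarrow> ennreal) \<Rightarrow> ennreal"
  assumes sw: "\<And>f h. f \<in> borel_measurable M \<Longrightarrow> h \<in> borel_measurable M \<Longrightarrow> \<kappa> h * \<nu> f = \<kappa> f * \<nu> h"
    and a: "a \<in> borel_measurable M" "0 < \<kappa> a" "\<kappa> a < \<infinity>"
    and b: "b \<in> borel_measurable M" "0 < \<nu> b" "\<nu> b < \<infinity>"
  obtains c :: real where "c > 0" "\<And>f. f \<in> borel_measurable M \<Longrightarrow> \<nu> f = ennreal c * \<kappa> f"
proof -
  have e: "\<kappa> b * \<nu> a = \<kappa> a * \<nu> b" using sw a b by blast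
  have p: "0 < \<kappa> a * \<nu> b" "\<kappa> a * \<nu> b < \<infinity>"
    using a b by (simp_all add: ennreal_zero_less_mult_iff ennreal_mult_less_top)
  have va: "0 < \<nu> a" "\<nu> a < \<infinity>"
  proof -
    show "0 < \<nu> a" using e p by (metis mult_zero_right not_gr_zero)
    have "\<nu> a \<noteq> \<top>"
    proof
      assume "\<nu> a = \<top>"
      then have "\<kappa> b * \<top> = \<kappa> a * \<nu> b" using e by simp
      then show False using p by (cases "\<kappa> b = 0") (auto simp: ennreal_mult_top)
    qed
    then show "\<nu> a < \<infinity>" by (simp add: less_top)
  qed
  obtain x y where xy: "\<kappa> a = ennreal x" "\<nu> a = ennreal y" "0 < x" "0 < y"
    using a va by (metis ennreal_cases ennreal_less_zero_iff infinity_ennreal_def order_less_irrefl)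
  show ?thesis
  proof (rule that[of "y / x"])
    show "y / x > 0" using xy by simp
    fix f :: "'a \<Rightarrow> ennreal" assume f: "f \<in> borel_measurable M"
    have "ennreal x * \<nu> f = \<kappa> f * ennreal y" using sw[OF f a(1)] xy by simp
    then have "ennreal (1/x) * (ennreal x * \<nu> f) = ennreal (1/x) * (\<kappa> f * ennreal y)" by simp
    moreover have "ennreal (1/x) * (ennreal x * \<nu> f) = \<nu> f"
      using xy by (simp add: mult.assoc[symmetric] ennreal_mult[symmetric])
    moreover have "ennreal (1/x) * (\<kappa> f * ennreal y) = (ennreal (1/x) * ennreal y) * \<kappa> f"
      by (simp only: ac_simps)
    moreover have "ennreal (1/x) * ennreal y = ennreal (y/x)"
      using xy by (simp add: ennreal_mult[symmetric])
    ultimately show "\<nu> f = ennreal (y/x) * \<kappa> f" by simp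
  qed
qed

lemma sigma_finite_density_finite:
  assumes "sigma_finite_measure M" "f \<in> borel_measurable M" "\<And>x. f x \<noteq> \<top>"
  shows "sigma_finite_measure (density M f)"
  using sigma_finite_measure.sigma_finite_iff_density_finite[OF assms(1,2)] assms(3) by simp

text \<open>\<open>P\<close> is an invariant measure on the acting group and
  \<open>\<kappa> h\<close> is the orbit integral of \<open>h\<close>, the same at almost every
  point by transitivity. The weight \<open>w\<close> makes \<open>\<nu>\<close> invariant. That
  \<open>a\<close> and the inverse action \<open>a'\<close> have the same orbit integral expresses
  unimodularity, and \<open>b\<close> is the test function at which the constants can be
  compared.\<close>

lemma homogeneous_measure_unique:
  fixes P :: "'p::second_countable_topology measure" and \<nu> :: "'x::second_countable_topology measure"
    and \<kappa> :: "('x \<Rightarrow> ennreal) \<Rightarrow> ennreal"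
  assumes P: "sigma_finite_measure P" "sets P = sets borel"
    and \<nu>: "sigma_finite_measure \<nu>" "sets \<nu> = sets borel" "emeasure \<nu> (space \<nu>) \<noteq> 0"
    and w: "w \<in> borel_measurable borel" "\<And>x. w x \<noteq> \<top>" "AE x in \<nu>. w x \<noteq> 0"
    and a: "(\<lambda>(p, x). a p x) \<in> borel \<rightarrow>\<^sub>M borel" and a': "(\<lambda>(p, x). a' p x) \<in> borel \<rightarrow>\<^sub>M borel"
    and inv: "AE p in P. (\<forall>x. a' p (a p x) = x) \<and>
      (\<forall>F\<in>borel_measurable borel. (\<integral>\<^sup>+x. w x * F (a p x) \<partial>\<nu>) = (\<integral>\<^sup>+x. w x * F x \<partial>\<nu>))"
    and orbit: "\<And>h. h \<in> borel_measurable borel \<Longrightarrow>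
      AE x in \<nu>. (\<integral>\<^sup>+p. h (a p x) \<partial>P) = \<kappa> h \<and> (\<integral>\<^sup>+p. h (a' p x) \<partial>P) = \<kappa> h"
    and b: "b \<in> borel_measurable borel" "0 < \<kappa> b" "\<kappa> b < \<infinity>"
  obtains c :: real where "c > 0"
    "\<And>f. f \<in> borel_measurable borel \<Longrightarrow> (\<integral>\<^sup>+x. w x * f x \<partial>\<nu>) = ennreal c * \<kappa> f"
proof -
  define \<nu>' where "\<nu>' = density \<nu> w"
  have \<nu>_meas: "f \<in> borel_measurable \<nu> \<longleftrightarrow> f \<in> borel_measurable borel" for f :: "'x \<Rightarrow> ennreal"
    using measurable_cong_sets[OF \<nu>(2) refl] by blast
  have \<nu>': "sigma_finite_measure \<nu>'" "sets \<nu>' = sets borel"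
    unfolding \<nu>'_def by (rule sigma_finite_density_finite) (simp_all add: \<nu> \<nu>_meas w)
  have ni: "(\<integral>\<^sup>+x. f x \<partial>\<nu>') = (\<integral>\<^sup>+x. w x * f x \<partial>\<nu>)" if "f \<in> borel_measurable borel" for f
    unfolding \<nu>'_def using that w by (intro nn_integral_density) (simp_all add: \<nu>_meas)
  have nz: "emeasure \<nu>' (space \<nu>') \<noteq> 0"
  proof
    assume "emeasure \<nu>' (space \<nu>') = 0"
    then have "(\<integral>\<^sup>+x. 1 \<partial>\<nu>') = 0" by simp
    then have "(\<integral>\<^sup>+x. w x * 1 \<partial>\<nu>) = 0" by (subst ni[symmetric]) auto
    then have "AE x in \<nu>. w x = 0" using w by (simp add: nn_integral_0_iff_AE \<nu>_meas)
    with w(3) have "AE x in \<nu>. False" by eventually_elim simp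
    then have "emeasure \<nu> (space \<nu>) = 0" by (simp add: AE_iff_null null_setsD1)
    then show False using \<nu> by simp
  qed
  have orbit': "AE x in \<nu>'. (\<integral>\<^sup>+p. h (a p x) \<partial>P) = \<kappa> h \<and> (\<integral>\<^sup>+p. h (a' p x) \<partial>P) = \<kappa> h"
    if "h \<in> borel_measurable borel" for h
    unfolding \<nu>'_def using orbit[OF that] w by (subst AE_density) (auto simp: \<nu>_meas elim: eventually_mono)
  have a'_section: "(\<lambda>x. a' p x) \<in> borel \<rightarrow>\<^sub>M borel" "(\<lambda>x. a p x) \<in> borel \<rightarrow>\<^sub>M borel" for p
  proof -
    have "(\<lambda>x. (p, x)) \<in> borel \<rightarrow>\<^sub>M (borel :: ('p \<times> 'x) measure)"
      by (intro borel_measurable_continuous_onI continuous_intros)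
    from measurable_compose[OF this a'] measurable_compose[OF this a]
    show "(\<lambda>x. a' p x) \<in> borel \<rightarrow>\<^sub>M borel" "(\<lambda>x. a p x) \<in> borel \<rightarrow>\<^sub>M borel" by simp_all
  qed
  have swap: "\<kappa> h * (\<integral>\<^sup>+x. f x \<partial>\<nu>') = \<kappa> f * (\<integral>\<^sup>+x. h x \<partial>\<nu>')"
    if f: "f \<in> borel_measurable borel" and h: "h \<in> borel_measurable borel" for f h
  proof (rule orbit_integral_swap[where a = a and a' = a'])
    show "AE p in P. (\<integral>\<^sup>+x. f x * h (a p x) \<partial>\<nu>') = (\<integral>\<^sup>+x. f (a' p x) * h x \<partial>\<nu>')"
      using inv
    proof eventually_elim
      case (elim p)
      have m: "(\<lambda>x. f (a' p x) * h x) \<in> borel_measurable borel" "(\<lambda>x. f x * h (a p x)) \<in> borel_measurable borel"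
        using measurable_compose[OF a'_section(1) f] measurable_compose[OF a'_section(2) h] f h by measurable
      \<comment> \<open>Invariance is applied to the product of \<open>h\<close> with
        \<open>f\<close> after the inverse action, so that the two actions cancel inside
        \<open>f\<close>.\<close>
      from bspec[OF conjunct2[OF elim] m(1)]
      have "(\<integral>\<^sup>+x. w x * (f (a' p (a p x)) * h (a p x)) \<partial>\<nu>) = (\<integral>\<^sup>+x. w x * (f (a' p x) * h x) \<partial>\<nu>)" .
      then show ?case using elim by (simp add: ni m)
    qed
  qed (use f h orbit'[OF f] orbit'[OF h] P \<nu>' a a' in \<open>auto elim: eventually_mono\<close>)
  obtain D where D: "D \<in> sets \<nu>'" "0 < emeasure \<nu>' D" "emeasure \<nu>' D < \<infinity>"
    using sigma_finite_measure_pos_finite_set[OF \<nu>'(1) nz] by blast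
  obtain c :: real where c: "c > 0" "\<And>f. f \<in> borel_measurable borel \<Longrightarrow> (\<integral>\<^sup>+x. f x \<partial>\<nu>') = ennreal c * \<kappa> f"
  proof (rule proportional_of_swap[of borel \<kappa> "\<lambda>f. \<integral>\<^sup>+x. f x \<partial>\<nu>'" b "indicator D"])
    show "indicator D \<in> borel_measurable borel" using D \<nu>' by (simp add: borel_measurable_indicator)
  qed (use b D swap in simp_all)
  then show ?thesis using that by (simp add: ni)
qed

subsection \<open>Lebesgue measures on subspaces\<close>

text \<open>A Lebesgue measure on the subspace \<open>V\<close>, in some normalization, seen as a Borel measure on the
whole space; \<open>d\<close> is the dimension of \<open>V\<close>.\<close>
locale leb_on =
  fixes V :: "'a::euclidean_space set" and \<Lambda> :: "'a measure" and d :: real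
  assumes subsp: "subspace V"
    and sets_leb[measurable_cong]: "sets \<Lambda> = sets borel"
    and AE_leb: "AE x in \<Lambda>. x \<in> V"
    and leb_nonzero: "emeasure \<Lambda> (space \<Lambda>) \<noteq> 0"
    and leb_cball: "\<And>r. emeasure \<Lambda> (cball 0 r) < \<infinity>"
    and leb_translate: "\<And>v f. v \<in> V \<Longrightarrow> f \<in> borel_measurable borel \<Longrightarrow>
        (\<integral>\<^sup>+x. f (x + v) \<partial>\<Lambda>) = (\<integral>\<^sup>+x. f x \<partial>\<Lambda>)"
    and leb_dilate: "\<And>r f. r > 0 \<Longrightarrow> f \<in> borel_measurable borel \<Longrightarrow>
        (\<integral>\<^sup>+x. f (r *\<^sub>R x) \<partial>\<Lambda>) = ennreal (r powr - d) * (\<integral>\<^sup>+x. f x \<partial>\<Lambda>)"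
begin

lemma space_leb: "space \<Lambda> = UNIV"
  using sets_eq_imp_space_eq[OF sets_leb] by simp

lemma UN_cball: "(\<Union>n::nat. cball (0::'a) (real n)) = UNIV"
  by (auto simp: real_arch_simple)

lemma sigma_finite_leb: "sigma_finite_measure \<Lambda>"
proof
  show "\<exists>A. countable A \<and> A \<subseteq> sets \<Lambda> \<and> \<Union> A = space \<Lambda> \<and> (\<forall>a\<in>A. emeasure \<Lambda> a \<noteq> \<infinity>)"
    using UN_cball leb_cball
    by (intro exI[of _ "range (\<lambda>n::nat. cball 0 (real n))"]) (auto simp: sets_leb space_leb less_top)
qed

text \<open>Countably many balls cover the space, so one of them has positive mass, and a dilation
  carries it to any other radius.\<close>

lemma cball_pos:
  assumes "r > 0" shows "0 < emeasure \<Lambda> (cball 0 r)"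
proof -
  have "\<exists>n::nat. emeasure \<Lambda> (cball 0 (real n)) \<noteq> 0"
  proof (rule ccontr)
    assume "\<not> ?thesis"
    then have "\<And>n::nat. cball 0 (real n) \<in> null_sets \<Lambda>" by (auto simp: sets_leb)
    then have "(\<Union>n::nat. cball (0::'a) (real n)) \<in> null_sets \<Lambda>" by (rule null_sets_UN)
    then show False using UN_cball leb_nonzero by (metis null_setsD1 space_leb)
  qed
  then obtain n :: nat where n: "emeasure \<Lambda> (cball 0 (real n)) \<noteq> 0" by blast
  show ?thesis
  proof (cases "real n \<le> r")
    case True
    then have "emeasure \<Lambda> (cball 0 (real n)) \<le> emeasure \<Lambda> (cball 0 r)"
      by (intro emeasure_mono) (auto simp: sets_leb)
    then show ?thesis using n by (metis leD not_gr_zero)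
  next
    case False
    then have n0: "real n > 0" using assms by simp
    let ?s = "real n / r"
    have s: "?s > 0" using n0 assms by simp
    have "(\<integral>\<^sup>+x. indicator (cball 0 (real n)) (?s *\<^sub>R x) \<partial>\<Lambda>) = (\<integral>\<^sup>+x. indicator (cball 0 r) x \<partial>\<Lambda>)"
      using s n0 assms by (intro nn_integral_cong) (auto simp: indicator_def field_simps split: if_splits)
    moreover have "(\<integral>\<^sup>+x. indicator (cball 0 (real n)) (?s *\<^sub>R x) \<partial>\<Lambda>)
        = ennreal (?s powr - d) * emeasure \<Lambda> (cball 0 (real n))"
      by (subst leb_dilate[OF s]) (auto simp: sets_leb intro!: borel_measurable_indicator)
    ultimately have "emeasure \<Lambda> (cball 0 r) = ennreal (?s powr - d) * emeasure \<Lambda> (cball 0 (real n))"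
      by (simp add: sets_leb)
    moreover have "0 < emeasure \<Lambda> (cball 0 (real n))" using n by (metis not_gr_zero)
    ultimately show ?thesis using s n0 assms by (simp add: ennreal_zero_less_mult_iff)
  qed
qed

text \<open>The subspace acts on itself by translations, and \<open>\<Lambda>\<close> is taken as
  the measure on the acting group. The inverse translation leaves \<open>f\<close> reflected;
  \<open>reflect\<close> removes this afterwards.\<close>

lemma swap_translate:
  assumes \<nu>: "leb_on V \<nu> d'"
    and f[measurable]: "f \<in> borel_measurable borel" and h[measurable]: "h \<in> borel_measurable borel"
  shows "(\<integral>\<^sup>+x. h x \<partial>\<Lambda>) * (\<integral>\<^sup>+x. f x \<partial>\<nu>) = (\<integral>\<^sup>+x. f (- x) \<partial>\<Lambda>) * (\<integral>\<^sup>+x. h x \<partial>\<nu>)"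
proof (rule orbit_integral_swap[where a = "\<lambda>p x. x + p" and a' = "\<lambda>p x. x - p"])
  interpret \<nu>: leb_on V \<nu> d' by fact
  show "AE p in \<Lambda>. (\<integral>\<^sup>+x. f x * h (x + p) \<partial>\<nu>) = (\<integral>\<^sup>+x. f (x - p) * h x \<partial>\<nu>)"
    using AE_leb
  proof eventually_elim
    case (elim p)
    have "(\<lambda>x. f (x - p) * h x) \<in> borel_measurable borel" by measurable
    from \<nu>.leb_translate[OF elim this] show ?case by simp
  qed
  show "AE x in \<nu>. (\<integral>\<^sup>+p. h (x + p) \<partial>\<Lambda>) = (\<integral>\<^sup>+x. h x \<partial>\<Lambda>)"
    using \<nu>.AE_leb
  proof eventually_elim
    case (elim x)
    from leb_translate[OF elim h] show ?case by (simp add: add.commute)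
  qed
  show "AE x in \<nu>. (\<integral>\<^sup>+p. f (x - p) \<partial>\<Lambda>) = (\<integral>\<^sup>+x. f (- x) \<partial>\<Lambda>)"
    using \<nu>.AE_leb
  proof eventually_elim
    case (elim x)
    have "- x \<in> V" using elim subsp by (simp add: subspace_neg)
    moreover have "(\<lambda>x. f (- x)) \<in> borel_measurable borel" by measurable
    ultimately show ?case using leb_translate[of "-x" "\<lambda>x. f (- x)"] by simp
  qed
  show "sigma_finite_measure \<Lambda>" "sigma_finite_measure \<nu>" "sets \<nu> = sets borel" "sets \<Lambda> = sets borel"
    by (fact sigma_finite_leb \<nu>.sigma_finite_leb sets_leb \<nu>.sets_leb)+
qed (auto simp: case_prod_beta' intro!: borel_measurable_continuous_onI continuous_intros)

lemma cball_integral: "(\<integral>\<^sup>+x. indicator (cball 0 1) x \<partial>\<Lambda>) = emeasure \<Lambda> (cball 0 1)"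
  by (simp add: sets_leb)

text \<open>In \<open>swap_translate\<close> with \<open>\<Lambda>\<close> in both roles, the mass
  of the unit ball appears on both sides and cancels.\<close>

lemma reflect:
  assumes f[measurable]: "f \<in> borel_measurable borel"
  shows "(\<integral>\<^sup>+x. f (- x) \<partial>\<Lambda>) = (\<integral>\<^sup>+x. f x \<partial>\<Lambda>)"
proof -
  let ?i = "indicator (cball 0 1) :: 'a \<Rightarrow> ennreal"
  have "(\<integral>\<^sup>+x. ?i x \<partial>\<Lambda>) * (\<integral>\<^sup>+x. f x \<partial>\<Lambda>) = (\<integral>\<^sup>+x. f (- x) \<partial>\<Lambda>) * (\<integral>\<^sup>+x. ?i x \<partial>\<Lambda>)"
    by (rule swap_translate[OF leb_on_axioms]) (auto intro!: borel_measurable_indicator)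
  then show ?thesis unfolding cball_integral
    using cball_pos[of 1] leb_cball[of 1] 
    by (auto simp: mult.commute[of _ "emeasure \<Lambda> (cball 0 1)"] ennreal_mult_cancel_left)
qed

lemma unique:
  assumes \<nu>: "leb_on V \<nu> d'"
  obtains c :: real where "c > 0"
    "\<And>f. f \<in> borel_measurable borel \<Longrightarrow> (\<integral>\<^sup>+x. f x \<partial>\<nu>) = ennreal c * (\<integral>\<^sup>+x. f x \<partial>\<Lambda>)"
proof -
  interpret \<nu>: leb_on V \<nu> d' by fact
  let ?i = "indicator (cball 0 1) :: 'a \<Rightarrow> ennreal"
  show ?thesis
  proof (rule proportional_of_swap[of borel "\<lambda>f. \<integral>\<^sup>+x. f x \<partial>\<Lambda>" "\<lambda>f. \<integral>\<^sup>+x. f x \<partial>\<nu>" ?i ?i])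
    fix f h :: "'a \<Rightarrow> ennreal" assume [measurable]: "f \<in> borel_measurable borel" "h \<in> borel_measurable borel"
    show "(\<integral>\<^sup>+x. h x \<partial>\<Lambda>) * (\<integral>\<^sup>+x. f x \<partial>\<nu>) = (\<integral>\<^sup>+x. f x \<partial>\<Lambda>) * (\<integral>\<^sup>+x. h x \<partial>\<nu>)"
      using swap_translate[OF \<nu>, of f h] reflect[of f] by simp
  qed (use cball_pos[of 1] leb_cball[of 1] \<nu>.cball_pos[of 1] \<nu>.leb_cball[of 1] that in
        \<open>auto simp: cball_integral \<nu>.cball_integral intro!: borel_measurable_indicator\<close>)
qed

lemma image:
  fixes \<phi> :: "'a \<Rightarrow> 'b::euclidean_space"
  assumes lin: "linear \<phi>" and inj: "inj_on \<phi> V"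
  shows "leb_on (\<phi> ` V) (distr \<Lambda> borel \<phi>) d"
proof
  have [measurable]: "\<phi> \<in> borel \<rightarrow>\<^sub>M borel"
    using lin by (intro borel_measurable_continuous_onI linear_continuous_on linear_linear[THEN iffD2])
  show "subspace (\<phi> ` V)" using lin subsp by (rule linear_subspace_image)
  then have [measurable]: "\<phi> ` V \<in> sets borel" by (intro borel_closed closed_subspace)
  show "sets (distr \<Lambda> borel \<phi>) = sets borel" by simp
  show "AE x in distr \<Lambda> borel \<phi>. x \<in> \<phi> ` V"
    using AE_leb by (subst AE_distr_iff) auto
  show "emeasure (distr \<Lambda> borel \<phi>) (space (distr \<Lambda> borel \<phi>)) \<noteq> 0"
    using leb_nonzero by (subst emeasure_distr) (auto simp: space_leb)
  show "emeasure (distr \<Lambda> borel \<phi>) (cball 0 r) < \<infinity>" for r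
  proof -
    \<comment> \<open>The preimage of a ball may be unbounded in the whole space. On
      \<open>V\<close>, however, injectivity bounds \<open>\<phi>\<close> from below, and
      \<open>\<Lambda>\<close> charges nothing else.\<close>
    obtain e where e: "e > 0" "\<And>x. x \<in> V \<Longrightarrow> norm (\<phi> x) \<ge> e * norm x"
      using injective_imp_isometric[of V \<phi>] closed_subspace[OF subsp] subsp lin inj
      by (metis linear_conv_bounded_linear linear_inj_on_iff_eq_0)
    have "emeasure (distr \<Lambda> borel \<phi>) (cball 0 r) = emeasure \<Lambda> {x. norm (\<phi> x) \<le> r}"
      by (subst emeasure_distr) (auto simp: space_leb vimage_def)
    also have "\<dots> \<le> emeasure \<Lambda> (cball 0 (r / e))"
    proof (rule emeasure_mono_AE)
      show "AE x in \<Lambda>. x \<in> {x. norm (\<phi> x) \<le> r} \<longrightarrow> x \<in> cball 0 (r / e)"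
        using AE_leb
      proof eventually_elim
        case (elim x)
        then show ?case using e(2)[OF elim] e(1) by (auto simp: field_simps)
      qed
    qed (auto simp: sets_leb)
    finally show ?thesis using leb_cball[of "r/e"] by (simp add: order_le_less_trans)
  qed
  fix f :: "'b \<Rightarrow> ennreal" assume f[measurable]: "f \<in> borel_measurable borel"
  show "(\<integral>\<^sup>+x. f (x + v) \<partial>distr \<Lambda> borel \<phi>) = (\<integral>\<^sup>+x. f x \<partial>distr \<Lambda> borel \<phi>)" if "v \<in> \<phi> ` V" for v
  proof -
    obtain w where w: "w \<in> V" "v = \<phi> w" using \<open>v \<in> \<phi> ` V\<close> by blast
    have "(\<integral>\<^sup>+x. f (\<phi> (x + w)) \<partial>\<Lambda>) = (\<integral>\<^sup>+x. f (\<phi> x) \<partial>\<Lambda>)"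
      by (rule leb_translate[OF w(1)]) measurable
    then show ?thesis using w lin by (simp add: nn_integral_distr linear_add)
  qed
  show "(\<integral>\<^sup>+x. f (r *\<^sub>R x) \<partial>distr \<Lambda> borel \<phi>) = ennreal (r powr - d) * (\<integral>\<^sup>+x. f x \<partial>distr \<Lambda> borel \<phi>)"
    if "r > 0" for r
  proof -
    have "(\<integral>\<^sup>+x. f (\<phi> (r *\<^sub>R x)) \<partial>\<Lambda>) = ennreal (r powr - d) * (\<integral>\<^sup>+x. f (\<phi> x) \<partial>\<Lambda>)"
      by (rule leb_dilate[OF that]) measurable
    then show ?thesis using lin by (simp add: nn_integral_distr linear_scale)
  qed
qed

text \<open>The image of \<open>\<Lambda>\<close> is again a Lebesgue measure on \<open>V\<close>,
  so uniqueness produces the Jacobian factor as an abstract constant, without a determinant of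
  \<open>\<phi>\<close>.\<close>

lemma linear_change:
  assumes lin: "linear \<phi>" and inj: "inj_on \<phi> V" and im: "\<phi> ` V = V"
  obtains c :: real where "c > 0"
    "\<And>f. f \<in> borel_measurable borel \<Longrightarrow> (\<integral>\<^sup>+x. f (\<phi> x) \<partial>\<Lambda>) = ennreal c * (\<integral>\<^sup>+x. f x \<partial>\<Lambda>)"
proof -
  have [measurable]: "\<phi> \<in> borel \<rightarrow>\<^sub>M borel"
    using lin by (intro borel_measurable_continuous_onI linear_continuous_on linear_linear[THEN iffD2])
  have "leb_on V (distr \<Lambda> borel \<phi>) d" using image[OF lin inj] im by simp
  from unique[OF this] obtain c :: real where c: "c > 0"
    "\<And>f. f \<in> borel_measurable borel \<Longrightarrow> (\<integral>\<^sup>+x. f x \<partial>distr \<Lambda> borel \<phi>) = ennreal c * (\<integral>\<^sup>+x. f x \<partial>\<Lambda>)" by blast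
  show ?thesis
  proof (rule that[OF c(1)])
    fix f :: "'a \<Rightarrow> ennreal" assume [measurable]: "f \<in> borel_measurable borel"
    show "(\<integral>\<^sup>+x. f (\<phi> x) \<partial>\<Lambda>) = ennreal c * (\<integral>\<^sup>+x. f x \<partial>\<Lambda>)"
      using c(2)[of f] by (simp add: nn_integral_distr)
  qed
qed

text \<open>The unit ball of \<open>V\<close> is preserved and has positive finite mass, which
  forces the constant of \<open>linear_change\<close> to be 1.\<close>

lemma isometry_change:
  assumes lin: "linear \<phi>" and im: "\<phi> ` V = V" and iso: "\<And>x. x \<in> V \<Longrightarrow> norm (\<phi> x) = norm x"
    and f: "f \<in> borel_measurable borel"
  shows "(\<integral>\<^sup>+x. f (\<phi> x) \<partial>\<Lambda>) = (\<integral>\<^sup>+x. f x \<partial>\<Lambda>)"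
proof -
  have inj: "inj_on \<phi> V"
    using lin subsp iso by (metis linear_inj_on_iff_eq_0 norm_eq_zero)
  obtain c where c: "c > 0" "\<And>f. f \<in> borel_measurable borel \<Longrightarrow> (\<integral>\<^sup>+x. f (\<phi> x) \<partial>\<Lambda>) = ennreal c * (\<integral>\<^sup>+x. f x \<partial>\<Lambda>)"
    using linear_change[OF lin inj im] by blast
  let ?i = "indicator (cball 0 1) :: 'a \<Rightarrow> ennreal"
  have "(\<integral>\<^sup>+x. ?i (\<phi> x) \<partial>\<Lambda>) = (\<integral>\<^sup>+x. ?i x \<partial>\<Lambda>)"
    using AE_leb by (intro nn_integral_cong_AE) (auto simp: indicator_def iso elim!: eventually_mono)
  then have "ennreal c * emeasure \<Lambda> (cball 0 1) = emeasure \<Lambda> (cball 0 1)"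
    using c(2)[of ?i] by (simp add: cball_integral borel_measurable_indicator)
  then have "emeasure \<Lambda> (cball 0 1) * ennreal c = emeasure \<Lambda> (cball 0 1) * 1"
    by (simp add: mult.commute)
  then have "ennreal c = 1"
    using cball_pos[of 1] leb_cball[of 1] by (subst (asm) ennreal_mult_cancel_left) auto
  then show ?thesis using c(2)[OF f] by simp
qed

text \<open>By translation invariance, the indicator of \<open>Z\<close> may be averaged over a segment in direction \<open>e\<close>.\<close>
lemma AE_not_in_of_finite_lines:
  assumes e: "e \<in> V" and Z[measurable]: "Z \<in> sets borel" and fin: "\<And>x. finite {t::real. x + t *\<^sub>R e \<in> Z}"
  shows "AE x in \<Lambda>. x \<notin> Z"
proof -
  let ?z = "indicator Z :: 'a \<Rightarrow> ennreal"
  let ?U = "uniform_measure lborel {0..1::real}"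
  interpret U: prob_space ?U by (rule prob_space_uniform_measure) auto
  have sU: "sets ?U = sets borel" by simp
  have "emeasure \<Lambda> Z = (\<integral>\<^sup>+x. ?z x \<partial>\<Lambda>)" by (simp add: sets_leb)
  also have "\<dots> = (\<integral>\<^sup>+t. (\<integral>\<^sup>+x. ?z x \<partial>\<Lambda>) \<partial>?U)" using U.emeasure_space_1 by simp
  also have "\<dots> = (\<integral>\<^sup>+t. (\<integral>\<^sup>+x. ?z (x + t *\<^sub>R e) \<partial>\<Lambda>) \<partial>?U)"
    using e subsp by (intro nn_integral_cong leb_translate[symmetric]) (auto simp: subspace_scale)
  also have "\<dots> = (\<integral>\<^sup>+x. (\<integral>\<^sup>+t. ?z (x + t *\<^sub>R e) \<partial>?U) \<partial>\<Lambda>)"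
  proof (rule nn_integral_swap_borel)
    show "sigma_finite_measure ?U" by unfold_locales
    show "sigma_finite_measure \<Lambda>" by (rule sigma_finite_leb)
    have "(\<lambda>z::real \<times> 'a. snd z + fst z *\<^sub>R e) \<in> borel \<rightarrow>\<^sub>M borel"
      by (intro borel_measurable_continuous_onI continuous_intros)
    from measurable_compose[OF this borel_measurable_indicator[OF Z]]
    show "(\<lambda>(t, x). ?z (x + t *\<^sub>R e)) \<in> borel_measurable borel" by (simp add: case_prod_beta')
  qed (simp_all add: sets_leb)
  also have "\<dots> = (\<integral>\<^sup>+x. 0 \<partial>\<Lambda>)"
  proof (rule nn_integral_cong)
    fix x
    have "(\<integral>\<^sup>+t. ?z (x + t *\<^sub>R e) \<partial>?U) = (\<integral>\<^sup>+t. indicator {t. x + t *\<^sub>R e \<in> Z} t \<partial>?U)"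
      by (intro nn_integral_cong) (auto simp: indicator_def)
    also have "\<dots> = emeasure ?U {t. x + t *\<^sub>R e \<in> Z}"
      using fin[of x] by (intro nn_integral_indicator) (auto intro: borel_closed finite_imp_closed)
    also have "\<dots> = 0"
    proof -
      have "emeasure lborel ({0..1} \<inter> {t. x + t *\<^sub>R e \<in> Z}) = 0"
        using fin[of x] by (intro emeasure_lborel_countable countable_finite) auto
      then show ?thesis using fin[of x] by (subst emeasure_uniform_measure) (auto intro: borel_closed finite_imp_closed)
    qed
    finally show "(\<integral>\<^sup>+t. ?z (x + t *\<^sub>R e) \<partial>?U) = 0" .
  qed
  finally have "emeasure \<Lambda> Z = 0" by simp
  then have "Z \<in> null_sets \<Lambda>" by (auto simp: sets_leb)
  then show ?thesis by (rule AE_not_in)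
qed

end

lemma leb_on_lborel: "leb_on (UNIV :: 'a::euclidean_space set) lborel (real DIM('a))"
proof
  show "emeasure lborel (cball (0::'a) r) < \<infinity>" for r
    using emeasure_lborel_cball_finite[of 0 r] by (simp add: less_top)
  fix f :: "'a \<Rightarrow> ennreal" assume f[measurable]: "f \<in> borel_measurable borel"
  show "(\<integral>\<^sup>+x. f (x + v) \<partial>lborel) = (\<integral>\<^sup>+x. f x \<partial>lborel)" for v
  proof -
    have "(\<integral>\<^sup>+x. f x \<partial>lborel) = (\<integral>\<^sup>+x. f x \<partial>distr lborel borel ((+) v))" by (simp add: lborel_distr_plus)
    then show ?thesis by (simp add: nn_integral_distr add.commute)
  qed
  show "(\<integral>\<^sup>+x. f (r *\<^sub>R x) \<partial>lborel) = ennreal (r powr - real DIM('a)) * (\<integral>\<^sup>+x. f x \<partial>lborel)" if "r > 0" for r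
  proof -
    have "(\<integral>\<^sup>+x. f x \<partial>lborel) = (\<integral>\<^sup>+x. f x \<partial>density (distr lborel borel (\<lambda>x. 0 + r *\<^sub>R x)) (\<lambda>_. \<bar>r\<bar>^DIM('a)))"
      using lborel_affine[of r "0::'a"] that by simp
    also have "\<dots> = ennreal (r powr real DIM('a)) * (\<integral>\<^sup>+x. f (r *\<^sub>R x) \<partial>lborel)"
      using that by (subst nn_integral_density) (auto simp: nn_integral_distr nn_integral_cmult powr_realpow)
    finally have "ennreal (r powr - real DIM('a)) * (\<integral>\<^sup>+x. f x \<partial>lborel) =
       ennreal (r powr - real DIM('a)) * (ennreal (r powr real DIM('a)) * (\<integral>\<^sup>+x. f (r *\<^sub>R x) \<partial>lborel))" by simp
    also have "\<dots> = ennreal 1 * (\<integral>\<^sup>+x. f (r *\<^sub>R x) \<partial>lborel)"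
      using that by (simp add: mult.assoc[symmetric] ennreal_mult[symmetric] powr_minus)
    finally show ?thesis by simp
  qed
qed auto

lemma leb_on_prod:
  assumes V: "leb_on V \<Lambda> d" and W: "leb_on W \<Lambda>' d'"
  shows "leb_on (V \<times> W) (\<Lambda> \<Otimes>\<^sub>M \<Lambda>') (d + d')"
proof -
  interpret V: leb_on V \<Lambda> d by fact
  interpret W: leb_on W \<Lambda>' d' by fact
  interpret pair_sigma_finite \<Lambda> \<Lambda>'
    using V.sigma_finite_leb W.sigma_finite_leb by (simp add: pair_sigma_finite_def)
  have sb: "sets (\<Lambda> \<Otimes>\<^sub>M \<Lambda>') = sets borel"
    using V.sets_leb W.sets_leb by (simp add: borel_prod[symmetric] cong: sets_pair_measure_cong)
  have ni: "(\<integral>\<^sup>+z. f z \<partial>(\<Lambda> \<Otimes>\<^sub>M \<Lambda>')) = (\<integral>\<^sup>+x. \<integral>\<^sup>+y. f (x, y) \<partial>\<Lambda>' \<partial>\<Lambda>)"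
    if "f \<in> borel_measurable borel" for f :: "'a \<times> 'b \<Rightarrow> ennreal"
    using that by (subst sigma_finite_measure.nn_integral_fst[OF W.sigma_finite_leb, symmetric]) (auto simp: sb cong: measurable_cong_sets)
  have m1: "(\<lambda>y. f (x, y)) \<in> borel_measurable borel" if f: "f \<in> borel_measurable borel" 
    for f :: "'a \<times> 'b \<Rightarrow> ennreal" and x
  proof -
    have "(\<lambda>y. (x, y)) \<in> borel \<rightarrow>\<^sub>M (borel :: ('a \<times> 'b) measure)"
      by (intro borel_measurable_continuous_onI continuous_intros)
    from measurable_compose[OF this f] show ?thesis .
  qed
  have m2: "(\<lambda>x. \<integral>\<^sup>+y. f (x, y) \<partial>\<Lambda>') \<in> borel_measurable borel" if "f \<in> borel_measurable borel"
    for f :: "'a \<times> 'b \<Rightarrow> ennreal"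
    using borel_measurable_nn_integral_param[OF W.sigma_finite_leb W.sets_leb, of "\<lambda>x y. f (x, y)"] that
    by simp
  show ?thesis
  proof
    show "subspace (V \<times> W)" using V.subsp W.subsp by (rule subspace_Times)
    show "sets (\<Lambda> \<Otimes>\<^sub>M \<Lambda>') = sets borel" by (rule sb)
    have cl: "V \<times> W \<in> sets borel"
      using V.subsp W.subsp by (intro borel_closed closed_Times closed_subspace)
    show "AE x in \<Lambda> \<Otimes>\<^sub>M \<Lambda>'. x \<in> V \<times> W"
    proof (rule AE_pair_measure)
      show "{x \<in> space (\<Lambda> \<Otimes>\<^sub>M \<Lambda>'). x \<in> V \<times> W} \<in> sets (\<Lambda> \<Otimes>\<^sub>M \<Lambda>')"
        using cl sb sets_eq_imp_space_eq[OF sb] by simp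
      show "AE x in \<Lambda>. AE y in \<Lambda>'. (x, y) \<in> V \<times> W"
        using V.AE_leb by eventually_elim (use W.AE_leb in auto)
    qed
    show "emeasure (\<Lambda> \<Otimes>\<^sub>M \<Lambda>') (space (\<Lambda> \<Otimes>\<^sub>M \<Lambda>')) \<noteq> 0"
      using V.leb_nonzero W.leb_nonzero
      by (simp add: space_pair_measure sigma_finite_measure.emeasure_pair_measure_Times[OF W.sigma_finite_leb])
    show "emeasure (\<Lambda> \<Otimes>\<^sub>M \<Lambda>') (cball 0 r) < \<infinity>" for r
    proof -
      have "emeasure (\<Lambda> \<Otimes>\<^sub>M \<Lambda>') (cball 0 r) \<le> emeasure (\<Lambda> \<Otimes>\<^sub>M \<Lambda>') (cball 0 r \<times> cball 0 r)"
      proof (rule emeasure_mono)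
        show "cball 0 r \<subseteq> cball (0::'a) r \<times> cball (0::'b) r"
        proof
          fix z :: "'a \<times> 'b" assume z: "z \<in> cball 0 r"
          have "norm (fst z) \<le> norm z" "norm (snd z) \<le> norm z" using norm_fst_le[of "fst z" "snd z"] norm_snd_le[of "snd z" "fst z"] by simp_all
          with z show "z \<in> cball 0 r \<times> cball 0 r" by (cases z) auto
        qed
        show "cball 0 r \<times> cball 0 r \<in> sets (\<Lambda> \<Otimes>\<^sub>M \<Lambda>')"
          by (intro pair_measureI) (auto simp: V.sets_leb W.sets_leb)
      qed
      also have "\<dots> = emeasure \<Lambda> (cball 0 r) * emeasure \<Lambda>' (cball 0 r)"
        by (subst sigma_finite_measure.emeasure_pair_measure_Times[OF W.sigma_finite_leb]) (auto simp: V.sets_leb W.sets_leb)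
      also have "\<dots> < \<infinity>" using V.leb_cball[of r] W.leb_cball[of r] by (simp add: ennreal_mult_less_top)
      finally show ?thesis .
    qed
    fix f :: "'a \<times> 'b \<Rightarrow> ennreal" assume f[measurable]: "f \<in> borel_measurable borel"
    show "(\<integral>\<^sup>+x. f (x + v) \<partial>(\<Lambda> \<Otimes>\<^sub>M \<Lambda>')) = (\<integral>\<^sup>+x. f x \<partial>(\<Lambda> \<Otimes>\<^sub>M \<Lambda>'))" if "v \<in> V \<times> W" for v
    proof -
      obtain a b where v: "v = (a, b)" "a \<in> V" "b \<in> W" using \<open>v \<in> V \<times> W\<close> by blast
      have "(\<integral>\<^sup>+x. f (x + v) \<partial>(\<Lambda> \<Otimes>\<^sub>M \<Lambda>')) = (\<integral>\<^sup>+x. \<integral>\<^sup>+y. f (x + a, y + b) \<partial>\<Lambda>' \<partial>\<Lambda>)"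
        using v by (subst ni) auto
      also have "\<dots> = (\<integral>\<^sup>+x. \<integral>\<^sup>+y. f (x + a, y) \<partial>\<Lambda>' \<partial>\<Lambda>)"
        using W.leb_translate[OF v(3) m1[OF f]] by simp
      also have "\<dots> = (\<integral>\<^sup>+x. \<integral>\<^sup>+y. f (x, y) \<partial>\<Lambda>' \<partial>\<Lambda>)"
        using V.leb_translate[OF v(2) m2[OF f]] by simp
      finally show ?thesis using ni f by simp
    qed
    show "(\<integral>\<^sup>+x. f (r *\<^sub>R x) \<partial>(\<Lambda> \<Otimes>\<^sub>M \<Lambda>')) = ennreal (r powr - (d + d')) * (\<integral>\<^sup>+x. f x \<partial>(\<Lambda> \<Otimes>\<^sub>M \<Lambda>'))"
      if r: "r > 0" for r
    proof -
      have "(\<integral>\<^sup>+x. f (r *\<^sub>R x) \<partial>(\<Lambda> \<Otimes>\<^sub>M \<Lambda>')) = (\<integral>\<^sup>+x. \<integral>\<^sup>+y. f (r *\<^sub>R x, r *\<^sub>R y) \<partial>\<Lambda>' \<partial>\<Lambda>)"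
        by (subst ni) auto
      also have "\<dots> = (\<integral>\<^sup>+x. ennreal (r powr - d') * (\<integral>\<^sup>+y. f (r *\<^sub>R x, y) \<partial>\<Lambda>') \<partial>\<Lambda>)"
        using W.leb_dilate[OF r m1[OF f]] by simp
      also have "\<dots> = ennreal (r powr - d') * (\<integral>\<^sup>+x. \<integral>\<^sup>+y. f (r *\<^sub>R x, y) \<partial>\<Lambda>' \<partial>\<Lambda>)"
        using measurable_compose[OF _ m2[OF f], of "\<lambda>x. r *\<^sub>R x" borel]
        by (intro nn_integral_cmult) (simp add: V.sets_leb cong: measurable_cong_sets)
      also have "\<dots> = ennreal (r powr - d') * (ennreal (r powr - d) * (\<integral>\<^sup>+x. \<integral>\<^sup>+y. f (x, y) \<partial>\<Lambda>' \<partial>\<Lambda>))"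
        using V.leb_dilate[OF r m2[OF f]] by simp
      also have "\<dots> = ennreal (r powr - (d + d')) * (\<integral>\<^sup>+x. \<integral>\<^sup>+y. f (x, y) \<partial>\<Lambda>' \<partial>\<Lambda>)"
        using r by (simp add: mult.assoc[symmetric] ennreal_mult[symmetric] powr_add[symmetric] add.commute)
      finally show ?thesis using ni f by simp
    qed
  qed
qed

subsection \<open>Adjoints and positive definite matrices\<close>

lemma borel_measurable_vec:
  fixes f :: "'a \<Rightarrow> 'b::euclidean_space^'n"
  assumes "\<And>i. (\<lambda>x. f x $ i) \<in> borel_measurable M"
  shows "f \<in> borel_measurable M"
proof (subst borel_measurable_euclidean_space, intro ballI)
  fix b :: "'b^'n" assume "b \<in> Basis"
  then obtain i u where b: "b = axis i u" by (auto simp: Basis_vec_def)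
  have [measurable]: "(\<lambda>x. f x $ i) \<in> borel_measurable M" by (rule assms)
  have "(\<lambda>x. inner (f x $ i) u) \<in> borel_measurable M" by measurable
  then show "(\<lambda>x. inner (f x) b) \<in> borel_measurable M" by (simp add: b inner_axis)
qed

lemma borel_measurable_vec_lambda[measurable (raw)]:
  fixes f :: "'n::finite \<Rightarrow> 'a \<Rightarrow> 'b::euclidean_space"
  assumes "\<And>i. f i \<in> borel_measurable M"
  shows "(\<lambda>x. \<chi> i. f i x) \<in> borel_measurable M"
  using assms by (intro borel_measurable_vec) simp

lemma borel_measurable_vec_nth'[measurable (raw)]:
  fixes f :: "'a \<Rightarrow> 'b::euclidean_space^'n"
  assumes f: "f \<in> borel_measurable M"
  shows "(\<lambda>x. f x $ i) \<in> borel_measurable M"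
proof -
  have "(\<lambda>x::'b^'n. x $ i) \<in> borel \<rightarrow>\<^sub>M borel"
    by (intro borel_measurable_continuous_onI continuous_intros)
  from measurable_compose[OF f this] show ?thesis .
qed

lemma borel_measurable_cnj[measurable]: "cnj \<in> borel \<rightarrow>\<^sub>M borel"
  by (intro borel_measurable_continuous_onI continuous_intros)

lemma borel_measurable_matrix_mult[measurable (raw)]:
  fixes A :: "'a \<Rightarrow> complex^'n^'m" and B :: "'a \<Rightarrow> complex^'k^'n"
  assumes [measurable]: "A \<in> borel_measurable M" "B \<in> borel_measurable M"
  shows "(\<lambda>x. A x ** B x) \<in> borel_measurable M"
  unfolding matrix_matrix_mult_def by measurable

lemma borel_measurable_mat_adj[measurable (raw)]:
  fixes A :: "'a \<Rightarrow> complex^'n^'m"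
  assumes [measurable]: "A \<in> borel_measurable M"
  shows "(\<lambda>x. mat_adj (A x)) \<in> borel_measurable M"
  unfolding mat_adj_def by measurable

lemma borel_measurable_det[measurable (raw)]:
  fixes A :: "'a \<Rightarrow> complex^'n^'n"
  assumes [measurable]: "A \<in> borel_measurable M"
  shows "(\<lambda>x. det (A x)) \<in> borel_measurable M"
  unfolding det_def by measurable

lemma matrix_inv_eqI:
  fixes A :: "'a::field^'n^'n"
  assumes "A ** B = mat 1" shows "matrix_inv A = B"
proof -
  have "B ** A = mat 1" using assms matrix_left_right_inverse by blast
  show ?thesis unfolding matrix_inv_def
  proof (rule some_equality)
    fix C assume "A ** C = mat 1 \<and> C ** A = mat 1"
    then have "C ** (A ** B) = B" by (simp add: matrix_mul_assoc)
    then show "C = B" using assms by simp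
  qed (use assms \<open>B ** A = mat 1\<close> in simp)
qed

lemma matrix_inv:
  fixes A :: "'a::field^'n^'n"
  assumes "det A \<noteq> 0"
  shows "A ** matrix_inv A = mat 1" "matrix_inv A ** A = mat 1"
proof -
  obtain B where "A ** B = mat 1" using assms by (metis invertible_det_nz invertible_def)
  then show "A ** matrix_inv A = mat 1" using matrix_inv_eqI by metis
  then show "matrix_inv A ** A = mat 1" using matrix_left_right_inverse by blast
qed

lemma det_nonzero_kernel:
  fixes A :: "'a::field^'n^'n"
  assumes "det A \<noteq> 0" "A *v x = 0" shows "x = 0"
proof -
  have "matrix_inv A *v (A *v x) = x" using assms(1) by (simp add: matrix_vector_mul_assoc matrix_inv)
  then show ?thesis using assms(2) by simp
qed

text \<open>Off the invertible matrices \<^const>\<open>matrix_inv\<close> is a constant, and on them Cramer's rule applies.\<close>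
lemma borel_measurable_matrix_inv[measurable (raw)]:
  fixes A :: "'a \<Rightarrow> complex^'n^'n"
  assumes [measurable]: "A \<in> borel_measurable M"
  shows "(\<lambda>x. matrix_inv (A x)) \<in> borel_measurable M"
proof -
  define c :: "complex^'n^'n" where "c = (SOME A'. False)"
  define C where "C = (\<lambda>(A::complex^'n^'n) k l. det (\<chi> i j. if j = k then (if i = l then 1 else 0) else A $ i $ j) / det A)"
  have "matrix_inv B = (if det B = 0 then c else \<chi> k l. C B k l)" for B :: "complex^'n^'n"
  proof (cases "det B = 0")
    case True
    then have "\<And>A'. \<not> (B ** A' = mat 1 \<and> A' ** B = mat 1)"
      by (metis invertible_def invertible_det_nz)
    then have "(\<lambda>A'. B ** A' = mat 1 \<and> A' ** B = mat 1) = (\<lambda>A'. False)" by (intro ext) blast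
    then show ?thesis using True by (simp add: matrix_inv_def c_def)
  next
    case False
    have "matrix_inv B $ k $ l = C B k l" for k l
    proof -
      have ax: "(\<chi> i j. if j = k then axis l 1 $ i else B $ i $ j) =
          (\<chi> i j. if j = k then (if i = l then 1 else 0) else B $ i $ j)" for k
        by (simp add: vec_eq_iff axis_def)
      have "B *v column l (matrix_inv B) = axis l 1"
      proof -
        have "B *v column l (matrix_inv B) = column l (B ** matrix_inv B)"
          by (simp add: vec_eq_iff column_def matrix_vector_mult_def matrix_matrix_mult_def)
        then show ?thesis
          unfolding matrix_inv(1)[OF False] by (simp add: vec_eq_iff column_def mat_def axis_def)
      qed
      then have "column l (matrix_inv B) = (\<chi> k. det (\<chi> i j. if j = k then axis l 1 $ i else B $ i $ j) / det B)"
        using cramer[OF False] by blast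
      then show ?thesis unfolding ax by (simp add: C_def column_def vec_eq_iff)
    qed
    then show ?thesis using False by (simp add: vec_eq_iff)
  qed
  then have "(\<lambda>x. matrix_inv (A x)) = (\<lambda>x. if det (A x) = 0 then c else \<chi> k l. C (A x) k l)" by simp
  also have "\<dots> \<in> borel_measurable M"
  proof -
    have [measurable]: "(\<lambda>x. if j = k then (if i = l then 1 else 0) else A x $ i $ j) \<in> borel_measurable M" 
      for i j k l by (cases "j = k") simp_all
    show ?thesis unfolding C_def by measurable
  qed
  finally show ?thesis .
qed

section \<open>Algebra of adjoints, the Hermitian inner product and the Frobenius norm\<close>

lemma mat_adj_mat_adj[simp]: "mat_adj (mat_adj A) = A"
  by (simp add: mat_adj_def vec_eq_iff)

lemma mat_adj_mult: "mat_adj (A ** B) = mat_adj B ** mat_adj A"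
  by (simp add: mat_adj_def matrix_matrix_mult_def vec_eq_iff mult.commute)

lemma mat_adj_add: "mat_adj (A + B) = mat_adj A + mat_adj B"
  and mat_adj_diff: "mat_adj (A - B) = mat_adj A - mat_adj B"
  and mat_adj_scaleR: "mat_adj (r *\<^sub>R A) = r *\<^sub>R mat_adj A"
  by (simp_all add: mat_adj_def vec_eq_iff)

lemma mat_adj_1[simp]: "mat_adj (mat 1) = mat 1"
  by (simp add: mat_adj_def mat_def vec_eq_iff)

lemma mat_adj_mat: "mat_adj (mat z) = mat (cnj z)"
  by (simp add: mat_adj_def mat_def vec_eq_iff)

lemma linear_mat_adj: "linear mat_adj"
  by (rule linearI) (simp_all add: mat_adj_add mat_adj_scaleR)

lemma det_mat_adj: "det (mat_adj A) = cnj (det A)"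
proof -
  have "mat_adj A = transpose (\<chi> i j. cnj (A $ i $ j))" by (simp add: mat_adj_def transpose_def)
  then have "det (mat_adj A) = det (\<chi> i j. cnj (A $ i $ j))" by simp
  also have "\<dots> = cnj (det A)" by (simp add: det_def)
  finally show ?thesis .
qed

lemma matrix_mult_diff_ldistrib: "A ** (B - C) = A ** B - A ** C"
  for A :: "'a::ring_1^'n^'m"
  by (vector matrix_matrix_mult_def sum_subtractf right_diff_distrib)

lemma matrix_mult_diff_rdistrib: "(B - C) ** A = B ** A - C ** A"
  for A :: "'a::ring_1^'n^'m"
  by (vector matrix_matrix_mult_def sum_subtractf left_diff_distrib)

lemma matrix_mult_add_rdistrib: "(B + C) ** A = B ** A + C ** A"
  for A :: "'a::semiring_1^'n^'m"
  by (vector matrix_matrix_mult_def sum.distrib distrib_right)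

lemma matrix_mult_scaleR_left: "(r *\<^sub>R A) ** B = r *\<^sub>R (A ** B)"
  and matrix_mult_scaleR_right: "A ** (r *\<^sub>R B) = r *\<^sub>R (A ** B)"
  for A :: "'a::real_algebra_1^'n^'m"
  by (simp_all add: matrix_matrix_mult_def vec_eq_iff scaleR_sum_right)

lemma mat_of_real: "mat (of_real r) = r *\<^sub>R (mat 1 :: complex^'n^'n)"
  by (simp add: mat_def vec_eq_iff of_real_def)

lemma mat_of_real_mult: "mat (of_real r) ** A = r *\<^sub>R A" "A ** mat (of_real r) = r *\<^sub>R A"
  for A :: "complex^'n^'m"
  by (simp_all add: mat_of_real matrix_mult_scaleR_left matrix_mult_scaleR_right)

lemma matrix_vector_mult_scaleR_complex: "A *v (r *\<^sub>R x) = r *\<^sub>R (A *v x)"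
  for A :: "complex^'n^'m"
  by (simp add: matrix_vector_mult_def vec_eq_iff scaleR_sum_right)

lemma det_mat: "det (mat z :: complex^'n^'n) = z ^ CARD('n)"
  by (subst det_diagonal) (auto simp: mat_def)

text \<open>The complex inner product, conjugate linear in the first argument. Its real part is the
  library's \<open>inner\<close>.\<close>

definition cip :: "complex^'n \<Rightarrow> complex^'n \<Rightarrow> complex" where
  "cip x y = (\<Sum>i\<in>UNIV. cnj (x $ i) * y $ i)"

lemma herm_form_cip: "herm_form M x = cip x (M *v x)"
  by (simp add: herm_form_def cip_def matrix_vector_mult_def sum_distrib_left mult.assoc)

lemma cip_adj: "cip (A *v x) y = cip x (mat_adj A *v y)"
proof -
  have "cip (A *v x) y = (\<Sum>i\<in>UNIV. \<Sum>j\<in>UNIV. cnj (A $ i $ j) * cnj (x $ j) * y $ i)"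
    by (simp add: cip_def matrix_vector_mult_def sum_distrib_right)
  also have "\<dots> = (\<Sum>j\<in>UNIV. \<Sum>i\<in>UNIV. cnj (A $ i $ j) * cnj (x $ j) * y $ i)" by (rule sum.swap)
  also have "\<dots> = cip x (mat_adj A *v y)"
    by (simp add: cip_def matrix_vector_mult_def mat_adj_def sum_distrib_left ac_simps)
  finally show ?thesis .
qed

lemma cip_cnj: "cnj (cip x y) = cip y x"
  by (simp add: cip_def mult.commute)

lemma cip_self: "cip x x = of_real ((norm x)\<^sup>2)"
proof -
  have "(norm x)\<^sup>2 = (\<Sum>i\<in>UNIV. (cmod (x $ i))\<^sup>2)"
    by (simp add: norm_vec_def L2_set_def sum_nonneg)
  then show ?thesis by (simp add: cip_def complex_norm_square mult.commute del: of_real_power)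
qed

lemma cip_add: "cip x (y + z) = cip x y + cip x z" "cip (x + y) z = cip x z + cip y z"
  and cip_diff: "cip x (y - z) = cip x y - cip x z"
  and cip_scaleR: "cip x (r *\<^sub>R y) = r *\<^sub>R cip x y" "cip (r *\<^sub>R x) y = r *\<^sub>R cip x y"
  by (simp_all add: cip_def sum.distrib sum_subtractf algebra_simps scaleR_sum_right)

lemma herm_form_congruence: "herm_form (mat_adj g ** S ** g) x = herm_form S (g *v x)"
  by (simp add: herm_form_cip cip_adj matrix_vector_mul_assoc matrix_mul_assoc)

lemma herm_form_gram: "herm_form (mat_adj X ** X) x = of_real ((norm (X *v x))\<^sup>2)"
proof -
  have "herm_form (mat_adj X ** X) x = cip (X *v x) (X *v x)"
    by (simp add: herm_form_cip cip_adj matrix_vector_mul_assoc)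
  then show ?thesis by (simp add: cip_self)
qed

lemma herm_form_add: "herm_form (A + B) x = herm_form A x + herm_form B x"
  and herm_form_diff: "herm_form (A - B) x = herm_form A x - herm_form B x"
  by (simp_all add: herm_form_cip algebra_simps cip_add cip_diff)

lemma herm_form_1: "herm_form (mat 1) x = of_real ((norm x)\<^sup>2)"
  by (simp add: herm_form_cip cip_self)

text \<open>The norm of the nested vector type is the Frobenius norm; in trace form its unitary
  invariance becomes visible.\<close>

lemma norm_matrix_square: "(norm X)\<^sup>2 = Re (trace (mat_adj X ** X))"
proof -
  have "(norm X)\<^sup>2 = (\<Sum>i\<in>UNIV. \<Sum>j\<in>UNIV. (cmod (X $ i $ j))\<^sup>2)"
    by (simp add: norm_vec_def L2_set_def sum_nonneg)
  also have "\<dots> = (\<Sum>j\<in>UNIV. \<Sum>i\<in>UNIV. (cmod (X $ i $ j))\<^sup>2)" by (rule sum.swap)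
  also have "\<dots> = Re (trace (mat_adj X ** X))"
    by (simp add: trace_def matrix_matrix_mult_def mat_adj_def complex_mult_cnj cmod_def power2_eq_square)
  finally show ?thesis .
qed

text \<open>Real matrices are kept inside the complex ones, so that \<open>\<beta>\<close> only
  selects a real subspace and both cases run through the same lemmas. \<open>UF 1\<close> contains
  orthogonal matrices of either determinant, unlike \<open>haar_group 1\<close>.\<close>

definition VM :: "nat \<Rightarrow> (complex^'n^'m) set" where "VM \<beta> = {A. \<beta> = 1 \<longrightarrow> real_matrix A}"
definition GLF :: "nat \<Rightarrow> (complex^'n^'n) set" where "GLF \<beta> = {g \<in> VM \<beta>. det g \<noteq> 0}"
definition UF :: "nat \<Rightarrow> (complex^'n^'n) set" where "UF \<beta> = {u \<in> VM \<beta>. mat_adj u ** u = mat 1}"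
definition Herm :: "nat \<Rightarrow> (complex^'n^'n) set" where "Herm \<beta> = {S \<in> VM \<beta>. mat_adj S = S}"
text \<open>Encoded as semidefinite and nonsingular: this is a closed condition plus a determinant,
  hence visibly Borel, and it is close to the support of \<open>jacobi_density\<close>. Strict
  positivity of the form is recovered in \<open>PD_pos\<close>.\<close>

definition PD :: "nat \<Rightarrow> (complex^'n^'n) set" where
  "PD \<beta> = {S \<in> Herm \<beta>. (\<forall>x. 0 \<le> Re (herm_form S x)) \<and> det S \<noteq> 0}"

lemma real_matrix_iff: "real_matrix A \<longleftrightarrow> (\<forall>i j. cnj (A $ i $ j) = A $ i $ j)"
  by (auto simp: real_matrix_def complex_eq_iff)

lemma VM_mult: "A \<in> VM \<beta> \<Longrightarrow> B \<in> VM \<beta> \<Longrightarrow> A ** B \<in> VM \<beta>"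
  by (auto simp: VM_def real_matrix_iff matrix_matrix_mult_def)

lemma VM_adj: "A \<in> VM \<beta> \<Longrightarrow> mat_adj A \<in> VM \<beta>"
  and VM_add: "A \<in> VM \<beta> \<Longrightarrow> B \<in> VM \<beta> \<Longrightarrow> A + B \<in> VM \<beta>"
  and VM_minus: "A \<in> VM \<beta> \<Longrightarrow> - A \<in> VM \<beta>"
  and VM_scaleR: "A \<in> VM \<beta> \<Longrightarrow> r *\<^sub>R A \<in> VM \<beta>"
  and VM_0: "0 \<in> VM \<beta>"
  by (auto simp: VM_def real_matrix_def mat_adj_def)

lemma VM_mat: "mat (of_real r) \<in> VM \<beta>"
  by (simp add: VM_def real_matrix_def mat_def)

lemma VM_1: "mat 1 \<in> VM \<beta>"
  using VM_mat[of 1] by simp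

lemma subspace_VM: "subspace (VM \<beta>)"
  by (rule subspaceI) (auto intro: VM_add VM_scaleR VM_0)

text \<open>For \<open>\<beta> = 1\<close>, entrywise conjugation is multiplicative and fixes
  \<open>A\<close>, so it fixes the inverse of \<open>A\<close> as well.\<close>

lemma VM_matrix_inv:
  assumes "A \<in> VM \<beta>" "det A \<noteq> 0" shows "matrix_inv A \<in> VM \<beta>"
proof (cases "\<beta> = 1")
  case True
  let ?c = "\<lambda>A::complex^'a^'a. \<chi> i j. cnj (A $ i $ j)"
  have "?c A = A" using assms True by (auto simp: VM_def real_matrix_iff vec_eq_iff)
  moreover have "?c A ** ?c (matrix_inv A) = ?c (A ** matrix_inv A)"
    by (simp add: matrix_matrix_mult_def vec_eq_iff)
  moreover have "?c (A ** matrix_inv A) = mat 1"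
    using matrix_inv(1)[OF assms(2)] by (simp add: mat_def vec_eq_iff)
  ultimately have "A ** ?c (matrix_inv A) = mat 1" by simp
  then have "matrix_inv A = ?c (matrix_inv A)" by (rule matrix_inv_eqI)
  then show ?thesis by (simp add: VM_def real_matrix_iff vec_eq_iff)
qed (simp add: VM_def)

lemma det_VM_1: "A \<in> VM (Suc 0) \<Longrightarrow> cnj (det A) = det A"
  by (simp add: det_def VM_def real_matrix_iff)

lemma GLF_mult: "g \<in> GLF \<beta> \<Longrightarrow> h \<in> GLF \<beta> \<Longrightarrow> g ** h \<in> GLF \<beta>"
  and GLF_adj: "g \<in> GLF \<beta> \<Longrightarrow> mat_adj g \<in> GLF \<beta>"
  and GLF_1: "mat 1 \<in> GLF \<beta>"
  by (auto simp: GLF_def VM_mult VM_adj VM_1 det_mul det_mat_adj)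

lemma GLF_inv: "g \<in> GLF \<beta> \<Longrightarrow> matrix_inv g \<in> GLF \<beta>"
proof -
  assume g: "g \<in> GLF \<beta>"
  then have "det g * det (matrix_inv g) = 1"
    by (metis (mono_tags, lifting) GLF_def det_I det_mul matrix_inv(1) mem_Collect_eq)
  then show ?thesis using g by (auto simp: GLF_def VM_matrix_inv)
qed

lemma det_matrix_inv:
  fixes g :: "'a::field^'n^'n"
  assumes "det g \<noteq> 0" shows "det (matrix_inv g) = inverse (det g)"
  using matrix_inv(1)[OF assms] assms by (metis det_I det_mul inverse_unique)

lemma matrix_inv_mult:
  fixes g h :: "'a::field^'n^'n"
  assumes "det g \<noteq> 0" "det h \<noteq> 0" shows "matrix_inv (g ** h) = matrix_inv h ** matrix_inv g"
  by (rule matrix_inv_eqI) (metis assms matrix_inv(1) matrix_mul_assoc matrix_mul_rid)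

lemma matrix_inv_adj:
  assumes "det g \<noteq> 0" shows "matrix_inv (mat_adj g) = mat_adj (matrix_inv g)"
  by (rule matrix_inv_eqI) (metis assms matrix_inv(2) mat_adj_mult mat_adj_1)

lemma matrix_inv_inv:
  fixes g :: "'a::field^'n^'n"
  assumes "det g \<noteq> 0" shows "matrix_inv (matrix_inv g) = g"
  by (rule matrix_inv_eqI) (rule matrix_inv(2)[OF assms])

lemma UF_GLF: "u \<in> UF \<beta> \<Longrightarrow> u \<in> GLF \<beta>"
  unfolding UF_def GLF_def by (metis (mono_tags, lifting) det_I det_mul mem_Collect_eq mult_zero_right zero_neq_one)

lemma UF_right: "u \<in> UF \<beta> \<Longrightarrow> u ** mat_adj u = mat 1"
  unfolding UF_def using matrix_left_right_inverse by blast

lemma UF_adj: "u \<in> UF \<beta> \<Longrightarrow> mat_adj u \<in> UF \<beta>"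
  using UF_right[of u \<beta>] by (auto simp: UF_def VM_adj)

lemma UF_mult: "u \<in> UF \<beta> \<Longrightarrow> v \<in> UF \<beta> \<Longrightarrow> u ** v \<in> UF \<beta>"
  by (auto simp: UF_def VM_mult mat_adj_mult) (metis matrix_mul_assoc matrix_mul_lid)

lemma cmod_det_UF: "u \<in> UF \<beta> \<Longrightarrow> cmod (det u) = 1"
proof -
  assume "u \<in> UF \<beta>"
  then have "cnj (det u) * det u = 1"
    unfolding UF_def by (metis (mono_tags, lifting) det_I det_mat_adj det_mul mem_Collect_eq)
  then have "cmod (det u) * cmod (det u) = 1" by (metis complex_mod_cnj norm_mult norm_one)
  then show ?thesis by (metis abs_norm_cancel abs_square_eq_1 power2_eq_square)
qed

lemma norm_unitary_left: "mat_adj u ** u = mat 1 \<Longrightarrow> norm (u ** X) = norm X"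
proof -
  assume u: "mat_adj u ** u = mat 1"
  have "mat_adj X ** mat_adj u ** (u ** X) = mat_adj X ** (mat_adj u ** u) ** X" by (simp only: matrix_mul_assoc)
  then have "(norm (u ** X))\<^sup>2 = (norm X)\<^sup>2"
    using u by (simp add: norm_matrix_square mat_adj_mult)
  then show ?thesis by simp
qed

lemma norm_mat_adj: "norm (mat_adj X) = norm X"
proof -
  have "(norm (mat_adj X))\<^sup>2 = (norm X)\<^sup>2"
    unfolding norm_matrix_square by (simp add: trace_mul_sym[of X])
  then show ?thesis by simp
qed

lemma norm_unitary_right: "u ** mat_adj u = mat 1 \<Longrightarrow> norm (X ** u) = norm X"
  using norm_unitary_left[of "mat_adj u" "mat_adj X"] by (metis mat_adj_mat_adj mat_adj_mult norm_mat_adj)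

lemma subspace_Herm: "subspace (Herm \<beta>)"
  by (rule subspaceI) (auto simp: Herm_def VM_add VM_scaleR VM_0 mat_adj_add mat_adj_scaleR mat_adj_def vec_eq_iff)

lemma Herm_congruence: "S \<in> Herm \<beta> \<Longrightarrow> g \<in> VM \<beta> \<Longrightarrow> mat_adj g ** S ** g \<in> Herm \<beta>"
  by (auto simp: Herm_def VM_mult VM_adj mat_adj_mult matrix_mul_assoc)

lemma Herm_gram: "X \<in> VM \<beta> \<Longrightarrow> mat_adj X ** X \<in> Herm \<beta>"
  by (auto simp: Herm_def VM_mult VM_adj mat_adj_mult)

lemma Herm_1: "mat 1 \<in> Herm \<beta>" by (simp add: Herm_def VM_1)

lemma Herm_form_real: "S \<in> Herm \<beta> \<Longrightarrow> Im (herm_form S x) = 0"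
proof -
  assume "S \<in> Herm \<beta>"
  then have "cnj (herm_form S x) = herm_form S x"
    unfolding herm_form_cip cip_cnj cip_adj by (simp add: Herm_def)
  then show ?thesis by (simp add: complex_eq_iff)
qed

text \<open>For small \<open>t\<close> the linear term dominates. The value
  \<open>- b / (\<bar>c\<bar> + 1)\<close> is small enough whatever the sign of
  \<open>c\<close>.\<close>

lemma nonneg_quadratic_linear_coeff_zero:
  fixes b c :: real
  assumes "\<And>t. 0 \<le> 2 * t * b + t\<^sup>2 * c" shows "b = 0"
proof (rule ccontr)
  assume b: "b \<noteq> 0"
  let ?k = "\<bar>c\<bar> + 1"
  have k: "?k > 0" by simp
  have "0 \<le> 2 * (- b / ?k) * b + (- b / ?k)\<^sup>2 * c" by (rule assms)
  also have "\<dots> \<le> 2 * (- b / ?k) * b + (- b / ?k)\<^sup>2 * ?k"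
    by (intro add_left_mono mult_left_mono) auto
  also have "\<dots> = - (b\<^sup>2 / ?k)"
  proof -
    have "(- b / ?k)\<^sup>2 * ?k = b\<^sup>2 / ?k" using k by (simp add: power2_eq_square)
    moreover have "2 * (- b / ?k) * b = - 2 * (b\<^sup>2 / ?k)" by (simp add: power2_eq_square)
    ultimately show ?thesis by linarith
  qed
  finally show False using b k by (simp add: divide_le_0_iff field_simps)
qed

text \<open>If the form vanishes at \<open>x\<close>, then its expansion along
  \<open>x + t *\<^sub>R y\<close> has no linear term, for every \<open>y\<close>. Taking
  \<open>y = S *v x\<close> gives \<open>S *v x = 0\<close>, against nonsingularity.\<close>

lemma PD_pos:
  assumes S: "S \<in> PD \<beta>" and x: "x \<noteq> 0" shows "0 < Re (herm_form S x)"
proof (rule ccontr)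
  assume "\<not> ?thesis"
  then have z: "Re (cip x (S *v x)) = 0" using S unfolding PD_def herm_form_cip[symmetric] by (auto simp: not_less intro: antisym)
  have b: "Re (cip y (S *v x)) = 0" for y
  proof (rule nonneg_quadratic_linear_coeff_zero)
    fix t :: real
    have sym: "cip x (S *v y) = cnj (cip y (S *v x))"
      using S unfolding cip_cnj cip_adj PD_def Herm_def by auto
    have "0 \<le> Re (herm_form S (x + t *\<^sub>R y))" using S unfolding PD_def by blast
    also have "\<dots> = Re (cip x (S *v x)) + t * (2 * Re (cip y (S *v x))) + t * t * Re (cip y (S *v y))"
      unfolding herm_form_cip by (simp add: matrix_vector_right_distrib cip_add cip_scaleR sym matrix_vector_mult_scaleR_complex algebra_simps)
    finally show "0 \<le> 2 * t * Re (cip y (S *v x)) + t\<^sup>2 * Re (cip y (S *v y))"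
      by (simp add: z power2_eq_square algebra_simps)
  qed
  from b[of "S *v x"] have "S *v x = 0" by (simp add: cip_self)
  then have "x = 0" using S det_nonzero_kernel unfolding PD_def by blast
  with x show False by simp
qed

lemma det_zero_kernel:
  fixes A :: "'a::field^'n^'n"
  assumes "det A = 0" obtains x where "x \<noteq> 0" "A *v x = 0"
  using assms matrix_left_invertible_ker[of A] by (metis invertible_det_nz invertible_left_inverse)

lemma PD_I:
  assumes S: "S \<in> Herm \<beta>" and pos: "\<And>x. x \<noteq> 0 \<Longrightarrow> 0 < Re (herm_form S x)"
  shows "S \<in> PD \<beta>"
proof -
  have "0 \<le> Re (herm_form S x)" for x
    using pos[of x] by (cases "x = 0") (auto simp: herm_form_def)
  moreover have "det S \<noteq> 0"
  proof
    assume "det S = 0"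
    then obtain x where "x \<noteq> 0" "S *v x = 0" by (rule det_zero_kernel)
    then show False using pos[of x] by (simp add: herm_form_cip cip_def)
  qed
  ultimately show ?thesis using S by (simp add: PD_def)
qed

lemma GLF_vec_nonzero: "g \<in> GLF \<beta> \<Longrightarrow> x \<noteq> 0 \<Longrightarrow> g *v x \<noteq> 0"
  unfolding GLF_def using det_nonzero_kernel by blast

lemma PD_congruence_imp: "S \<in> PD \<beta> \<Longrightarrow> g \<in> GLF \<beta> \<Longrightarrow> mat_adj g ** S ** g \<in> PD \<beta>"
  by (rule PD_I) (auto simp: herm_form_congruence PD_pos GLF_vec_nonzero intro!: Herm_congruence, auto simp: PD_def GLF_def)

lemma congruence_inv:
  assumes g: "g \<in> GLF \<beta>"
  shows "mat_adj (matrix_inv g) ** (mat_adj g ** S ** g) ** matrix_inv g = S"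
    and "mat_adj g ** (mat_adj (matrix_inv g) ** S ** matrix_inv g) ** g = S"
proof -
  have d: "det g \<noteq> 0" using g by (simp add: GLF_def)
  have 1: "mat_adj (matrix_inv g) ** mat_adj g = mat 1" "mat_adj g ** mat_adj (matrix_inv g) = mat 1"
    using matrix_inv[OF d] by (simp_all flip: mat_adj_mult)
  have "mat_adj (matrix_inv g) ** (mat_adj g ** S ** g) ** matrix_inv g
     = (mat_adj (matrix_inv g) ** mat_adj g) ** S ** (g ** matrix_inv g)" by (simp only: matrix_mul_assoc)
  then show "mat_adj (matrix_inv g) ** (mat_adj g ** S ** g) ** matrix_inv g = S"
    using 1 matrix_inv[OF d] by simp
  have "mat_adj g ** (mat_adj (matrix_inv g) ** S ** matrix_inv g) ** g
     = (mat_adj g ** mat_adj (matrix_inv g)) ** S ** (matrix_inv g ** g)" by (simp only: matrix_mul_assoc)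
  then show "mat_adj g ** (mat_adj (matrix_inv g) ** S ** matrix_inv g) ** g = S"
    using 1 matrix_inv[OF d] by simp
qed

lemma PD_congruence: "g \<in> GLF \<beta> \<Longrightarrow> mat_adj g ** S ** g \<in> PD \<beta> \<longleftrightarrow> S \<in> PD \<beta>"
  by (metis PD_congruence_imp GLF_inv congruence_inv(1))

lemma PD_1: "mat 1 \<in> PD \<beta>"
  by (rule PD_I) (auto simp: Herm_1 herm_form_1)

lemma PD_gram: "g \<in> GLF \<beta> \<Longrightarrow> mat_adj g ** g \<in> PD \<beta>"
  using PD_congruence[of g \<beta> "mat 1"] PD_1 by simp

lemma PD_add_nonneg:
  assumes "S \<in> PD \<beta>" "T \<in> Herm \<beta>" "\<And>x. 0 \<le> Re (herm_form T x)" shows "S + T \<in> PD \<beta>"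
proof (rule PD_I)
  show "S + T \<in> Herm \<beta>" using assms subspace_add[OF subspace_Herm[of \<beta>], of S T] by (simp add: PD_def)
qed (auto simp: herm_form_add intro!: add_pos_nonneg PD_pos[OF assms(1)] assms(3))

lemma PD_nonneg_def: "S \<in> PD \<beta> \<longleftrightarrow> S \<in> VM \<beta> \<and> nonneg_def S \<and> det S \<noteq> 0" if "S \<in> Herm \<beta>"
  using that Herm_form_real[OF that] by (auto simp: PD_def nonneg_def_def Herm_def)

lemma borel_VM[measurable]: "VM \<beta> \<in> sets borel"
  by (intro borel_closed closed_subspace subspace_VM)

lemma borel_Herm[measurable]: "Herm \<beta> \<in> sets borel"
  by (intro borel_closed closed_subspace subspace_Herm)

lemma borel_measurable_herm_form[measurable (raw)]:
  fixes A :: "'a \<Rightarrow> complex^'n^'n"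
  assumes [measurable]: "A \<in> borel_measurable M"
  shows "(\<lambda>y. herm_form (A y) x) \<in> borel_measurable M"
  unfolding herm_form_def by measurable

lemma borel_PD[measurable]: "PD \<beta> \<in> sets borel"
proof -
  \<comment> \<open>The intersection over all vectors is uncountable, so closedness of each
    condition is used rather than mere measurability.\<close>
  have "closed {S. 0 \<le> Re (herm_form S x)}" for x :: "complex^'a"
    unfolding herm_form_def by (intro closed_Collect_le continuous_intros)
  then have "closed (\<Inter>x. {S::complex^'a^'a. 0 \<le> Re (herm_form S x)})" by blast
  then have [measurable]: "(\<Inter>x. {S::complex^'a^'a. 0 \<le> Re (herm_form S x)}) \<in> sets borel" by (rule borel_closed)
  have "{S::complex^'a^'a. det S \<noteq> 0} \<in> sets borel" by measurable
  then have "Herm \<beta> \<inter> (\<Inter>x. {S::complex^'a^'a. 0 \<le> Re (herm_form S x)}) \<inter> {S. det S \<noteq> 0} \<in> sets borel"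
    by (intro sets.Int) measurable
  also have "Herm \<beta> \<inter> (\<Inter>x. {S::complex^'a^'a. 0 \<le> Re (herm_form S x)}) \<inter> {S. det S \<noteq> 0} = PD \<beta>"
    by (auto simp: PD_def)
  finally show ?thesis .
qed

lemma borel_GLF[measurable]: "GLF \<beta> \<in> sets borel"
proof -
  have "{S::complex^'a^'a. det S \<noteq> 0} \<in> sets borel" by measurable
  then have "VM \<beta> \<inter> {S::complex^'a^'a. det S \<noteq> 0} \<in> sets borel" by (intro sets.Int) measurable
  also have "VM \<beta> \<inter> {S::complex^'a^'a. det S \<noteq> 0} = GLF \<beta>" by (auto simp: GLF_def)
  finally show ?thesis .
qed

subsection \<open>Gram--Schmidt orthonormalization\<close>

text \<open>\<open>W\<close> is to be read as the Gram matrix of a family of columns: those with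
  index in \<open>J\<close> are orthonormal.\<close>

definition orth_on :: "'n set \<Rightarrow> complex^'n^'n \<Rightarrow> bool" where
  "orth_on J W \<longleftrightarrow> (\<forall>a\<in>J. \<forall>b\<in>J. W $ a $ b = (if a = b then 1 else 0))"

text \<open>Right multiplication by it adds to column \<open>j\<close> the combination of all
  columns with coefficients \<open>v\<close>.\<close>

definition shear :: "'n \<Rightarrow> complex^'n \<Rightarrow> complex^'n^'n" where
  "shear j v = (\<chi> a b. (if a = b then 1 else 0) + (if b = j then v $ a else 0))"

definition scale_on :: "'n set \<Rightarrow> real \<Rightarrow> complex^'n^'n" where
  "scale_on J r = (\<chi> a b. if a = b then (if a \<in> J then of_real r else 1) else 0)"

lemma shear_mult: "w $ j = 0 \<Longrightarrow> shear j v ** shear j w = shear j (v + w)"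
  by (simp add: shear_def matrix_matrix_mult_def vec_eq_iff distrib_left distrib_right sum.distrib
      if_distrib[of "\<lambda>x. x * _"] if_distrib[of "\<lambda>x. _ * x"] cong: if_cong)

lemma shear_0: "shear j 0 = mat 1"
  by (simp add: shear_def mat_def vec_eq_iff)

lemma scale_on_mult: "(A ** scale_on J r) $ a $ b = A $ a $ b * (if b \<in> J then of_real r else 1)"
  by (simp add: scale_on_def matrix_matrix_mult_def if_distrib[of "\<lambda>x. _ * x"] cong: if_cong)

lemma scale_on_mult_left: "(scale_on J r ** A) $ a $ b = (if a \<in> J then of_real r else 1) * A $ a $ b"
  by (simp add: scale_on_def matrix_matrix_mult_def if_distrib[of "\<lambda>x. x * _"] cong: if_cong)

lemma scale_on_UNIV: "scale_on UNIV r = mat (of_real r)"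
  by (simp add: scale_on_def mat_def vec_eq_iff)

lemma scale_on_empty: "scale_on {} r = mat 1"
  by (simp add: scale_on_def mat_def vec_eq_iff)

lemma scale_on_insert: "j \<notin> J \<Longrightarrow> scale_on (insert j J) r = scale_on {j} r ** scale_on J r"
  by (auto simp: vec_eq_iff scale_on_mult) (auto simp: scale_on_def)

lemma GLF_I:
  assumes "A \<in> VM \<beta>" "A ** B = mat 1" shows "A \<in> GLF \<beta>"
  using assms unfolding GLF_def by (metis (mono_tags, lifting) det_I det_mul mem_Collect_eq mult_zero_left zero_neq_one)

lemma scale_on_GLF: "r > 0 \<Longrightarrow> scale_on J r \<in> GLF \<beta>"
proof (rule GLF_I[of _ _ "scale_on J (1/r)"])
  assume "r > 0"
  then show "scale_on J r ** scale_on J (1 / r) = mat 1"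
    by (auto simp: vec_eq_iff scale_on_mult) (auto simp: scale_on_def mat_def)
qed (simp add: VM_def real_matrix_def scale_on_def)

lemma shear_GLF: "v $ j = 0 \<Longrightarrow> (\<beta> = 1 \<Longrightarrow> \<forall>a. Im (v $ a) = 0) \<Longrightarrow> shear j v \<in> GLF \<beta>"
  by (rule GLF_I[of _ _ "shear j (- v)"])
    (simp_all add: shear_mult shear_0 VM_def real_matrix_def, simp add: shear_def)

text \<open>Keeps track of the fact that a Gram--Schmidt matrix is a product of shears and positive
  scalings of single columns, so that a character can be evaluated on it factor by factor.\<close>

inductive elem :: "nat \<Rightarrow> complex^'n^'n \<Rightarrow> bool" for \<beta> where
  elem_1: "elem \<beta> (mat 1)"
| elem_step: "elem \<beta> E \<Longrightarrow> v $ j = 0 \<Longrightarrow> (\<beta> = 1 \<Longrightarrow> \<forall>a. Im (v $ a) = 0) \<Longrightarrow> r > 0 \<Longrightarrow>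
    elem \<beta> (E ** (shear j v ** scale_on {j} r))"

lemma elem_GLF: "elem \<beta> E \<Longrightarrow> E \<in> GLF \<beta>"
  by (induction rule: elem.induct) (auto intro!: GLF_1 GLF_mult shear_GLF scale_on_GLF)

text \<open>Coefficients that subtract from column \<open>j\<close> its projection onto the
  orthonormal columns in \<open>J\<close>. The Gram matrix \<open>W\<close> already contains
  them.\<close>

definition gs_vec :: "'n set \<Rightarrow> 'n \<Rightarrow> complex^'n^'n \<Rightarrow> complex^'n" where
  "gs_vec J j W = (\<chi> a. if a \<in> J then - W $ a $ j else 0)"

text \<open>Under the root stands the squared distance of column \<open>j\<close> from the span of
  the orthonormal columns in \<open>J\<close>, expressed through the Gram matrix.\<close>

definition gs_norm :: "'n set \<Rightarrow> 'n \<Rightarrow> complex^'n^'n \<Rightarrow> real" where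
  "gs_norm J j W = 1 / sqrt (Re (W $ j $ j - (\<Sum>a\<in>J. W $ j $ a * W $ a $ j)))"

definition gs_step :: "'n set \<Rightarrow> 'n \<Rightarrow> complex^'n^'n \<Rightarrow> complex^'n^'n" where
  "gs_step J j W = shear j (gs_vec J j W) ** scale_on {j} (gs_norm J j W)"

lemma mult_gs_step:
  "(A ** gs_step J j W) $ a $ b =
    (if b = j then of_real (gs_norm J j W) * (A $ a $ j - (\<Sum>c\<in>J. A $ a $ c * W $ c $ j)) else A $ a $ b)"
proof -
  have "(A ** shear j (gs_vec J j W)) $ a $ b = A $ a $ b + (if b = j then (\<Sum>c\<in>UNIV. A $ a $ c * gs_vec J j W $ c) else 0)"
    by (simp add: shear_def matrix_matrix_mult_def distrib_left sum.distrib if_distrib[of "\<lambda>x. _ * x"] cong: if_cong)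
  also have "(\<Sum>c\<in>UNIV. A $ a $ c * gs_vec J j W $ c) = - (\<Sum>c\<in>J. A $ a $ c * W $ c $ j)"
    by (simp add: gs_vec_def if_distrib[of "\<lambda>x. _ * x"] sum.If_cases sum_negf cong: if_cong)
  finally show ?thesis
    by (simp add: gs_step_def matrix_mul_assoc scale_on_mult mult.commute)
qed

lemma mat_adj_mult_nth: "(mat_adj A ** B) $ a $ b = (\<Sum>c\<in>UNIV. cnj (A $ c $ a) * B $ c $ b)"
  by (simp add: matrix_matrix_mult_def mat_adj_def)

lemma gs_step_spec:
  fixes W :: "complex^'n^'n"
  assumes W: "W \<in> PD \<beta>" and J: "orth_on J W" and j: "j \<notin> J"
  shows "gs_norm J j W > 0"
    and "orth_on (insert j J) (mat_adj (gs_step J j W) ** W ** gs_step J j W)"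
proof -
  let ?G = "gs_step J j W" and ?r = "gs_norm J j W"
  \<comment> \<open>\<open>u\<close> holds the coefficients of the residual of column
    \<open>j\<close>, \<open>w\<close> its inner products with all columns, and \<open>q\<close> its
    squared length; positivity of \<open>q\<close> comes from definiteness, as
    \<open>u $ j = 1\<close>.\<close>
  define q where "q = W $ j $ j - (\<Sum>a\<in>J. W $ j $ a * W $ a $ j)"
  define u :: "complex^'n" where "u = (\<chi> a. if a = j then 1 else if a \<in> J then - W $ a $ j else 0)"
  define w where "w a = W $ a $ j - (\<Sum>c\<in>J. W $ a $ c * W $ c $ j)" for a
  have wJ: "w a = 0" if "a \<in> J" for a
  proof -
    have "(\<Sum>c\<in>J. W $ a $ c * W $ c $ j) = (\<Sum>c\<in>J. if a = c then W $ c $ j else 0)"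
      using J that by (intro sum.cong) (auto simp: orth_on_def)
    then show ?thesis using that by (simp add: w_def)
  qed
  have uw: "(W *v u) $ a = w a" for a
  proof -
    have "(W *v u) $ a = (\<Sum>c\<in>UNIV. (if c = j then W $ a $ c else 0) + (if c \<in> J then - (W $ a $ c * W $ c $ j) else 0))"
      unfolding matrix_vector_mult_def u_def using j by (auto intro!: sum.cong)
    then show ?thesis by (simp add: w_def sum.distrib sum.If_cases sum_negf)
  qed
  have "cnj (u $ a) * w a = (if a = j then q else 0)" for a
    using wJ by (auto simp: u_def w_def q_def)
  then have form: "herm_form W u = q"
    by (simp add: herm_form_cip cip_def uw)
  have "u $ j = 1" by (simp add: u_def)
  then have "u \<noteq> 0" by auto
  then have q: "Re q > 0" "Im q = 0"
    using PD_pos[OF W] Herm_form_real[of W \<beta> u] W form by (auto simp: PD_def)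
  show r: "?r > 0" using q by (simp add: gs_norm_def q_def)
  have r2: "of_real ?r * of_real ?r * q = 1"
  proof -
    have "?r = 1 / sqrt (Re q)" by (simp only: gs_norm_def q_def)
    then have "?r * ?r = 1 / Re q" using q by simp
    then have "?r * ?r * Re q = 1" using q by simp
    then show ?thesis using q by (simp add: complex_eq_iff)
  qed
  have G: "?G $ a $ b = (if b = j then of_real ?r * u $ a else if a = b then 1 else 0)" for a b
  proof -
    have "?G $ a $ b = (mat 1 ** ?G) $ a $ b" by simp
    also have "\<dots> = (if b = j then of_real ?r * u $ a else if a = b then 1 else 0)"
      unfolding mult_gs_step using j by (auto simp: u_def mat_def if_distrib[of "\<lambda>x. x * _"] sum.If_cases cong: if_cong)
    finally show ?thesis .
  qed
  have GLF: "?G \<in> GLF \<beta>"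
    unfolding gs_step_def using r j W
    by (intro GLF_mult shear_GLF scale_on_GLF)
      (auto simp: gs_vec_def PD_def Herm_def VM_def real_matrix_def)
  have herm: "mat_adj ?G ** W ** ?G \<in> Herm \<beta>"
    using PD_congruence_imp[OF W GLF] by (simp add: PD_def)
  \<comment> \<open>Only column \<open>j\<close> of the step differs from the identity, so its
    adjoint, multiplied from the left, changes only row \<open>j\<close>.\<close>
  have row: "(mat_adj ?G ** W ** ?G) $ a $ b = (W ** ?G) $ a $ b" if "a \<noteq> j" for a b
  proof -
    have "(mat_adj ?G ** W ** ?G) $ a $ b = (\<Sum>c\<in>UNIV. cnj (?G $ c $ a) * (W ** ?G) $ c $ b)"
      unfolding matrix_mul_assoc[symmetric] by (rule mat_adj_mult_nth)
    then show ?thesis using that by (simp add: G if_distrib[of cnj] if_distrib[of "\<lambda>x. x * _"] cong: if_cong)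
  qed
  have Wj: "(W ** ?G) $ a $ j = of_real ?r * w a" for a
    by (simp add: mult_gs_step w_def)
  have jj: "(mat_adj ?G ** W ** ?G) $ j $ j = 1"
  proof -
    have "(mat_adj ?G ** W ** ?G) $ j $ j = (\<Sum>c\<in>UNIV. cnj (?G $ c $ j) * (W ** ?G) $ c $ j)"
      unfolding matrix_mul_assoc[symmetric] by (rule mat_adj_mult_nth)
    also have "\<dots> = (\<Sum>c\<in>UNIV. of_real ?r * of_real ?r * (cnj (u $ c) * w c))"
      by (simp add: G Wj ac_simps)
    also have "\<dots> = of_real ?r * of_real ?r * (\<Sum>c\<in>UNIV. cnj (u $ c) * w c)"
      by (simp only: sum_distrib_left)
    also have "(\<Sum>c\<in>UNIV. cnj (u $ c) * w c) = q"
      using form by (simp add: herm_form_cip cip_def uw)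
    finally show ?thesis using r2 by simp
  qed
  have aj: "(mat_adj ?G ** W ** ?G) $ a $ j = 0" if "a \<in> J" for a
    using that j row[of a j] wJ[of a] Wj[of a] by auto
  moreover have "(mat_adj ?G ** W ** ?G) $ j $ a = 0" if "a \<in> J" for a
  proof -
    have "mat_adj (mat_adj ?G ** W ** ?G) = mat_adj ?G ** W ** ?G" using herm by (simp add: Herm_def)
    then have "cnj ((mat_adj ?G ** W ** ?G) $ a $ j) = (mat_adj ?G ** W ** ?G) $ j $ a"
      by (metis (no_types, lifting) mat_adj_def vec_lambda_beta)
    then show ?thesis using aj[OF that] by simp
  qed
  moreover have "(mat_adj ?G ** W ** ?G) $ a $ b = (if a = b then 1 else 0)" if "a \<in> J" "b \<in> J" for a b
  proof -
    have ab: "a \<noteq> j" "b \<noteq> j" using that j by auto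
    have "(mat_adj ?G ** W ** ?G) $ a $ b = (W ** ?G) $ a $ b" by (rule row[OF ab(1)])
    also have "\<dots> = W $ a $ b" using ab by (simp only: mult_gs_step if_False)
    also have "\<dots> = (if a = b then 1 else 0)" using J that unfolding orth_on_def by blast
    finally show ?thesis .
  qed
  ultimately show "orth_on (insert j J) (mat_adj ?G ** W ** ?G)"
    using jj j by (auto simp: orth_on_def)
qed

text \<open>The columns in \<open>D\<close> are treated one at a time, each step being an explicit
  measurable function of the current Gram matrix. Columns in \<open>J0\<close> are orthonormal from
  the start and stay untouched: \<open>frame_completion\<close> needs this to extend a given frame,
  while \<open>J0 = {}\<close> yields a root of \<open>S\<close>.\<close>

lemma gram_schmidt:
  fixes J0 :: "'n::finite set"
  assumes "finite D" "D \<inter> J0 = {}"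
  shows "\<exists>E. E \<in> borel \<rightarrow>\<^sub>M borel \<and> (\<forall>S\<in>PD \<beta>. orth_on J0 S \<longrightarrow> elem \<beta> (E S) \<and>
     orth_on (J0 \<union> D) (mat_adj (E S) ** S ** E S) \<and> (\<forall>a. \<forall>b\<in>J0. E S $ a $ b = (if a = b then 1 else 0)))"
  using assms
proof (induction D)
  case empty
  show ?case by (intro exI[of _ "\<lambda>_. mat 1"]) (auto simp: elem_1, simp_all add: mat_def)
next
  case (insert j D)
  then obtain E where E[measurable]: "E \<in> borel \<rightarrow>\<^sub>M borel"
    and ES: "\<And>S. S \<in> PD \<beta> \<Longrightarrow> orth_on J0 S \<Longrightarrow> elem \<beta> (E S) \<and>
     orth_on (J0 \<union> D) (mat_adj (E S) ** S ** E S) \<and> (\<forall>a. \<forall>b\<in>J0. E S $ a $ b = (if a = b then 1 else 0))"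
    by auto
  let ?W = "\<lambda>S. mat_adj (E S) ** S ** E S"
  let ?E = "\<lambda>S. E S ** gs_step (J0 \<union> D) j (?W S)"
  show ?case
  proof (intro exI[of _ ?E] conjI ballI impI allI)
    have [measurable]: "(\<lambda>W. gs_step (J0 \<union> D) j W) \<in> borel \<rightarrow>\<^sub>M borel"
    proof -
      have [measurable]: "(\<lambda>W. gs_vec (J0 \<union> D) j W $ a) \<in> borel \<rightarrow>\<^sub>M borel" for a
        by (cases "a \<in> J0 \<union> D") (simp_all add: gs_vec_def)
      have [measurable]: "(\<lambda>W. gs_norm (J0 \<union> D) j W) \<in> borel \<rightarrow>\<^sub>M borel"
        unfolding gs_norm_def by measurable
      show ?thesis unfolding gs_step_def shear_def scale_on_def by measurable
    qed
    show "?E \<in> borel \<rightarrow>\<^sub>M borel" by measurable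
    fix S assume S: "S \<in> PD \<beta>" "orth_on J0 S"
    have el: "elem \<beta> (E S)" and orth: "orth_on (J0 \<union> D) (?W S)" 
      and cols: "\<And>a b. b \<in> J0 \<Longrightarrow> E S $ a $ b = (if a = b then 1 else 0)"
      using ES[OF S] by auto
    have W: "?W S \<in> PD \<beta>" using S el by (intro PD_congruence_imp elem_GLF)
    have j: "j \<notin> J0 \<union> D" using insert by auto
    show "elem \<beta> (?E S)"
      unfolding gs_step_def using el gs_step_spec(1)[OF W orth j] j W
      by (intro elem_step) (auto simp: gs_vec_def PD_def Herm_def VM_def real_matrix_def)
    have "mat_adj (?E S) ** S ** ?E S =
        mat_adj (gs_step (J0 \<union> D) j (?W S)) ** ?W S ** gs_step (J0 \<union> D) j (?W S)"
      by (simp only: mat_adj_mult matrix_mul_assoc)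
    then show "orth_on (J0 \<union> insert j D) (mat_adj (?E S) ** S ** ?E S)"
      using gs_step_spec(2)[OF W orth j] by simp
    show "?E S $ a $ b = (if a = b then 1 else 0)" if "b \<in> J0" for a b
      using that j cols by (auto simp: mult_gs_step)
  qed
qed

text \<open>A measurable choice of \<open>E\<close> such that \<open>E(S)\<inverse>\<close> plays the role of a square root of \<open>S\<close>.\<close>
lemma orthonormalizer:
  obtains E :: "complex^'n^'n \<Rightarrow> complex^'n^'n" where "E \<in> borel \<rightarrow>\<^sub>M borel"
    "\<And>S. S \<in> PD \<beta> \<Longrightarrow> elem \<beta> (E S)" "\<And>S. S \<in> PD \<beta> \<Longrightarrow> mat_adj (E S) ** S ** E S = mat 1"
proof -
  obtain E :: "complex^'n^'n \<Rightarrow> complex^'n^'n" where E: "E \<in> borel \<rightarrow>\<^sub>M borel"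
    "\<And>S. S \<in> PD \<beta> \<Longrightarrow> elem \<beta> (E S)" "\<And>S. S \<in> PD \<beta> \<Longrightarrow> orth_on UNIV (mat_adj (E S) ** S ** E S)"
    using gram_schmidt[of UNIV "{}" \<beta>] by (auto simp: orth_on_def)
  show ?thesis using E by (intro that[of E]) (auto simp: orth_on_def mat_def vec_eq_iff)
qed

text \<open>Transitivity of congruence on the cone; \<open>g\<close> is the inverse of the
  orthonormalizing matrix.\<close>

lemma PD_eq_gram:
  assumes "S \<in> PD \<beta>" obtains g where "g \<in> GLF \<beta>" "S = mat_adj g ** g"
proof -
  obtain E :: "complex^'a^'a \<Rightarrow> complex^'a^'a" where "E S \<in> GLF \<beta>" "mat_adj (E S) ** S ** E S = mat 1"
    using assms orthonormalizer[of \<beta>] elem_GLF by metis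
  then show ?thesis using that[of "matrix_inv (E S)"] congruence_inv(1)[of "E S" \<beta> S] GLF_inv[of "E S" \<beta>] by simp
qed

subsection \<open>Characters of the general linear group\<close>

text \<open>A shear \<open>s\<close> satisfies \<open>D s s = s D\<close> for a diagonal matrix \<open>D\<close>, so its character is \<open>1\<close>; the diagonal
matrices with a single entry \<open>r \<noteq> 1\<close> are conjugate to each other and multiply up to a scalar matrix.
By Gram--Schmidt these generate the group together with the unitary matrices.\<close>
lemma trivial_character:
  fixes \<psi> :: "complex^'n^'n \<Rightarrow> real"
  assumes pos: "\<And>g. g \<in> GLF \<beta> \<Longrightarrow> \<psi> g > 0"
    and mult: "\<And>g h. g \<in> GLF \<beta> \<Longrightarrow> h \<in> GLF \<beta> \<Longrightarrow> \<psi> (g ** h) = \<psi> g * \<psi> h"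
    and unit: "\<And>u. u \<in> UF \<beta> \<Longrightarrow> \<psi> u = 1"
    and dil: "\<And>r. r > 0 \<Longrightarrow> \<psi> (mat (of_real r)) = 1"
    and g: "g \<in> GLF \<beta>"
  shows "\<psi> g = 1"
proof -
  have one: "\<psi> (mat 1) = 1" using unit[of "mat 1"] by (simp add: UF_def VM_1)
  have shear: "\<psi> (shear j v) = 1" if v: "v $ j = 0" "\<beta> = 1 \<Longrightarrow> \<forall>a. Im (v $ a) = 0" for j v
  proof -
    let ?s = "shear j v" and ?D = "scale_on {j} 2 :: complex^'n^'n"
    have s: "?s \<in> GLF \<beta>" and D: "?D \<in> GLF \<beta>" using v by (auto intro: shear_GLF scale_on_GLF)
    have "?D ** (?s ** ?s) = ?s ** ?D"
      using v by (auto simp: shear_mult vec_eq_iff scale_on_mult scale_on_mult_left) (auto simp: shear_def)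
    then have "\<psi> ?D * (\<psi> ?s * \<psi> ?s) = \<psi> ?s * \<psi> ?D" using s D by (metis GLF_mult mult)
    then show ?thesis using pos[OF s] pos[OF D] by simp
  qed
  have swap: "\<psi> (scale_on {j} r) = \<psi> (scale_on {k} r)" if r: "r > 0" for j k r
  proof -
    let ?t = "Transposition.transpose j k"
    have tt: "?t a = ?t b \<longleftrightarrow> a = b" for a b by (metis transpose_involutory)
    have tk: "?t a = k \<longleftrightarrow> a = j" "k = ?t a \<longleftrightarrow> a = j" for a
      by (metis transpose_apply_first transpose_involutory)+
    define P :: "complex^'n^'n" where "P = (\<chi> a b. if a = ?t b then 1 else 0)"
    have P: "P \<in> UF \<beta>"
    proof -
      have "(mat_adj P ** P) $ a $ b = (mat 1 :: complex^'n^'n) $ a $ b" for a b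
        by (simp add: tt P_def mat_adj_def matrix_matrix_mult_def mat_def if_distrib[of cnj] if_distrib[of "\<lambda>x. x * _"] cong: if_cong)
      then show ?thesis by (simp add: UF_def vec_eq_iff VM_def P_def real_matrix_def)
    qed
    have "P ** scale_on {j} r = scale_on {k} r ** P"
      by (auto simp: vec_eq_iff scale_on_mult scale_on_mult_left P_def tk)
    then have "\<psi> P * \<psi> (scale_on {j} r) = \<psi> (scale_on {k} r) * \<psi> P"
      using UF_GLF[OF P] scale_on_GLF[OF r] by (metis mult)
    then show ?thesis using unit[OF P] by simp
  qed
  have scl: "\<psi> (scale_on {j} r) = 1" if r: "r > 0" for j r
  proof -
    have "\<psi> (scale_on J r) = \<psi> (scale_on {j} r) ^ card J" for J
    proof (induction J rule: infinite_finite_induct)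
      case (insert k J)
      then have "\<psi> (scale_on (insert k J) r) = \<psi> (scale_on {k} r) * \<psi> (scale_on J r)"
        using r by (subst scale_on_insert) (simp_all add: mult scale_on_GLF)
      then show ?case using insert swap[OF r, of k j] by simp
    qed (simp_all add: scale_on_empty one)
    from this[of UNIV] have "\<psi> (scale_on {j} r) ^ CARD('n) = 1"
      using dil[OF r] by (simp add: scale_on_UNIV)
    moreover have "\<psi> (scale_on {j} r) > 0" using r by (simp add: pos scale_on_GLF)
    ultimately show ?thesis
      using power_eq_iff_eq_base[of "CARD('n)" "\<psi> (scale_on {j} r)" 1] by simp
  qed
  have elem: "\<psi> E = 1" if "elem \<beta> E" for E
    using that
  proof (induction rule: elem.induct)
    case (elem_step E v j r)
    then have "\<psi> (E ** (shear j v ** scale_on {j} r)) = \<psi> E * (\<psi> (shear j v) * \<psi> (scale_on {j} r))"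
      by (simp add: mult elem_GLF shear_GLF scale_on_GLF GLF_mult)
    then show ?case using elem_step shear scl by simp
  qed (rule one)
  let ?S = "mat_adj g ** g"
  obtain E :: "complex^'n^'n \<Rightarrow> complex^'n^'n" where E: "elem \<beta> (E ?S)" "mat_adj (E ?S) ** ?S ** E ?S = mat 1"
    using PD_gram[OF g] orthonormalizer[of \<beta>] by metis
  have "mat_adj (g ** E ?S) ** (g ** E ?S) = mat_adj (E ?S) ** ?S ** E ?S"
    by (simp only: mat_adj_mult matrix_mul_assoc)
  then have "g ** E ?S \<in> UF \<beta>"
    using E GLF_mult[OF g elem_GLF[OF E(1)]] by (auto simp: UF_def GLF_def)
  then show ?thesis using unit mult[OF g elem_GLF[OF E(1)]] elem[OF E(1)] by simp
qed

text \<open>A scalar matrix \<open>r\<close> has determinant \<open>r ^ CARD('n)\<close>, so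
  dividing \<open>\<psi>\<close> by this power of \<open>cmod (det g)\<close> leaves a character
  that is 1 on dilations and on unitary matrices.\<close>

lemma character_eq_det_powr:
  fixes \<psi> :: "complex^'n^'n \<Rightarrow> real"
  assumes pos: "\<And>g. g \<in> GLF \<beta> \<Longrightarrow> \<psi> g > 0"
    and mult: "\<And>g h. g \<in> GLF \<beta> \<Longrightarrow> h \<in> GLF \<beta> \<Longrightarrow> \<psi> (g ** h) = \<psi> g * \<psi> h"
    and unit: "\<And>u. u \<in> UF \<beta> \<Longrightarrow> \<psi> u = 1"
    and dil: "\<And>r. r > 0 \<Longrightarrow> \<psi> (mat (of_real r)) = r powr s"
    and g: "g \<in> GLF \<beta>"
  shows "\<psi> g = cmod (det g) powr (s / CARD('n))"
proof -
  let ?e = "s / CARD('n)"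
  have "\<psi> g * cmod (det g) powr (- ?e) = 1"
  proof (rule trivial_character[where \<beta> = \<beta> and \<psi> = "\<lambda>g. \<psi> g * cmod (det g) powr (- ?e)"])
    show "0 < \<psi> h * cmod (det h) powr (- ?e)" if "h \<in> GLF \<beta>" for h
      using pos[OF that] that by (simp add: GLF_def)
    show "\<psi> (h ** k) * cmod (det (h ** k)) powr (- ?e)
        = \<psi> h * cmod (det h) powr (- ?e) * (\<psi> k * cmod (det k) powr (- ?e))" if "h \<in> GLF \<beta>" "k \<in> GLF \<beta>" for h k
      using that by (simp add: mult det_mul norm_mult powr_mult)
    show "\<psi> u * cmod (det u) powr (- ?e) = 1" if "u \<in> UF \<beta>" for u
      using unit[OF that] cmod_det_UF[OF that] by simp
    show "\<psi> (mat (of_real r)) * cmod (det (mat (of_real r) :: complex^'n^'n)) powr (- ?e) = 1" if "r > 0" for r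
    proof -
      have "cmod (det (mat (of_real r) :: complex^'n^'n)) = r powr CARD('n)"
        using that by (simp add: det_mat norm_power powr_realpow)
      then show ?thesis using that dil by (simp add: powr_powr powr_add[symmetric])
    qed
  qed (rule g)
  moreover have "cmod (det g) > 0" using g by (simp add: GLF_def)
  ultimately show ?thesis by (simp add: powr_minus field_simps)
qed

text \<open>The scaling factors form a positive character, for left and for right actions alike
  since positive reals commute. The number \<open>k\<close> is the degree of the action: 1 for
  multiplication, 2 for congruence. A dilation by \<open>r\<close> then scales the measure by
  \<open>r powr (- (k * d))\<close>, which determines the exponent.\<close>

lemma (in leb_on) group_action:
  fixes T :: "complex^'n^'n \<Rightarrow> 'a \<Rightarrow> 'a"
  assumes lin: "\<And>g. linear (T g)" and V: "\<And>g x. g \<in> GLF \<beta> \<Longrightarrow> x \<in> V \<Longrightarrow> T g x \<in> V"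
    and comp: "(\<forall>g\<in>GLF \<beta>. \<forall>h\<in>GLF \<beta>. \<forall>x\<in>V. T (g ** h) x = T g (T h x)) \<or>
        (\<forall>g\<in>GLF \<beta>. \<forall>h\<in>GLF \<beta>. \<forall>x\<in>V. T (g ** h) x = T h (T g x))"
    and one: "\<And>x. x \<in> V \<Longrightarrow> T (mat 1) x = x"
    and iso: "\<And>u x. u \<in> UF \<beta> \<Longrightarrow> x \<in> V \<Longrightarrow> norm (T u x) = norm x"
    and dil: "\<And>r x. r > 0 \<Longrightarrow> x \<in> V \<Longrightarrow> T (mat (of_real r)) x = r ^ k *\<^sub>R x"
    and g: "g \<in> GLF \<beta>" and f: "f \<in> borel_measurable borel"
  shows "(\<integral>\<^sup>+x. f (T g x) \<partial>\<Lambda>) = ennreal (cmod (det g) powr (- (k * d / CARD('n)))) * (\<integral>\<^sup>+x. f x \<partial>\<Lambda>)"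
proof -
  have [measurable]: "T g \<in> borel \<rightarrow>\<^sub>M borel" for g
    using lin by (intro borel_measurable_continuous_onI linear_continuous_on linear_linear[THEN iffD2])
  have inv: "T (matrix_inv g) (T g x) = x" "T g (T (matrix_inv g) x) = x" if "g \<in> GLF \<beta>" "x \<in> V" for g x
  proof -
    have "det g \<noteq> 0" using that by (simp add: GLF_def)
    then show "T (matrix_inv g) (T g x) = x" "T g (T (matrix_inv g) x) = x"
      using comp GLF_inv[OF that(1)] that one by (metis matrix_inv)+
  qed
  have im: "T g ` V = V" if "g \<in> GLF \<beta>" for g
    using inv(2)[OF that] V[OF that] V[OF GLF_inv[OF that]] by (force simp: image_iff)
  have inj: "inj_on (T g) V" if "g \<in> GLF \<beta>" for g
    using inv(1)[OF that] by (rule inj_on_inverseI)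
  have "\<forall>g\<in>GLF \<beta>. \<exists>c>0. \<forall>f\<in>borel_measurable borel. (\<integral>\<^sup>+x. f (T g x) \<partial>\<Lambda>) = ennreal c * (\<integral>\<^sup>+x. f x \<partial>\<Lambda>)"
    using linear_change[OF lin inj im] by metis
  then obtain \<psi> where \<psi>: "\<And>g. g \<in> GLF \<beta> \<Longrightarrow> \<psi> g > 0"
    "\<And>g f. g \<in> GLF \<beta> \<Longrightarrow> f \<in> borel_measurable borel \<Longrightarrow> (\<integral>\<^sup>+x. f (T g x) \<partial>\<Lambda>) = ennreal (\<psi> g) * (\<integral>\<^sup>+x. f x \<partial>\<Lambda>)"
    by metis
  let ?i = "indicator (cball 0 1) :: 'a \<Rightarrow> ennreal"
  have i: "?i \<in> borel_measurable borel" by (intro borel_measurable_indicator) simp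
  have uniq: "a = b" if "a \<ge> 0" "b \<ge> 0" "ennreal a * (\<integral>\<^sup>+x. ?i x \<partial>\<Lambda>) = ennreal b * (\<integral>\<^sup>+x. ?i x \<partial>\<Lambda>)" for a b
    using that cball_pos[of 1] leb_cball[of 1] unfolding cball_integral
    by (auto simp: mult.commute[of _ "emeasure _ _"] ennreal_mult_cancel_left)
  have mult: "\<psi> (g ** h) = \<psi> g * \<psi> h" if g: "g \<in> GLF \<beta>" and h: "h \<in> GLF \<beta>" for g h
  proof -
    have "(\<integral>\<^sup>+x. ?i (T (g ** h) x) \<partial>\<Lambda>) = (\<integral>\<^sup>+x. ?i (T g (T h x)) \<partial>\<Lambda>) \<or>
        (\<integral>\<^sup>+x. ?i (T (g ** h) x) \<partial>\<Lambda>) = (\<integral>\<^sup>+x. ?i (T h (T g x)) \<partial>\<Lambda>)"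
      using comp
    proof
      assume "\<forall>g\<in>GLF \<beta>. \<forall>h\<in>GLF \<beta>. \<forall>x\<in>V. T (g ** h) x = T g (T h x)"
      then have "(\<integral>\<^sup>+x. ?i (T (g ** h) x) \<partial>\<Lambda>) = (\<integral>\<^sup>+x. ?i (T g (T h x)) \<partial>\<Lambda>)"
        using g h AE_leb by (intro nn_integral_cong_AE) (auto elim!: eventually_mono)
      then show ?thesis ..
    next
      assume "\<forall>g\<in>GLF \<beta>. \<forall>h\<in>GLF \<beta>. \<forall>x\<in>V. T (g ** h) x = T h (T g x)"
      then have "(\<integral>\<^sup>+x. ?i (T (g ** h) x) \<partial>\<Lambda>) = (\<integral>\<^sup>+x. ?i (T h (T g x)) \<partial>\<Lambda>)"
        using g h AE_leb by (intro nn_integral_cong_AE) (auto elim!: eventually_mono)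
      then show ?thesis ..
    qed
    moreover have "(\<integral>\<^sup>+x. ?i (T g (T h x)) \<partial>\<Lambda>) = ennreal (\<psi> h * \<psi> g) * (\<integral>\<^sup>+x. ?i x \<partial>\<Lambda>)"
      if g: "g \<in> GLF \<beta>" and h: "h \<in> GLF \<beta>" for g h
    proof -
      have "(\<lambda>x. ?i (T g x)) \<in> borel_measurable borel" using i by measurable
      from \<psi>(2)[OF h this] \<psi>(2)[OF g i] \<psi>(1)[OF g] \<psi>(1)[OF h] show ?thesis
        by (simp add: ennreal_mult mult.assoc)
    qed
    ultimately have "ennreal (\<psi> (g ** h)) * (\<integral>\<^sup>+x. ?i x \<partial>\<Lambda>) = ennreal (\<psi> g * \<psi> h) * (\<integral>\<^sup>+x. ?i x \<partial>\<Lambda>)"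
      using g h \<psi>(2)[OF GLF_mult[OF g h] i] by (metis mult.commute)
    then show ?thesis by (rule uniq[rotated -1]) (use \<psi>(1) g h GLF_mult[OF g h] in \<open>auto intro!: less_imp_le\<close>)
  qed
  have unit: "\<psi> u = 1" if u: "u \<in> UF \<beta>" for u
  proof -
    have "(\<integral>\<^sup>+x. ?i (T u x) \<partial>\<Lambda>) = (\<integral>\<^sup>+x. ?i x \<partial>\<Lambda>)"
      using im[OF UF_GLF[OF u]] iso[OF u] i by (intro isometry_change[OF lin])
    then show ?thesis using \<psi>(2)[OF UF_GLF[OF u] i] \<psi>(1)[OF UF_GLF[OF u]] by (intro uniq) auto
  qed
  have r: "\<psi> (mat (of_real r)) = r powr (- (k * d))" if r: "r > 0" for r
  proof -
    have m: "mat (of_real r) \<in> GLF \<beta>" using r by (simp add: scale_on_GLF flip: scale_on_UNIV)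
    have "(\<integral>\<^sup>+x. ?i (T (mat (of_real r)) x) \<partial>\<Lambda>) = (\<integral>\<^sup>+x. ?i (r ^ k *\<^sub>R x) \<partial>\<Lambda>)"
      using dil[OF r] AE_leb by (intro nn_integral_cong_AE) (auto elim!: eventually_mono)
    also have "\<dots> = ennreal ((r ^ k) powr - d) * (\<integral>\<^sup>+x. ?i x \<partial>\<Lambda>)"
      using r i by (intro leb_dilate) auto
    also have "(r ^ k) powr - d = r powr (- (k * d))"
      using r by (simp add: powr_realpow[symmetric] powr_powr)
    finally show ?thesis using \<psi>(2)[OF m i] \<psi>(1)[OF m] by (intro uniq) auto
  qed
  have "\<psi> g = cmod (det g) powr (- (k * d) / CARD('n))"
    using \<psi>(1) mult unit r g by (rule character_eq_det_powr[where \<beta> = \<beta>])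
  then show ?thesis using \<psi>(2)[OF g f] by simp
qed

subsection \<open>Lebesgue measure on rectangular and Hermitian matrices\<close>

definition LM :: "nat \<Rightarrow> (complex^'n^'m) measure" where
  "LM \<beta> = (if \<beta> = 1 then distr lborel borel (\<lambda>A::real^'n^'m. \<chi> i j. complex_of_real (A $ i $ j)) else lborel)"

lemma leb_LM:
  assumes "\<beta> \<in> {1, 2}"
  shows "leb_on (VM \<beta> :: (complex^'n^'m) set) (LM \<beta>) (real \<beta> * CARD('n) * CARD('m))"
proof (cases "\<beta> = 1")
  case True
  let ?\<phi> = "\<lambda>A::real^'n^'m. \<chi> i j. complex_of_real (A $ i $ j)"
  interpret R: leb_on UNIV "lborel :: (real^'n^'m) measure" "real DIM(real^'n^'m)" by (rule leb_on_lborel)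
  have "leb_on (range ?\<phi>) (distr lborel borel ?\<phi>) (real DIM(real^'n^'m))"
    by (rule R.image) (auto simp: linear_iff vec_eq_iff scaleR_conv_of_real[where 'a = complex] intro!: inj_onI)
  moreover have "range ?\<phi> = VM \<beta>"
  proof
    show "range ?\<phi> \<subseteq> VM \<beta>" by (auto simp: VM_def real_matrix_def)
    show "VM \<beta> \<subseteq> range ?\<phi>"
    proof
      fix A :: "complex^'n^'m" assume "A \<in> VM \<beta>"
      then have "A = ?\<phi> (\<chi> i j. Re (A $ i $ j))"
        using True by (simp add: VM_def real_matrix_def vec_eq_iff complex_eq_iff)
      then show "A \<in> range ?\<phi>" by (rule range_eqI)
    qed
  qed
  ultimately show ?thesis using True by (simp add: LM_def mult.commute)
next
  case False
  then have 2: "\<beta> = 2" using assms by simp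
  have "VM \<beta> = (UNIV :: (complex^'n^'m) set)" using False by (simp add: VM_def)
  then show ?thesis
    using leb_on_lborel[where 'a = "complex^'n^'m"] 2 by (simp add: LM_def ac_simps)
qed

lemma LM_right:
  fixes h :: "complex^'n^'n" and f :: "complex^'n^'m \<Rightarrow> ennreal"
  assumes \<beta>: "\<beta> \<in> {1, 2}" and h: "h \<in> GLF \<beta>" and f: "f \<in> borel_measurable borel"
  shows "(\<integral>\<^sup>+X. f (X ** h) \<partial>LM \<beta>) = ennreal (cmod (det h) powr (- (real \<beta> * CARD('m)))) * (\<integral>\<^sup>+X. f X \<partial>LM \<beta>)"
proof -
  interpret leb_on "VM \<beta> :: (complex^'n^'m) set" "LM \<beta>" "real \<beta> * CARD('n) * CARD('m)"
    using \<beta> by (rule leb_LM)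
  have "(\<integral>\<^sup>+X. f (X ** h) \<partial>LM \<beta>) =
    ennreal (cmod (det h) powr (- (real 1 * (real \<beta> * CARD('n) * CARD('m)) / CARD('n)))) * (\<integral>\<^sup>+X. f X \<partial>LM \<beta>)"
    by (rule group_action[where T = "\<lambda>h X. X ** h" and k = 1])
      (use h f in \<open>auto simp: linear_iff matrix_mult_add_rdistrib matrix_mult_scaleR_left VM_mult GLF_def
         matrix_mul_assoc norm_unitary_right UF_right mat_of_real_mult\<close>)
  then show ?thesis by simp
qed

lemma LM_left:
  fixes h :: "complex^'m^'m" and f :: "complex^'n^'m \<Rightarrow> ennreal"
  assumes \<beta>: "\<beta> \<in> {1, 2}" and h: "h \<in> GLF \<beta>" and f: "f \<in> borel_measurable borel"
  shows "(\<integral>\<^sup>+X. f (h ** X) \<partial>LM \<beta>) = ennreal (cmod (det h) powr (- (real \<beta> * CARD('n)))) * (\<integral>\<^sup>+X. f X \<partial>LM \<beta>)"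
proof -
  interpret leb_on "VM \<beta> :: (complex^'n^'m) set" "LM \<beta>" "real \<beta> * CARD('n) * CARD('m)"
    using \<beta> by (rule leb_LM)
  have "(\<integral>\<^sup>+X. f (h ** X) \<partial>LM \<beta>) =
    ennreal (cmod (det h) powr (- (real 1 * (real \<beta> * CARD('n) * CARD('m)) / CARD('m)))) * (\<integral>\<^sup>+X. f X \<partial>LM \<beta>)"
    by (rule group_action[where T = "\<lambda>h X. h ** X" and k = 1])
      (use h f in \<open>auto simp: linear_iff matrix_add_ldistrib matrix_mult_scaleR_right VM_mult GLF_def
         matrix_mul_assoc norm_unitary_left UF_def mat_of_real_mult\<close>)
  then show ?thesis by simp
qed

text \<open>\<open>det (A + mat z)\<close> is a polynomial in \<open>z\<close>. It is not zero,
  because \<open>A + mat z\<close> is injective once the real number \<open>z\<close> exceeds a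
  bound for the operator \<open>A\<close>.\<close>

lemma finite_det_shift:
  fixes A :: "complex^'n^'n"
  shows "finite {t::real. det (A + t *\<^sub>R mat 1) = 0}"
proof -
  define P :: "complex poly^'n^'n" where "P = (\<chi> i j. [:A $ i $ j, if i = j then 1 else 0:])"
  have P: "poly (det P) z = det (A + mat z)" for z
  proof -
    have "poly (of_int k) z = of_int k" for k by (simp add: of_int_poly)
    moreover have "poly (P $ i $ j) z = (A + mat z) $ i $ j" for i j
      by (simp add: P_def mat_def)
    ultimately show ?thesis by (simp add: det_def poly_sum poly_prod)
  qed
  have "det P \<noteq> 0"
  proof
    assume "det P = 0"
    obtain b where b: "b > 0" "\<And>x. norm (A *v x) \<le> norm x * b"
      using bounded_linear.pos_bounded[OF matrix_vector_mul_bounded_linear[of A]] by blast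
    have "det (A + mat (of_real (b + 1))) = 0" using P[of "of_real (b + 1)"] \<open>det P = 0\<close> by simp
    then obtain x where x: "x \<noteq> 0" "(A + mat (of_real (b + 1))) *v x = 0" by (rule det_zero_kernel)
    have "mat (of_real (b + 1)) *v x = (b + 1) *\<^sub>R x"
      unfolding mat_of_real by (simp add: matrix_vector_mult_def vec_eq_iff mat_def scaleR_sum_right
          if_distrib[of "\<lambda>x. x * _"] if_distrib[of "scaleR _"] cong: if_cong)
    then have "A *v x = - ((b + 1) *\<^sub>R x)"
      using x(2) by (simp add: matrix_vector_mult_add_rdistrib eq_neg_iff_add_eq_0)
    then have "(b + 1) * norm x \<le> norm x * b" using b(2)[of x] b(1) by simp
    then show False using x(1) b(1) by (simp add: algebra_simps)
  qed
  then have "finite {z. poly (det P) z = 0}" by (rule poly_roots_finite)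
  then have "finite (complex_of_real -` {z. poly (det P) z = 0})"
    by (rule finite_vimageI) (rule inj_of_real)
  also have "complex_of_real -` {z. poly (det P) z = 0} = {t::real. det (A + t *\<^sub>R mat 1) = 0}"
    by (simp add: P mat_of_real vimage_def)
  finally show ?thesis .
qed

text \<open>Along a line in direction \<open>E\<close> the product \<open>F ** X\<close> moves by
  real multiples of the identity, so each such line meets the singular set in finitely many
  points.\<close>

lemma AE_LM_det_mult:
  fixes F :: "complex^'m^'n" and E :: "complex^'n^'m"
  assumes \<beta>: "\<beta> \<in> {1, 2}" and E: "E \<in> VM \<beta>" and FE: "F ** E = mat 1"
  shows "AE X in LM \<beta>. det (F ** X) \<noteq> 0"
proof -
  interpret leb_on "VM \<beta> :: (complex^'n^'m) set" "LM \<beta>" "real \<beta> * CARD('n) * CARD('m)"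
    using \<beta> by (rule leb_LM)
  have "AE X in LM \<beta>. X \<notin> {X. det (F ** X) = 0}"
  proof (rule AE_not_in_of_finite_lines[OF E])
    show "{X. det (F ** X) = 0} \<in> sets borel" by measurable
    show "finite {t. X + t *\<^sub>R E \<in> {X. det (F ** X) = 0}}" for X
      using finite_det_shift[of "F ** X"] by (simp add: matrix_add_ldistrib matrix_mult_scaleR_right FE)
  qed
  then show ?thesis by simp
qed

text \<open>The notation \<open>complex^'n\<close> constrains \<open>'n\<close> to the sort \<open>finite\<close>, which clashes with an explicit
sort constraint \<open>{finite,linorder}\<close>.\<close>
type_synonym 'n cmat = "((complex, 'n) vec, 'n) vec"

text \<open>The factor 2 anticipates the degree of congruence in \<open>group_action\<close>. For
  \<open>\<beta> = 1\<close>, the upper and lower triangles have equal size and overlap in the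
  diagonal.\<close>

lemma card_herm_param_index:
  assumes "\<beta> \<in> {1, 2}"
  shows "2 * real (card (herm_param_index \<beta> :: ('n::{finite,linorder} \<times> 'n) set))
    = CARD('n) * (real \<beta> * (real CARD('n) - 1) + 2)"
proof (cases "\<beta> = 1")
  case True
  let ?A = "{(i, j). i \<le> j} :: ('n \<times> 'n) set" and ?B = "{(i, j). j \<le> i} :: ('n \<times> 'n) set"
  have "card (?A \<union> ?B) + card (?A \<inter> ?B) = card ?A + card ?B"
    by (rule card_Un_Int[symmetric]) auto
  moreover have "?A \<union> ?B = UNIV" by auto
  moreover have "?A \<inter> ?B = (\<lambda>i. (i, i)) ` UNIV" by auto
  moreover have "card ((\<lambda>i::'n. (i, i)) ` UNIV) = CARD('n)" by (rule card_image) (simp add: inj_on_def)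
  moreover have "card ?B = card ?A"
    by (rule bij_betw_same_card[of prod.swap]) (auto simp: bij_betw_def inj_on_def image_iff)
  ultimately have "CARD('n) * CARD('n) + CARD('n) = 2 * card ?A" by (simp add: card_prod)
  then have "real CARD('n) * CARD('n) + CARD('n) = 2 * real (card ?A)"
    by (metis of_nat_add of_nat_mult of_nat_numeral)
  then show ?thesis using True by (simp add: herm_param_index_def algebra_simps)
next
  case False
  then show ?thesis using assms by (auto simp: herm_param_index_def card_prod algebra_simps)
qed

text \<open>A product measure is determined on boxes, where one-dimensional invariance suffices. The
  restricted abstraction keeps the translated point in the extensional function space of
  \<open>PiM\<close>.\<close>

lemma nn_integral_PiM_lborel_translate:
  fixes v :: "'i \<Rightarrow> real"
  assumes I: "finite I" and f[measurable]: "f \<in> borel_measurable (PiM I (\<lambda>_. lborel))"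
  shows "(\<integral>\<^sup>+p. f (\<lambda>i\<in>I. p i + v i) \<partial>PiM I (\<lambda>_. lborel)) = (\<integral>\<^sup>+p. f p \<partial>PiM I (\<lambda>_. lborel))"
proof -
  let ?M = "PiM I (\<lambda>_. lborel :: real measure)" and ?T = "\<lambda>p. \<lambda>i\<in>I. p i + v i"
  interpret product_sigma_finite "\<lambda>_::'i. lborel :: real measure" by standard
  have T[measurable]: "?T \<in> ?M \<rightarrow>\<^sub>M ?M" by measurable
  have "distr ?M ?M ?T = ?M"
  proof (rule PiM_eqI[OF I])
    fix A :: "'i \<Rightarrow> real set" assume A: "\<And>i. i \<in> I \<Longrightarrow> A i \<in> sets lborel"
    have tr: "emeasure lborel ((\<lambda>x. x + v i) -` A i) = emeasure lborel (A i)" if "i \<in> I" for i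
    proof -
      have "emeasure lborel (A i) = emeasure (distr lborel borel ((+) (v i))) (A i)"
        by (simp add: lborel_distr_plus)
      also have "\<dots> = emeasure lborel ((\<lambda>x. x + v i) -` A i)"
      proof -
        have "(+) (v i) = (\<lambda>x. x + v i)" by auto
        then show ?thesis using A[OF that] by (simp add: emeasure_distr)
      qed
      finally show ?thesis ..
    qed
    have "emeasure (distr ?M ?M ?T) (Pi\<^sub>E I A) = emeasure ?M (?T -` Pi\<^sub>E I A \<inter> space ?M)"
      using A I by (intro emeasure_distr T sets_PiM_I_finite) auto
    also have "?T -` Pi\<^sub>E I A \<inter> space ?M = Pi\<^sub>E I (\<lambda>i. (\<lambda>x. x + v i) -` A i)"
      by (auto simp: space_PiM PiE_def Pi_def extensional_def)
    also have "emeasure ?M \<dots> = (\<Prod>i\<in>I. emeasure lborel ((\<lambda>x. x + v i) -` A i))"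
    proof (rule emeasure_PiM[OF I])
      fix i assume "i \<in> I"
      from measurable_sets[OF _ A[OF this], of "\<lambda>x. x + v i" borel]
      show "(\<lambda>x. x + v i) -` A i \<in> sets lborel" by simp
    qed
    also have "\<dots> = (\<Prod>i\<in>I. emeasure lborel (A i))" using tr by (intro prod.cong) auto
    finally show "emeasure (distr ?M ?M ?T) (Pi\<^sub>E I A) = (\<Prod>i\<in>I. emeasure lborel (A i))" .
  qed simp
  then have "(\<integral>\<^sup>+p. f p \<partial>?M) = (\<integral>\<^sup>+p. f p \<partial>distr ?M ?M ?T)" by simp
  then show ?thesis by (simp add: nn_integral_distr)
qed

lemma nn_integral_PiM_lborel_dilate:
  fixes f :: "('i \<Rightarrow> real) \<Rightarrow> ennreal"
  assumes I: "finite I" and f[measurable]: "f \<in> borel_measurable (PiM I (\<lambda>_. lborel))" and r: "r > 0"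
  shows "(\<integral>\<^sup>+p. f (\<lambda>i\<in>I. r * p i) \<partial>PiM I (\<lambda>_. lborel)) =
     ennreal (r powr - real (card I)) * (\<integral>\<^sup>+p. f p \<partial>PiM I (\<lambda>_. lborel))"
proof -
  let ?M = "PiM I (\<lambda>_. lborel :: real measure)" and ?T = "\<lambda>p. \<lambda>i\<in>I. r * p i"
  interpret product_sigma_finite "\<lambda>_::'i. lborel :: real measure" by standard
  have T[measurable]: "?T \<in> ?M \<rightarrow>\<^sub>M ?M" by measurable
  have "scale_measure (ennreal (r ^ card I)) (distr ?M ?M ?T) = ?M"
  proof (rule PiM_eqI[OF I])
    fix A :: "'i \<Rightarrow> real set" assume A: "\<And>i. i \<in> I \<Longrightarrow> A i \<in> sets lborel"
    have tr: "ennreal r * emeasure lborel ((*) r -` A i) = emeasure lborel (A i)" if "i \<in> I" for i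
    proof -
      have "emeasure lborel (A i) = emeasure (density (distr lborel borel ((*) r)) (\<lambda>_. \<bar>r\<bar>)) (A i)"
        using r by (subst lborel_distr_mult'[of r]) auto
      also have "\<dots> = ennreal r * emeasure lborel ((*) r -` A i)"
        using A[OF that] r by (subst emeasure_density) (auto simp: nn_integral_cmult emeasure_distr)
      finally show ?thesis by simp
    qed
    have "emeasure (distr ?M ?M ?T) (Pi\<^sub>E I A) = emeasure ?M (?T -` Pi\<^sub>E I A \<inter> space ?M)"
      using A I by (intro emeasure_distr T sets_PiM_I_finite) auto
    also have "?T -` Pi\<^sub>E I A \<inter> space ?M = Pi\<^sub>E I (\<lambda>i. (*) r -` A i)"
      by (auto simp: space_PiM PiE_def Pi_def extensional_def)
    also have "emeasure ?M \<dots> = (\<Prod>i\<in>I. emeasure lborel ((*) r -` A i))"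
    proof (rule emeasure_PiM[OF I])
      fix i assume "i \<in> I"
      from measurable_sets[OF _ A[OF this], of "(*) r" borel]
      show "(*) r -` A i \<in> sets lborel" by simp
    qed
    finally have "emeasure (distr ?M ?M ?T) (Pi\<^sub>E I A) = (\<Prod>i\<in>I. emeasure lborel ((*) r -` A i))" .
    then have "emeasure (scale_measure (ennreal (r ^ card I)) (distr ?M ?M ?T)) (Pi\<^sub>E I A)
        = (\<Prod>i\<in>I. ennreal r * emeasure lborel ((*) r -` A i))"
      unfolding emeasure_scale_measure prod.distrib using r by (simp only: prod_constant ennreal_power less_imp_le)
    also have "\<dots> = (\<Prod>i\<in>I. emeasure lborel (A i))" using tr by (intro prod.cong) auto
    finally show "emeasure (scale_measure (ennreal (r ^ card I)) (distr ?M ?M ?T)) (Pi\<^sub>E I A)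
        = (\<Prod>i\<in>I. emeasure lborel (A i))" .
  qed simp
  then have "(\<integral>\<^sup>+p. f p \<partial>?M) = (\<integral>\<^sup>+p. f p \<partial>scale_measure (ennreal (r ^ card I)) (distr ?M ?M ?T))" by simp
  also have "\<dots> = ennreal (r powr real (card I)) * (\<integral>\<^sup>+p. f (?T p) \<partial>?M)"
    using r by (subst nn_integral_scale_measure) (simp_all add: nn_integral_distr powr_realpow)
  finally have "ennreal (r powr - real (card I)) * (\<integral>\<^sup>+p. f p \<partial>?M) =
      (ennreal (r powr - real (card I)) * ennreal (r powr real (card I))) * (\<integral>\<^sup>+p. f (?T p) \<partial>?M)"
    by (simp add: mult.assoc)
  also have "ennreal (r powr - real (card I)) * ennreal (r powr real (card I)) = 1"
    using r by (simp add: ennreal_mult[symmetric] powr_add[symmetric])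
  finally show ?thesis by (simp only: mult_1_left)
qed

lemma herm_of_param_Herm: "herm_of_param \<beta> p \<in> Herm \<beta>"
  by (auto simp: Herm_def VM_def real_matrix_def mat_adj_def herm_of_param_def vec_eq_iff complex_eq_iff)

lemma herm_of_param_surj:
  assumes "S \<in> Herm \<beta>" "\<beta> \<in> {1, 2}" obtains p where "herm_of_param \<beta> p = S"
proof
  let ?p = "\<lambda>(i, j). if i \<le> j then Re (S $ i $ j) else Im (S $ j $ i)"
  have adj: "cnj (S $ j $ i) = S $ i $ j" for i j
    using assms(1) unfolding Herm_def mat_adj_def by (simp add: vec_eq_iff)
  have dg: "Im (S $ i $ i) = 0" for i using adj[of i i] by (simp add: complex_eq_iff)
  have od: "Im (S $ j $ i) = - Im (S $ i $ j)" "Re (S $ j $ i) = Re (S $ i $ j)" for i j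
    using adj[of i j] by (auto simp: complex_eq_iff)
  have re: "Im (S $ i $ j) = 0" if "\<beta> \<noteq> 2" for i j
    using assms that by (simp add: Herm_def VM_def real_matrix_def)
  have "herm_of_param \<beta> ?p $ i $ j = S $ i $ j" for i j
  proof (cases i j rule: linorder_cases)
    case less
    then show ?thesis using re[of i j] by (auto simp: herm_of_param_def complex_eq_iff)
  next
    case equal
    then show ?thesis using dg by (simp add: herm_of_param_def complex_eq_iff)
  next
    case greater
    then show ?thesis using re[of i j] od[of i j] by (auto simp: herm_of_param_def complex_eq_iff)
  qed
  then show "herm_of_param \<beta> ?p = S" by (simp add: vec_eq_iff)
qed

lemma leb_herm_lebesgue:
  assumes \<beta>: "\<beta> \<in> {1, 2}"
  shows "leb_on (Herm \<beta> :: ('n::{finite,linorder} cmat) set) (herm_lebesgue \<beta>)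
    (real (card (herm_param_index \<beta> :: ('n \<times> 'n) set)))"
proof -
  define I where "I = (herm_param_index \<beta> :: ('n \<times> 'n) set)"
  let ?M = "PiM I (\<lambda>_. lborel :: real measure)" and ?h = "herm_of_param \<beta> :: _ \<Rightarrow> 'n cmat"
  interpret product_sigma_finite "\<lambda>_::'n \<times> 'n. lborel :: real measure" by standard
  have fin: "finite I" by simp
  have mem: "(i, i) \<in> I" "i < j \<Longrightarrow> (i, j) \<in> I" "\<beta> = 2 \<Longrightarrow> (i, j) \<in> I" for i j
    by (auto simp: I_def herm_param_index_def)
  have h[measurable]: "?h \<in> ?M \<rightarrow>\<^sub>M borel"
  proof -
    have *: "(\<lambda>p. p (i, j)) \<in> borel_measurable ?M" if "(i, j) \<in> I" for i j
      using measurable_component_singleton[OF that, of "\<lambda>_. lborel"] by simp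
    have "(\<lambda>p. ?h p $ i $ j) \<in> borel_measurable ?M" for i j
    proof -
      have if2: "(\<lambda>p. if \<beta> = 2 then p (a, b) else 0) \<in> borel_measurable ?M" for a b
        using *[OF mem(3), of a b] by (cases "\<beta> = 2") auto
      show ?thesis
      proof (cases i j rule: linorder_cases)
        case less
        then have "(\<lambda>p. ?h p $ i $ j) = (\<lambda>p. Complex (p (i, j)) (if \<beta> = 2 then p (j, i) else 0))"
          by (auto simp: herm_of_param_def fun_eq_iff)
        then show ?thesis using *[OF mem(2)[OF less]] if2[of j i] by (simp add: borel_measurable_complex_iff)
      next
        case equal
        then have "(\<lambda>p. ?h p $ i $ j) = (\<lambda>p. complex_of_real (p (i, i)))"
          by (auto simp: herm_of_param_def fun_eq_iff)
        then show ?thesis using *[OF mem(1), of i] by simp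
      next
        case greater
        then have "(\<lambda>p. ?h p $ i $ j) = (\<lambda>p. Complex (p (j, i)) (- (if \<beta> = 2 then p (i, j) else 0)))"
          by (auto simp: herm_of_param_def fun_eq_iff)
        then show ?thesis using *[OF mem(2)[OF greater]] borel_measurable_uminus[OF if2[of i j]]
          by (simp add: borel_measurable_complex_iff)
      qed
    qed
    then show ?thesis by (intro borel_measurable_vec)
  qed
  \<comment> \<open>Only coordinates in \<open>I\<close> enter the matrix, so restricting a
    parameter function to \<open>I\<close> does not change it.\<close>
  have dep: "?h p = ?h q" if "\<And>i. i \<in> I \<Longrightarrow> p i = q i" for p q
    using that mem by (auto simp: herm_of_param_def vec_eq_iff complex_eq_iff)
  have ni: "(\<integral>\<^sup>+S. f S \<partial>herm_lebesgue \<beta>) = (\<integral>\<^sup>+p. f (?h p) \<partial>?M)"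
    if "f \<in> borel_measurable borel" for f :: "'n cmat \<Rightarrow> ennreal"
    using that by (simp add: herm_lebesgue_def I_def[symmetric] nn_integral_distr)
  show ?thesis
  proof
    show "subspace (Herm \<beta> :: ('n cmat) set)" by (rule subspace_Herm)
    show "sets (herm_lebesgue \<beta> :: ('n cmat) measure) = sets borel" by (simp add: herm_lebesgue_def)
    show "AE S in herm_lebesgue \<beta>. S \<in> (Herm \<beta> :: ('n cmat) set)"
      unfolding herm_lebesgue_def I_def[symmetric]
      by (subst AE_distr_iff) (auto simp: herm_of_param_Herm)
    show "emeasure (herm_lebesgue \<beta>) (space (herm_lebesgue \<beta> :: ('n cmat) measure)) \<noteq> 0"
    proof -
      have "emeasure (herm_lebesgue \<beta>) (space (herm_lebesgue \<beta> :: ('n cmat) measure)) = emeasure ?M (Pi\<^sub>E I (\<lambda>_. UNIV))"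
        unfolding herm_lebesgue_def I_def[symmetric] using h
        by (subst emeasure_distr) (auto simp: space_PiM)
      also have "\<dots> = (\<Prod>i\<in>I. emeasure lborel (UNIV :: real set))"
        by (rule emeasure_PiM[OF fin]) simp
      also have "\<dots> \<noteq> 0" by simp
      finally show ?thesis .
    qed
    show "emeasure (herm_lebesgue \<beta>) (cball (0 :: 'n cmat) r) < \<infinity>" for r
    proof -
      \<comment> \<open>Every coordinate is the real or imaginary part of an entry, up to sign, so a
        ball of matrices is contained in a bounded box of parameters. Coordinates below the diagonal
        occur in \<open>I\<close> only for \<open>\<beta> = 2\<close>, where they are imaginary
        parts.\<close>
      have bd: "\<bar>p i\<bar> \<le> norm (?h p)" if "i \<in> I" for p i
      proof -
        obtain a b where i: "i = (a, b)" by fastforce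
        have e: "cmod (?h p $ x $ y) \<le> norm (?h p)" for x y
          by (rule order_trans[OF Finite_Cartesian_Product.norm_nth_le Finite_Cartesian_Product.norm_nth_le])
        consider "a = b" | "a < b" | "b < a" by (rule linorder_cases)
        then show ?thesis
        proof cases
          case 1 then show ?thesis using e[of a b] i by (simp add: herm_of_param_def)
        next
          case 2
          have "\<bar>p i\<bar> = \<bar>Re (?h p $ a $ b)\<bar>" using 2 i by (simp add: herm_of_param_def)
          then show ?thesis using e[of a b] abs_Re_le_cmod[of "?h p $ a $ b"] by linarith
        next
          case 3
          then have "\<beta> = 2" using that i \<beta> by (auto simp: I_def herm_param_index_def)
          then have "\<bar>p i\<bar> = \<bar>Im (?h p $ b $ a)\<bar>" using 3 i by (simp add: herm_of_param_def)
          then show ?thesis using e[of b a] abs_Im_le_cmod[of "?h p $ b $ a"] by linarith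
        qed
      qed
      have "emeasure (herm_lebesgue \<beta>) (cball (0 :: 'n cmat) r) = emeasure ?M (?h -` cball 0 r \<inter> space ?M)"
        unfolding herm_lebesgue_def I_def[symmetric] using h by (intro emeasure_distr) auto
      also have "\<dots> \<le> emeasure ?M (Pi\<^sub>E I (\<lambda>_. {-r..r}))"
      proof (rule emeasure_mono)
        show "?h -` cball 0 r \<inter> space ?M \<subseteq> Pi\<^sub>E I (\<lambda>_. {-r..r})"
        proof
          fix p assume p: "p \<in> ?h -` cball 0 r \<inter> space ?M"
          have "p i \<in> {-r..r}" if "i \<in> I" for i
            using bd[OF that, of p] p by (auto simp: abs_le_iff)
          then show "p \<in> Pi\<^sub>E I (\<lambda>_. {-r..r})" using p by (simp add: space_PiM PiE_iff)
        qed
      qed (intro sets_PiM_I_finite fin, simp)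
      also have "\<dots> = (\<Prod>i\<in>I. emeasure lborel {-r..r})"
        by (rule emeasure_PiM[OF fin]) simp
      also have "\<dots> < \<infinity>"
        by (simp add: ennreal_power power_less_top_ennreal less_top[symmetric] emeasure_lborel_Icc_eq)
      finally show ?thesis .
    qed
    fix f :: "'n cmat \<Rightarrow> ennreal" assume f[measurable]: "f \<in> borel_measurable borel"
    show "(\<integral>\<^sup>+S. f (S + v) \<partial>herm_lebesgue \<beta>) = (\<integral>\<^sup>+S. f S \<partial>herm_lebesgue \<beta>)" if "v \<in> Herm \<beta>" for v
    proof -
      obtain q where q: "?h q = v" using herm_of_param_surj \<open>v \<in> Herm \<beta>\<close> \<beta> by metis
      have "?h p + v = ?h (\<lambda>i\<in>I. p i + q i)" for p
      proof -
        have "?h (\<lambda>i\<in>I. p i + q i) = ?h (\<lambda>i. p i + q i)" by (rule dep) simp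
        then show ?thesis unfolding q[symmetric] by (simp add: herm_of_param_def vec_eq_iff complex_eq_iff)
      qed
      then have "(\<integral>\<^sup>+S. f (S + v) \<partial>herm_lebesgue \<beta>) = (\<integral>\<^sup>+p. f (?h (\<lambda>i\<in>I. p i + q i)) \<partial>?M)"
        by (subst ni) auto
      also have "\<dots> = (\<integral>\<^sup>+p. f (?h p) \<partial>?M)"
        by (rule nn_integral_PiM_lborel_translate[OF fin, where f = "\<lambda>p. f (?h p)"]) measurable
      finally show ?thesis by (simp add: ni)
    qed
    show "(\<integral>\<^sup>+S. f (r *\<^sub>R S) \<partial>herm_lebesgue \<beta>) = ennreal (r powr - real (card (herm_param_index \<beta> :: ('n \<times> 'n) set))) * (\<integral>\<^sup>+S. f S \<partial>herm_lebesgue \<beta>)"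
      if "r > 0" for r
    proof -
      have "r *\<^sub>R ?h p = ?h (\<lambda>i\<in>I. r * p i)" for p
      proof -
        have "?h (\<lambda>i\<in>I. r * p i) = ?h (\<lambda>i. r * p i)" by (rule dep) simp
        then show ?thesis by (simp add: herm_of_param_def vec_eq_iff complex_eq_iff)
      qed
      then have "(\<integral>\<^sup>+S. f (r *\<^sub>R S) \<partial>herm_lebesgue \<beta>) = (\<integral>\<^sup>+p. f (?h (\<lambda>i\<in>I. r * p i)) \<partial>?M)"
        by (subst ni) auto
      also have "\<dots> = ennreal (r powr - real (card I)) * (\<integral>\<^sup>+p. f (?h p) \<partial>?M)"
        by (rule nn_integral_PiM_lborel_dilate[OF fin, where f = "\<lambda>p. f (?h p)", OF _ \<open>r > 0\<close>]) measurable
      finally show ?thesis by (simp add: ni I_def)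
    qed
  qed
qed

text \<open>Congruence by a scalar matrix \<open>r\<close> multiplies by the square of
  \<open>r\<close>, so \<open>group_action\<close> applies with degree 2 and the exponent is twice
  the dimension over \<open>CARD('n)\<close>.\<close>

lemma herm_lebesgue_congruence:
  fixes g :: "'n::{finite,linorder} cmat"
  assumes \<beta>: "\<beta> \<in> {1, 2}" and g: "g \<in> GLF \<beta>" and f: "f \<in> borel_measurable borel"
  shows "(\<integral>\<^sup>+S. f (mat_adj g ** S ** g) \<partial>herm_lebesgue \<beta>) =
    ennreal (cmod (det g) powr (- (real \<beta> * (real CARD('n) - 1) + 2))) * (\<integral>\<^sup>+S. f S \<partial>herm_lebesgue \<beta>)"
proof -
  let ?c = "real (card (herm_param_index \<beta> :: ('n \<times> 'n) set))"
  interpret leb_on "Herm \<beta> :: ('n cmat) set" "herm_lebesgue \<beta>" ?c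
    using \<beta> by (rule leb_herm_lebesgue)
  have n: "norm (mat_adj u ** S ** u) = norm S" if "u \<in> UF \<beta>" for u S :: "'n cmat"
    using norm_unitary_right[OF UF_right[OF that], of "mat_adj u ** S"]
      norm_unitary_left[of "mat_adj u" S] UF_right[OF that] by simp
  have "(\<integral>\<^sup>+S. f (mat_adj g ** S ** g) \<partial>herm_lebesgue \<beta>) =
    ennreal (cmod (det g) powr (- (real 2 * ?c / CARD('n)))) * (\<integral>\<^sup>+S. f S \<partial>herm_lebesgue \<beta>)"
  proof (rule group_action[where T = "\<lambda>h X. mat_adj h ** X ** h" and k = 2])
    show "linear (\<lambda>X. mat_adj g ** X ** g)" for g :: "'n cmat"
      by (simp add: linear_iff matrix_add_ldistrib matrix_mult_add_rdistrib matrix_mult_scaleR_left matrix_mult_scaleR_right)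
    show "mat_adj g ** X ** g \<in> Herm \<beta>" if "g \<in> GLF \<beta>" "X \<in> Herm \<beta>" for g X
      using that by (auto intro!: Herm_congruence simp: GLF_def)
    show "mat_adj (mat (of_real r)) ** X ** mat (of_real r) = r\<^sup>2 *\<^sub>R X" for r and X :: "'n cmat"
      by (simp add: mat_adj_mat mat_of_real_mult power2_eq_square)
  qed (use n g f in \<open>auto simp: mat_adj_mult matrix_mul_assoc\<close>)
  moreover have "real 2 * ?c / CARD('n) = real \<beta> * (real CARD('n) - 1) + 2"
    using card_herm_param_index[OF \<beta>, where 'n = 'n] by (simp add: field_simps)
  ultimately show ?thesis by simp
qed

subsection \<open>Haar measure on the general linear group and invariant measures on the positive cone\<close>

text \<open>As \<open>0 powr r = 0\<close>, this vanishes on singular matrices for every \<open>r\<close>.\<close>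
definition dpow :: "complex^'n^'n \<Rightarrow> real \<Rightarrow> ennreal" where
  "dpow A r = ennreal (cmod (det A) powr r)"

lemma borel_measurable_dpow[measurable (raw)]:
  assumes [measurable]: "A \<in> borel_measurable M"
  shows "(\<lambda>x. dpow (A x) r) \<in> borel_measurable M"
  unfolding dpow_def by measurable

lemma dpow_mult: "dpow (A ** B) r = dpow A r * dpow B r"
  by (simp add: dpow_def det_mul norm_mult powr_mult ennreal_mult)

lemma dpow_plus: "dpow A (r + s) = dpow A r * dpow A s"
  by (simp add: dpow_def powr_add ennreal_mult)

lemma dpow_0: "det A \<noteq> 0 \<Longrightarrow> dpow A 0 = 1"
  by (simp add: dpow_def)

lemma dpow_cancel: "det A \<noteq> 0 \<Longrightarrow> dpow A r * (dpow A (- r) * x) = x" "det A \<noteq> 0 \<Longrightarrow> dpow A (- r) * (dpow A r * x) = x"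
proof -
  have "dpow A r * (dpow A (- r) * x) = dpow A (r + - r) * x" "dpow A (- r) * (dpow A r * x) = dpow A (- r + r) * x"
    by (simp_all only: dpow_plus mult.assoc)
  then show "det A \<noteq> 0 \<Longrightarrow> dpow A r * (dpow A (- r) * x) = x" "det A \<noteq> 0 \<Longrightarrow> dpow A (- r) * (dpow A r * x) = x"
    by (simp_all add: dpow_0)
qed

lemma dpow_mult_cancel:
  assumes "det h \<noteq> 0"
  shows "dpow h r * (dpow (g ** h) (- r) * x) = dpow g (- r) * x"
    and "dpow h r * (dpow (h ** g) (- r) * x) = dpow g (- r) * x"
proof -
  have "dpow h r * (dpow (g ** h) (- r) * x) = dpow g (- r) * (dpow h r * (dpow h (- r) * x))"
    by (simp only: dpow_mult ac_simps)
  then show "dpow h r * (dpow (g ** h) (- r) * x) = dpow g (- r) * x"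
    using assms by (simp add: dpow_cancel)
  then show "dpow h r * (dpow (h ** g) (- r) * x) = dpow g (- r) * x"
    by (simp only: dpow_mult mult.commute[of "dpow h _" "dpow g _"])
qed

lemma dpow_adj: "dpow (mat_adj A) r = dpow A r"
  by (simp add: dpow_def det_mat_adj)

lemma dpow_inv: "det A \<noteq> 0 \<Longrightarrow> dpow (matrix_inv A) r = dpow A (- r)"
  by (simp add: dpow_def det_matrix_inv norm_inverse powr_minus inverse_powr)

lemma dpow_congruence: "dpow (mat_adj g ** S ** g) r = dpow g (2 * r) * dpow S r"
  using dpow_plus[of g r r] by (simp add: dpow_mult dpow_adj ac_simps)

lemma dpow_gram: "dpow (mat_adj g ** g) r = dpow g (2 * r)"
  using dpow_plus[of g r r] by (simp add: dpow_mult dpow_adj)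

lemma dpow_neq_top: "dpow A r \<noteq> \<top>" "dpow A r < \<top>"
  by (simp_all add: dpow_def)

lemma dpow_pos: "0 < dpow A r \<longleftrightarrow> det A \<noteq> 0"
  by (simp add: dpow_def)

text \<open>The infinite Haar measure of the general linear group, seen on all matrices. Left and
  right multiplication scale \<open>LM\<close> on square matrices by the same factor, so this
  density makes it invariant on both sides.\<close>

definition HM :: "nat \<Rightarrow> (complex^'n^'n) measure" where
  "HM \<beta> = density (LM \<beta>) (\<lambda>g. dpow g (- (real \<beta> * CARD('n))))"

lemma sets_LM[measurable_cong]: "sets (LM \<beta>) = sets borel" by (simp add: LM_def)
lemma sets_HM[measurable_cong]: "sets (HM \<beta>) = sets borel" by (simp add: HM_def sets_LM)

lemma measurable_LM: "f \<in> borel_measurable (LM \<beta>) \<longleftrightarrow> f \<in> borel_measurable borel"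
  and measurable_HM: "h \<in> borel_measurable (HM \<beta>) \<longleftrightarrow> h \<in> borel_measurable borel"
  using measurable_cong_sets[OF sets_LM refl] measurable_cong_sets[OF sets_HM refl] by blast+

lemma sigma_finite_LM: "\<beta> \<in> {1, 2} \<Longrightarrow> sigma_finite_measure (LM \<beta>)"
  by (rule leb_on.sigma_finite_leb[OF leb_LM])

lemma nn_integral_HM:
  fixes f :: "complex^'n^'n \<Rightarrow> ennreal"
  assumes "f \<in> borel_measurable borel"
  shows "(\<integral>\<^sup>+g. f g \<partial>HM \<beta>) = (\<integral>\<^sup>+g. dpow g (- (real \<beta> * CARD('n))) * f g \<partial>LM \<beta>)"
  unfolding HM_def using assms by (intro nn_integral_density) (simp_all add: measurable_LM)

lemma sigma_finite_HM: "\<beta> \<in> {1, 2} \<Longrightarrow> sigma_finite_measure (HM \<beta>)"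
  unfolding HM_def by (rule sigma_finite_density_finite) (simp_all add: sigma_finite_LM measurable_LM dpow_neq_top)

lemma AE_LM_GLF:
  assumes "\<beta> \<in> {1, 2}" shows "AE g in LM \<beta>. (g::complex^'n^'n) \<in> GLF \<beta>"
proof -
  have "AE g in LM \<beta>. (g::complex^'n^'n) \<in> VM \<beta>" by (rule leb_on.AE_leb[OF leb_LM[OF assms]])
  moreover have "AE g in LM \<beta>. det (mat 1 ** (g::complex^'n^'n)) \<noteq> 0"
    by (rule AE_LM_det_mult[OF assms VM_1]) simp
  ultimately show ?thesis by eventually_elim (simp add: GLF_def)
qed

lemma AE_HM_GLF:
  assumes "\<beta> \<in> {1, 2}" shows "AE g in HM \<beta>. (g::complex^'n^'n) \<in> GLF \<beta>"
proof -
  have "(AE g in HM \<beta>. (g::complex^'n^'n) \<in> GLF \<beta>) \<longleftrightarrow>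
      (AE g in LM \<beta>. 0 < dpow (g::complex^'n^'n) (- (real \<beta> * CARD('n))) \<longrightarrow> g \<in> GLF \<beta>)"
    unfolding HM_def by (rule AE_density) (simp add: measurable_LM)
  then show ?thesis using AE_LM_GLF[OF assms, where 'n = 'n] by (auto elim!: eventually_mono)
qed

lemma emeasure_HM_nonzero:
  assumes \<beta>: "\<beta> \<in> {1, 2}" shows "emeasure (HM \<beta> :: (complex^'n^'n) measure) (space (HM \<beta>)) \<noteq> 0"
proof
  assume "emeasure (HM \<beta> :: (complex^'n^'n) measure) (space (HM \<beta>)) = 0"
  then have "(\<integral>\<^sup>+g. 1 \<partial>(HM \<beta> :: (complex^'n^'n) measure)) = 0" by simp
  then have "(\<integral>\<^sup>+g. dpow (g::complex^'n^'n) (- (real \<beta> * CARD('n))) * 1 \<partial>LM \<beta>) = 0"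
    by (subst nn_integral_HM[symmetric]) auto
  then have "AE g in LM \<beta>. dpow (g::complex^'n^'n) (- (real \<beta> * CARD('n))) = 0"
    by (simp add: nn_integral_0_iff_AE measurable_LM)
  with AE_LM_GLF[OF \<beta>, where 'n = 'n] have "AE g in (LM \<beta> :: (complex^'n^'n) measure). False"
  proof eventually_elim
    case (elim g)
    then show False using dpow_pos[of g "- (real \<beta> * CARD('n))"] by (simp add: GLF_def)
  qed
  then have "emeasure (LM \<beta> :: (complex^'n^'n) measure) (space (LM \<beta>)) = 0"
    by (simp add: AE_iff_null null_setsD1)
  then show False using leb_on.leb_nonzero[OF leb_LM[OF \<beta>, where 'n = 'n and 'm = 'n]] by simp
qed

lemma HM_right:
  fixes h :: "complex^'n^'n"
  assumes \<beta>: "\<beta> \<in> {1, 2}" and h: "h \<in> GLF \<beta>" and f[measurable]: "f \<in> borel_measurable borel"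
  shows "(\<integral>\<^sup>+g. f (g ** h) \<partial>HM \<beta>) = (\<integral>\<^sup>+g. f g \<partial>HM \<beta>)"
proof -
  let ?b = "real \<beta> * CARD('n)"
  have d: "det h \<noteq> 0" using h by (simp add: GLF_def)
  have "(\<integral>\<^sup>+g. f (g ** h) \<partial>HM \<beta>) = (\<integral>\<^sup>+g. dpow g (- ?b) * f (g ** h) \<partial>LM \<beta>)"
    by (rule nn_integral_HM) measurable
  also have "\<dots> = (\<integral>\<^sup>+g. (\<lambda>x. dpow h ?b * (dpow x (- ?b) * f x)) (g ** h) \<partial>LM \<beta>)"
    using dpow_mult_cancel[OF d] by (intro nn_integral_cong) simp
  also have "\<dots> = dpow h (- ?b) * (\<integral>\<^sup>+x. dpow h ?b * (dpow x (- ?b) * f x) \<partial>LM \<beta>)"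
    unfolding dpow_def[of h "- ?b"] by (rule LM_right[OF \<beta> h]) measurable
  also have "\<dots> = (\<integral>\<^sup>+x. dpow x (- ?b) * f x \<partial>LM \<beta>)"
    using dpow_cancel[OF d] by (simp add: nn_integral_cmult measurable_LM)
  finally show ?thesis by (simp add: nn_integral_HM)
qed

lemma HM_left:
  fixes h :: "complex^'n^'n"
  assumes \<beta>: "\<beta> \<in> {1, 2}" and h: "h \<in> GLF \<beta>" and f[measurable]: "f \<in> borel_measurable borel"
  shows "(\<integral>\<^sup>+g. f (h ** g) \<partial>HM \<beta>) = (\<integral>\<^sup>+g. f g \<partial>HM \<beta>)"
proof -
  let ?b = "real \<beta> * CARD('n)"
  have d: "det h \<noteq> 0" using h by (simp add: GLF_def)
  have "(\<integral>\<^sup>+g. f (h ** g) \<partial>HM \<beta>) = (\<integral>\<^sup>+g. dpow g (- ?b) * f (h ** g) \<partial>LM \<beta>)"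
    by (rule nn_integral_HM) measurable
  also have "\<dots> = (\<integral>\<^sup>+g. (\<lambda>x. dpow h ?b * (dpow x (- ?b) * f x)) (h ** g) \<partial>LM \<beta>)"
    using dpow_mult_cancel[OF d] by (intro nn_integral_cong) simp
  also have "\<dots> = dpow h (- ?b) * (\<integral>\<^sup>+x. dpow h ?b * (dpow x (- ?b) * f x) \<partial>LM \<beta>)"
    unfolding dpow_def[of h "- ?b"] by (rule LM_left[OF \<beta> h]) measurable
  also have "\<dots> = (\<integral>\<^sup>+x. dpow x (- ?b) * f x \<partial>LM \<beta>)"
    using dpow_cancel[OF d] by (simp add: nn_integral_cmult measurable_LM)
  finally show ?thesis by (simp add: nn_integral_HM)
qed

lemma LM_eq_HM:
  fixes f :: "complex^'n^'n \<Rightarrow> ennreal"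
  assumes \<beta>: "\<beta> \<in> {1, 2}" and f[measurable]: "f \<in> borel_measurable borel"
  shows "(\<integral>\<^sup>+g. f g \<partial>LM \<beta>) = (\<integral>\<^sup>+g. dpow g (real \<beta> * CARD('n)) * f g \<partial>HM \<beta>)"
proof -
  have "(\<integral>\<^sup>+g. dpow g (real \<beta> * CARD('n)) * f g \<partial>HM \<beta>)
     = (\<integral>\<^sup>+g. dpow g (- (real \<beta> * CARD('n))) * (dpow g (real \<beta> * CARD('n)) * f g) \<partial>LM \<beta>)"
    by (rule nn_integral_HM) measurable
  also have "\<dots> = (\<integral>\<^sup>+g. f g \<partial>LM \<beta>)"
    using AE_LM_GLF[OF \<beta>] by (intro nn_integral_cong_AE) (auto simp: GLF_def dpow_cancel elim!: eventually_mono)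
  finally show ?thesis by simp
qed

lemma matrix_mult_measurable_pair:
  "(\<lambda>(p::complex^'n^'m, x::complex^'k^'n). p ** x) \<in> borel \<rightarrow>\<^sub>M borel"
  unfolding borel_prod[symmetric] by measurable

text \<open>The group acts on itself by left multiplication, and the integral of
  \<open>f x * indicator B (p ** x)\<close> is computed in both orders. Right invariance gives the
  mass of \<open>B\<close>; the substitution of \<open>x ** p\<close> for \<open>p\<close> removes
  \<open>x\<close> from \<open>f (matrix_inv p ** x)\<close>. The mass of \<open>B\<close>
  cancels.\<close>

lemma HM_inv:
  fixes f :: "complex^'n^'n \<Rightarrow> ennreal"
  assumes \<beta>: "\<beta> \<in> {1, 2}" and f[measurable]: "f \<in> borel_measurable borel"
  shows "(\<integral>\<^sup>+g. f (matrix_inv g) \<partial>HM \<beta>) = (\<integral>\<^sup>+g. f g \<partial>HM \<beta>)"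
proof -
  obtain B where B: "B \<in> sets (HM \<beta> :: (complex^'n^'n) measure)" "0 < emeasure (HM \<beta>) B" "emeasure (HM \<beta>) B < \<infinity>"
    using sigma_finite_measure_pos_finite_set[OF sigma_finite_HM[OF \<beta>] emeasure_HM_nonzero[OF \<beta>]] by blast
  have [measurable]: "B \<in> sets borel" using B by (simp add: sets_HM)
  have "emeasure (HM \<beta>) B * (\<integral>\<^sup>+g. f g \<partial>HM \<beta>) = (\<integral>\<^sup>+g. f (matrix_inv g) \<partial>HM \<beta>) * (\<integral>\<^sup>+g. indicator B g \<partial>HM \<beta>)"
  proof (rule orbit_integral_swap[where a = "\<lambda>p x. p ** x" and a' = "\<lambda>p x. matrix_inv p ** x"])
    show "(\<lambda>(p::complex^'n^'n, x::complex^'n^'n). p ** x) \<in> borel \<rightarrow>\<^sub>M (borel :: (complex^'n^'n) measure)" by (rule matrix_mult_measurable_pair)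
    show "(\<lambda>(p::complex^'n^'n, x::complex^'n^'n). matrix_inv p ** x) \<in> borel \<rightarrow>\<^sub>M (borel :: (complex^'n^'n) measure)"
      unfolding borel_prod[symmetric] by measurable
    show "AE p in HM \<beta>. (\<integral>\<^sup>+x. f x * indicator B (p ** x) \<partial>HM \<beta>) = (\<integral>\<^sup>+x. f (matrix_inv p ** x) * indicator B x \<partial>HM \<beta>)"
      using AE_HM_GLF[OF \<beta>]
    proof eventually_elim
      case (elim p)
      have "(\<lambda>x. f (matrix_inv p ** x) * indicator B x) \<in> borel_measurable borel" by measurable
      from HM_left[OF \<beta> elim this]
      have "(\<integral>\<^sup>+x. f (matrix_inv p ** (p ** x)) * indicator B (p ** x) \<partial>HM \<beta>) = (\<integral>\<^sup>+x. f (matrix_inv p ** x) * indicator B x \<partial>HM \<beta>)" .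
      moreover have "matrix_inv p ** (p ** x) = x" for x :: "complex^'n^'n"
        using matrix_inv(2)[of p] elim by (simp add: matrix_mul_assoc GLF_def)
      ultimately show ?case by simp
    qed
    show "AE x in HM \<beta>. (\<integral>\<^sup>+p. indicator B (p ** x) \<partial>HM \<beta>) = emeasure (HM \<beta>) B"
      using AE_HM_GLF[OF \<beta>]
    proof eventually_elim
      case (elim x)
      show ?case using HM_right[OF \<beta> elim, of "indicator B"] B(1) by simp
    qed
    show "AE x in HM \<beta>. (\<integral>\<^sup>+p. f (matrix_inv p ** x) \<partial>HM \<beta>) = (\<integral>\<^sup>+g. f (matrix_inv g) \<partial>HM \<beta>)"
      using AE_HM_GLF[OF \<beta>]
    proof eventually_elim
      case (elim x)
      have "(\<integral>\<^sup>+p. f (matrix_inv (x ** p) ** x) \<partial>HM \<beta>) = (\<integral>\<^sup>+p. f (matrix_inv p ** x) \<partial>HM \<beta>)"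
        by (rule HM_left[OF \<beta> elim, of "\<lambda>p. f (matrix_inv p ** x)"]) measurable
      moreover have "(\<integral>\<^sup>+p. f (matrix_inv (x ** p) ** x) \<partial>HM \<beta>) = (\<integral>\<^sup>+p. f (matrix_inv p) \<partial>HM \<beta>)"
      proof (rule nn_integral_cong_AE)
        have "matrix_inv (x ** p) ** x = matrix_inv p" if "p \<in> GLF \<beta>" for p
        proof -
          have "matrix_inv (x ** p) ** x = matrix_inv p ** (matrix_inv x ** x)"
            using that elim by (simp add: matrix_inv_mult GLF_def matrix_mul_assoc)
          then show ?thesis using elim by (simp add: matrix_inv GLF_def)
        qed
        then show "AE p in HM \<beta>. f (matrix_inv (x ** p) ** x) = f (matrix_inv p)"
          using AE_HM_GLF[OF \<beta>, where 'n = 'n] by (auto elim!: eventually_mono)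
      qed
      ultimately show ?case by simp
    qed
  qed (simp_all add: sigma_finite_HM[OF \<beta>] sets_HM borel_measurable_indicator)
  then have "emeasure (HM \<beta>) B * (\<integral>\<^sup>+g. f g \<partial>HM \<beta>) = emeasure (HM \<beta>) B * (\<integral>\<^sup>+g. f (matrix_inv g) \<partial>HM \<beta>)"
    using B(1) by (simp add: mult.commute)
  then show ?thesis using B by (subst (asm) ennreal_mult_cancel_left) auto
qed

text \<open>Haar measure is infinite, but the map to \<open>mat_adj g ** g\<close> only forgets a
  unitary factor, which ranges over a compact group. This supplies the test sets for the uniqueness
  arguments and the cutoff in \<open>corner_density\<close>.\<close>

lemma HM_gram_pos_finite_set:
  assumes \<beta>: "\<beta> \<in> {1, 2}"
  obtains B :: "(complex^'n^'n) set" where "B \<in> sets borel"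
    "0 < (\<integral>\<^sup>+g. indicator B (mat_adj g ** g) \<partial>HM \<beta>)" "(\<integral>\<^sup>+g. indicator B (mat_adj g ** g) \<partial>HM \<beta>) < \<infinity>"
proof -
  let ?b = "real \<beta> * CARD('n)"
  \<comment> \<open>The trace of \<open>mat_adj g ** g\<close> is the squared norm of
    \<open>g\<close>, so the first condition bounds \<open>g\<close>; the second bounds the Haar
    density. As \<open>k\<close> grows, the corresponding sets of \<open>g\<close> exhaust the
    invertible matrices.\<close>
  define B where "B k = {S::complex^'n^'n. Re (trace S) \<le> (real k)\<^sup>2 \<and> 1 / (real k + 1) \<le> cmod (det S)}" for k
  have B[measurable]: "B k \<in> sets borel" for k
    unfolding B_def trace_def by measurable
  have fin: "(\<integral>\<^sup>+g. indicator (B k) (mat_adj g ** g) \<partial>HM \<beta>) < \<infinity>" for k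
  proof -
    let ?C = "(1 / (real k + 1)) powr (- (?b / 2))"
    have le: "dpow g (- ?b) * indicator (B k) (mat_adj g ** g) \<le> ennreal ?C * indicator (cball 0 (real k)) g" for g :: "complex^'n^'n"
    proof (cases "mat_adj g ** g \<in> B k")
      case True
      then have 1: "(norm g)\<^sup>2 \<le> (real k)\<^sup>2" and 2: "1 / (real k + 1) \<le> cmod (det g) * cmod (det g)"
        by (auto simp: B_def norm_matrix_square det_mul det_mat_adj norm_mult)
      have "norm g \<le> real k" using 1 by (rule power2_le_imp_le) simp
      moreover have "cmod (det g) powr (- ?b) \<le> ?C"
      proof -
        have "cmod (det g) powr (- ?b) = (cmod (det g) * cmod (det g)) powr (- (?b / 2))"
          by (simp add: powr_mult powr_add[symmetric])
        also have "\<dots> \<le> ?C" using 2 by (intro powr_mono2') auto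
        finally show ?thesis .
      qed
      ultimately show ?thesis using True by (simp add: dpow_def ennreal_leI)
    qed simp
    have "(\<integral>\<^sup>+g. indicator (B k) (mat_adj g ** g) \<partial>HM \<beta>)
        = (\<integral>\<^sup>+g. dpow g (- ?b) * indicator (B k) (mat_adj g ** g) \<partial>LM \<beta>)"
      by (rule nn_integral_HM) measurable
    also have "\<dots> \<le> (\<integral>\<^sup>+g. ennreal ?C * indicator (cball 0 (real k)) (g::complex^'n^'n) \<partial>LM \<beta>)"
      by (intro nn_integral_mono le)
    also have "\<dots> = ennreal ?C * emeasure (LM \<beta>) (cball (0::complex^'n^'n) (real k))"
      by (subst nn_integral_cmult) (auto simp: sets_LM measurable_LM intro!: borel_measurable_indicator)
    also have "\<dots> < \<infinity>"
      using leb_on.leb_cball[OF leb_LM[OF \<beta>, where 'n = 'n and 'm = 'n]] by (simp add: ennreal_mult_less_top)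
    finally show ?thesis .
  qed
  have "\<exists>k. (\<integral>\<^sup>+g. indicator (B k) (mat_adj (g::complex^'n^'n) ** g) \<partial>HM \<beta>) \<noteq> 0"
  proof (rule ccontr)
    assume "\<not> ?thesis"
    then have z: "(\<integral>\<^sup>+g. indicator (B k) (mat_adj (g::complex^'n^'n) ** g) \<partial>HM \<beta>) = 0" for k by blast
    have "AE g in HM \<beta>. indicator (B k) (mat_adj (g::complex^'n^'n) ** g) = (0::ennreal)" for k
      using z[of k] by (subst (asm) nn_integral_0_iff_AE) (simp_all add: measurable_HM)
    then have "AE g in HM \<beta>. \<forall>k. indicator (B k) (mat_adj (g::complex^'n^'n) ** g) = (0::ennreal)"
      by (simp add: AE_all_countable)
    with AE_HM_GLF[OF \<beta>] have "AE g in (HM \<beta> :: (complex^'n^'n) measure). False"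
    proof eventually_elim
      case (elim g)
      have d: "cmod (det g) * cmod (det g) > 0" using elim by (simp add: GLF_def)
      obtain k1 :: nat where k1: "norm g \<le> real k1" using real_arch_simple by blast
      obtain k2 :: nat where k2: "1 / (cmod (det g) * cmod (det g)) \<le> real k2" using real_arch_simple by blast
      let ?k = "max k1 k2"
      have "(norm g)\<^sup>2 \<le> (real ?k)\<^sup>2" using k1 by (intro power_mono) auto
      moreover have "1 / (real ?k + 1) \<le> cmod (det g) * cmod (det g)"
      proof -
        have "1 / (cmod (det g) * cmod (det g)) \<le> real ?k + 1" using k2 by simp
        then show ?thesis using d by (simp add: field_simps)
      qed
      ultimately have "mat_adj g ** g \<in> B ?k"
        by (simp add: B_def norm_matrix_square det_mul det_mat_adj norm_mult)
      then show False using elim(2) by (metis indicator_simps(1) one_neq_zero)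
    qed
    then have "emeasure (HM \<beta> :: (complex^'n^'n) measure) (space (HM \<beta>)) = 0"
      by (simp add: AE_iff_null null_setsD1)
    then show False using emeasure_HM_nonzero[OF \<beta>] by blast
  qed
  then obtain k where "(\<integral>\<^sup>+g. indicator (B k) (mat_adj (g::complex^'n^'n) ** g) \<partial>HM \<beta>) \<noteq> 0" by blast
  then have "0 < (\<integral>\<^sup>+g. indicator (B k) (mat_adj (g::complex^'n^'n) ** g) \<partial>HM \<beta>)" by (metis not_gr_zero)
  then show ?thesis by (rule that[OF B _ fin])
qed

text \<open>The cone is a homogeneous space of the general linear group.\<close>
lemma cone_measure:
  fixes \<nu> :: "(complex^'n^'n) measure"
  assumes \<beta>: "\<beta> \<in> {1, 2}" and \<nu>: "sigma_finite_measure \<nu>" "sets \<nu> = sets borel" "emeasure \<nu> (space \<nu>) \<noteq> 0"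
    and PD: "AE S in \<nu>. S \<in> PD \<beta>"
    and scaling: "\<And>g f. g \<in> GLF \<beta> \<Longrightarrow> f \<in> borel_measurable borel \<Longrightarrow>
      (\<integral>\<^sup>+S. f (mat_adj g ** S ** g) \<partial>\<nu>) = dpow g (- s) * (\<integral>\<^sup>+S. f S \<partial>\<nu>)"
  obtains c :: real where "c > 0"
    "\<And>f. f \<in> borel_measurable borel \<Longrightarrow>
      (\<integral>\<^sup>+S. f S \<partial>\<nu>) = ennreal c * (\<integral>\<^sup>+g. dpow g s * f (mat_adj g ** g) \<partial>HM \<beta>)"
proof -
  \<comment> \<open>Congruence by \<open>g\<close> multiplies the determinant by the square of
    \<open>cmod (det g)\<close>, hence half of \<open>s\<close> compensates the scaling of
    \<open>\<nu>\<close>.\<close>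
  let ?w = "\<lambda>S::complex^'n^'n. dpow S (- s / 2)"
  define \<kappa> where "\<kappa> h = (\<integral>\<^sup>+g. h (mat_adj g ** g) \<partial>HM \<beta>)" for h :: "complex^'n^'n \<Rightarrow> ennreal"
  obtain B :: "(complex^'n^'n) set" where B: "B \<in> sets borel" "0 < \<kappa> (indicator B)" "\<kappa> (indicator B) < \<infinity>"
    unfolding \<kappa>_def using HM_gram_pos_finite_set[OF \<beta>] by blast
  have gram: "(\<integral>\<^sup>+g. h (mat_adj g ** S ** g) \<partial>HM \<beta>) = \<kappa> h"
    if S: "S \<in> PD \<beta>" and h[measurable]: "h \<in> borel_measurable borel" for S and h :: "complex^'n^'n \<Rightarrow> ennreal"
  proof -
    \<comment> \<open>Transitivity: a root of \<open>S\<close> is absorbed by left invariance, so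
      the orbit integral does not depend on \<open>S\<close>.\<close>
    obtain g0 where g0: "g0 \<in> GLF \<beta>" "S = mat_adj g0 ** g0" using S by (rule PD_eq_gram)
    have "(\<integral>\<^sup>+g. h (mat_adj (g0 ** g) ** (g0 ** g)) \<partial>HM \<beta>) = (\<integral>\<^sup>+g. h (mat_adj g ** g) \<partial>HM \<beta>)"
      by (rule HM_left[OF \<beta> g0(1), of "\<lambda>g. h (mat_adj g ** g)"]) measurable
    then show ?thesis unfolding g0(2) \<kappa>_def by (simp add: mat_adj_mult matrix_mul_assoc)
  qed
  obtain c :: real where c: "c > 0" "\<And>f. f \<in> borel_measurable borel \<Longrightarrow> (\<integral>\<^sup>+S. ?w S * f S \<partial>\<nu>) = ennreal c * \<kappa> f"
  proof (rule homogeneous_measure_unique[where P = "HM \<beta>" and \<nu> = \<nu> and w = ?w and \<kappa> = \<kappa> and b = "indicator B"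
      and a = "\<lambda>g S. mat_adj g ** S ** g" and a' = "\<lambda>g S. mat_adj (matrix_inv g) ** S ** matrix_inv g"])
    show "AE S in \<nu>. ?w S \<noteq> 0"
      using PD
    proof eventually_elim
      case (elim S)
      then show ?case using dpow_pos[of S "- s / 2"] by (simp add: PD_def)
    qed
    show "(\<lambda>(p::complex^'n^'n, x::complex^'n^'n). mat_adj p ** x ** p) \<in> borel \<rightarrow>\<^sub>M borel"
      "(\<lambda>(p::complex^'n^'n, x::complex^'n^'n). mat_adj (matrix_inv p) ** x ** matrix_inv p) \<in> borel \<rightarrow>\<^sub>M borel"
      unfolding borel_prod[symmetric] by measurable
    show "AE g in HM \<beta>. (\<forall>S. mat_adj (matrix_inv g) ** (mat_adj g ** S ** g) ** matrix_inv g = S) \<and>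
        (\<forall>F\<in>borel_measurable borel. (\<integral>\<^sup>+S. ?w S * F (mat_adj g ** S ** g) \<partial>\<nu>) = (\<integral>\<^sup>+S. ?w S * F S \<partial>\<nu>))"
      using AE_HM_GLF[OF \<beta>]
    proof (eventually_elim, intro conjI ballI allI)
      fix g :: "complex^'n^'n" and F :: "complex^'n^'n \<Rightarrow> ennreal"
      assume g: "g \<in> GLF \<beta>" and F[measurable]: "F \<in> borel_measurable borel"
      have d: "det g \<noteq> 0" using g by (simp add: GLF_def)
      have e: "2 * (- s / 2) = - s" by simp
      have "(\<integral>\<^sup>+S. ?w S * F (mat_adj g ** S ** g) \<partial>\<nu>) = (\<integral>\<^sup>+S. (\<lambda>S. dpow g s * (?w S * F S)) (mat_adj g ** S ** g) \<partial>\<nu>)"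
        using dpow_cancel[OF d, of s] by (intro nn_integral_cong) (simp add: dpow_congruence e mult.assoc)
      also have "\<dots> = dpow g (- s) * (\<integral>\<^sup>+S. dpow g s * (?w S * F S) \<partial>\<nu>)"
        by (rule scaling[OF g]) measurable
      also have "\<dots> = (\<integral>\<^sup>+S. ?w S * F S \<partial>\<nu>)"
        using dpow_cancel[OF d] by (subst nn_integral_cmult) (simp_all add: measurable_cong_sets[OF \<nu>(2) refl])
      finally show "(\<integral>\<^sup>+S. ?w S * F (mat_adj g ** S ** g) \<partial>\<nu>) = (\<integral>\<^sup>+S. ?w S * F S \<partial>\<nu>)" .
    qed (rule congruence_inv(1))
    show "AE S in \<nu>. (\<integral>\<^sup>+g. h (mat_adj g ** S ** g) \<partial>HM \<beta>) = \<kappa> h \<and>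
        (\<integral>\<^sup>+g. h (mat_adj (matrix_inv g) ** S ** matrix_inv g) \<partial>HM \<beta>) = \<kappa> h"
      if [measurable]: "h \<in> borel_measurable borel" for h
      using PD
    proof eventually_elim
      case (elim S)
      have "(\<integral>\<^sup>+g. h (mat_adj (matrix_inv g) ** S ** matrix_inv g) \<partial>HM \<beta>) = (\<integral>\<^sup>+g. h (mat_adj g ** S ** g) \<partial>HM \<beta>)"
        by (rule HM_inv[OF \<beta>, of "\<lambda>g. h (mat_adj g ** S ** g)"]) measurable
      then show ?case using gram[OF elim, of h] by simp
    qed
  qed (use B \<nu> in \<open>simp_all add: sigma_finite_HM[OF \<beta>] sets_HM dpow_neq_top borel_measurable_indicator\<close>)
  show ?thesis
  proof (rule that[OF c(1)])
    fix f :: "complex^'n^'n \<Rightarrow> ennreal" assume f[measurable]: "f \<in> borel_measurable borel"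
    have "(\<integral>\<^sup>+S. f S \<partial>\<nu>) = (\<integral>\<^sup>+S. ?w S * (dpow S (s / 2) * f S) \<partial>\<nu>)"
    proof (rule nn_integral_cong_AE)
      show "AE S in \<nu>. f S = ?w S * (dpow S (s / 2) * f S)"
        using PD
      proof eventually_elim
        case (elim S)
        then show ?case using dpow_cancel(2)[of S "s / 2" "f S"] by (simp add: PD_def)
      qed
    qed
    also have "\<dots> = ennreal c * \<kappa> (\<lambda>S. dpow S (s / 2) * f S)"
      by (rule c(2)) measurable
    finally show "(\<integral>\<^sup>+S. f S \<partial>\<nu>) = ennreal c * (\<integral>\<^sup>+g. dpow g s * f (mat_adj g ** g) \<partial>HM \<beta>)"
      by (simp add: \<kappa>_def dpow_gram)
  qed
qed

subsection \<open>Haar measure on the orthogonal and unitary groups\<close>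

text \<open>Haar measure moved from the group to the Borel sets of all matrices, where Tonelli is
  available; the group is remembered almost everywhere. Only left invariance is assumed, while
  invariance under adjoints and from the right is derived.\<close>

locale haar_measure =
  fixes G :: "(complex^'t^'t) set" and M :: "(complex^'t^'t) measure"
  assumes prob: "prob_space M" and sets_M[measurable_cong]: "sets M = sets borel" and AE_G: "AE Q in M. Q \<in> G"
    and adj_G: "\<And>U. U \<in> G \<Longrightarrow> mat_adj U \<in> G"
    and unitary_G: "\<And>U. U \<in> G \<Longrightarrow> U ** mat_adj U = mat 1"
    and left: "\<And>U f. U \<in> G \<Longrightarrow> f \<in> borel_measurable borel \<Longrightarrow> (\<integral>\<^sup>+Q. f (U ** Q) \<partial>M) = (\<integral>\<^sup>+Q. f Q \<partial>M)"
begin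

lemma unitary_G': "U \<in> G \<Longrightarrow> mat_adj U ** U = mat 1"
  using unitary_G matrix_left_right_inverse by blast

lemma sigma_finite_M: "sigma_finite_measure M"
  using prob by (simp add: prob_space_imp_sigma_finite)

lemma emeasure_M: "emeasure M (space M) = 1"
  using prob by (rule prob_space.emeasure_space_1)

text \<open>The double integral of \<open>f(P^* Q)\<close> is computed in both orders.\<close>
lemma adjoint:
  assumes f[measurable]: "f \<in> borel_measurable borel"
  shows "(\<integral>\<^sup>+Q. f (mat_adj Q) \<partial>M) = (\<integral>\<^sup>+Q. f Q \<partial>M)"
proof -
  have "(\<integral>\<^sup>+Q. f Q \<partial>M) = (\<integral>\<^sup>+P. (\<integral>\<^sup>+Q. f Q \<partial>M) \<partial>M)" by (simp add: emeasure_M)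
  also have "\<dots> = (\<integral>\<^sup>+P. (\<integral>\<^sup>+Q. f (mat_adj P ** Q) \<partial>M) \<partial>M)"
  proof (rule nn_integral_cong_AE)
    show "AE P in M. (\<integral>\<^sup>+Q. f Q \<partial>M) = (\<integral>\<^sup>+Q. f (mat_adj P ** Q) \<partial>M)"
      using AE_G by eventually_elim (rule left[OF adj_G f, symmetric])
  qed
  also have "\<dots> = (\<integral>\<^sup>+Q. (\<integral>\<^sup>+P. f (mat_adj P ** Q) \<partial>M) \<partial>M)"
  proof (rule nn_integral_swap_borel)
    show "(\<lambda>(P, Q). f (mat_adj P ** Q)) \<in> borel_measurable borel"
      unfolding borel_prod[symmetric] by measurable
  qed (simp_all add: sigma_finite_M sets_M)
  also have "\<dots> = (\<integral>\<^sup>+Q. (\<integral>\<^sup>+P. f (mat_adj P) \<partial>M) \<partial>M)"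
  proof (rule nn_integral_cong_AE)
    show "AE Q in M. (\<integral>\<^sup>+P. f (mat_adj P ** Q) \<partial>M) = (\<integral>\<^sup>+P. f (mat_adj P) \<partial>M)"
      using AE_G
    proof eventually_elim
      case (elim Q)
      have "(\<integral>\<^sup>+P. f (mat_adj (Q ** P) ** Q) \<partial>M) = (\<integral>\<^sup>+P. f (mat_adj P ** Q) \<partial>M)"
        by (rule left[OF elim, of "\<lambda>P. f (mat_adj P ** Q)"]) measurable
      moreover have "mat_adj (Q ** P) ** Q = mat_adj P" for P :: "complex^'t^'t"
        using unitary_G'[OF elim] by (simp add: mat_adj_mult matrix_mul_assoc[symmetric])
      ultimately show ?case by simp
    qed
  qed
  also have "\<dots> = (\<integral>\<^sup>+P. f (mat_adj P) \<partial>M)" by (simp add: emeasure_M)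
  finally show ?thesis by simp
qed

text \<open>Passing to adjoints exchanges right and left multiplication.\<close>

lemma right:
  assumes U: "U \<in> G" and f[measurable]: "f \<in> borel_measurable borel"
  shows "(\<integral>\<^sup>+Q. f (Q ** U) \<partial>M) = (\<integral>\<^sup>+Q. f Q \<partial>M)"
proof -
  have "(\<integral>\<^sup>+Q. f (Q ** U) \<partial>M) = (\<integral>\<^sup>+Q. f (mat_adj Q ** U) \<partial>M)"
    by (rule adjoint[of "\<lambda>Q. f (Q ** U)", symmetric]) measurable
  also have "\<dots> = (\<integral>\<^sup>+Q. f (mat_adj (mat_adj U ** Q)) \<partial>M)" by (simp add: mat_adj_mult)
  also have "\<dots> = (\<integral>\<^sup>+Q. f (mat_adj Q) \<partial>M)"
    by (rule left[OF adj_G[OF U], of "\<lambda>Q. f (mat_adj Q)"]) measurable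
  also have "\<dots> = (\<integral>\<^sup>+Q. f Q \<partial>M)" by (rule adjoint) measurable
  finally show ?thesis .
qed

end

lemma haar_group_UF: "\<beta> \<in> {1, 2} \<Longrightarrow> Q \<in> haar_group \<beta> \<Longrightarrow> Q \<in> UF \<beta>"
  unfolding haar_group_def UF_def VM_def using matrix_left_right_inverse[of Q] by (auto split: if_splits)

lemma haar_group_I: "\<beta> \<in> {1, 2} \<Longrightarrow> Q \<in> UF \<beta> \<Longrightarrow> (\<beta> = 1 \<Longrightarrow> det Q = 1) \<Longrightarrow> Q \<in> haar_group \<beta>"
  using UF_right[of Q \<beta>] by (auto simp: haar_group_def UF_def VM_def)

lemma borel_haar_group: "haar_group \<beta> \<in> sets borel"
proof -
  have "{Q :: complex^'a^'a. Q ** mat_adj Q = mat 1} \<in> sets borel" by measurable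
  moreover have "{Q :: complex^'a^'a. \<forall>i j. Im (Q $ i $ j) = 0} \<in> sets borel" by measurable
  moreover have "{Q :: complex^'a^'a. det Q = 1} \<in> sets borel" by measurable
  ultimately have "{Q :: complex^'a^'a. Q ** mat_adj Q = mat 1} \<in> sets borel"
    "{Q :: complex^'a^'a. \<forall>i j. Im (Q $ i $ j) = 0} \<inter> {Q. Q ** mat_adj Q = mat 1} \<inter> {Q. det Q = 1} \<in> sets borel"
    by (blast intro: sets.Int)+
  moreover have "{Q :: complex^'a^'a. \<forall>i j. Im (Q $ i $ j) = 0} \<inter> {Q. Q ** mat_adj Q = mat 1} \<inter> {Q. det Q = 1}
      = {Q. real_matrix Q \<and> Q ** mat_adj Q = mat 1 \<and> det Q = 1}"
    by (auto simp: real_matrix_def)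
  ultimately show ?thesis by (simp add: haar_group_def)
qed

lemma is_haar_prob_measurable:
  assumes "is_haar_prob G \<mu>" "h \<in> borel \<rightarrow>\<^sub>M N" shows "h \<in> \<mu> \<rightarrow>\<^sub>M N"
proof -
  have "sets \<mu> = sets (restrict_space borel G)" using assms by (simp add: is_haar_prob_def)
  then show ?thesis
    using measurable_restrict_space1[OF assms(2), of G] measurable_cong_sets[OF _ refl] by blast
qed

lemma distr_is_haar_prob:
  assumes \<mu>: "is_haar_prob G \<mu>" and h: "h \<in> borel \<rightarrow>\<^sub>M N"
  shows "distr \<mu> N h = distr (distr \<mu> borel (\<lambda>Q. Q)) N h"
  using h is_haar_prob_measurable[OF \<mu>, of "\<lambda>Q. Q" borel] by (subst distr_distr) (auto simp: comp_def)

lemma haar_measure_of_is_haar_prob: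
  fixes \<mu> :: "(complex^'t^'t) measure"
  assumes \<beta>: "\<beta> \<in> {1, 2}" and \<mu>: "is_haar_prob (haar_group \<beta>) \<mu>"
  shows "haar_measure (haar_group \<beta>) (distr \<mu> borel (\<lambda>Q. Q))"
proof -
  let ?G = "haar_group \<beta> :: (complex^'t^'t) set" and ?M = "distr \<mu> borel (\<lambda>Q. Q)"
  have sp: "space \<mu> = ?G" and st: "sets \<mu> = sets (restrict_space borel ?G)" and pr: "prob_space \<mu>"
    and inv: "\<And>U. U \<in> ?G \<Longrightarrow> distr \<mu> \<mu> (\<lambda>Q. U ** Q) = \<mu>"
    using \<mu> by (auto simp: is_haar_prob_def)
  have m: "h \<in> \<mu> \<rightarrow>\<^sub>M N" if "h \<in> borel \<rightarrow>\<^sub>M N" for h and N :: "'z measure"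
    using is_haar_prob_measurable[OF \<mu> that] .
  have id[measurable]: "(\<lambda>Q. Q) \<in> \<mu> \<rightarrow>\<^sub>M borel" by (rule m) simp
  have GU: "Q \<in> UF \<beta>" if "Q \<in> ?G" for Q using haar_group_UF[OF \<beta> that] .
  show "haar_measure ?G ?M"
  proof (rule haar_measure.intro)
    show "prob_space ?M" using pr by (rule prob_space.prob_space_distr) measurable
    show "sets ?M = sets borel" by simp
    have AEs: "AE Q in \<mu>. Q \<in> ?G" using AE_space[of \<mu>] sp by simp
    show "AE Q in ?M. Q \<in> ?G"
      using AEs borel_haar_group by (subst AE_distr_iff) auto
    show "mat_adj U \<in> ?G" if "U \<in> ?G" for U
      using UF_adj[OF GU[OF that]] that by (intro haar_group_I \<beta>) (auto simp: haar_group_def det_mat_adj)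
    show "U ** mat_adj U = mat 1" if "U \<in> ?G" for U
      using UF_right[OF GU[OF that]] .
    show "(\<integral>\<^sup>+Q. f (U ** Q) \<partial>?M) = (\<integral>\<^sup>+Q. f Q \<partial>?M)" if U: "U \<in> ?G" and f: "f \<in> borel_measurable borel" for U f
    proof -
      have [measurable]: "f \<in> borel_measurable borel" by fact
      have prod: "U ** Q \<in> ?G" if "Q \<in> ?G" for Q
        using UF_mult[OF GU[OF U] GU[OF that]] U that
        by (intro haar_group_I \<beta>) (auto simp: haar_group_def det_mul)
      have "(\<lambda>Q. U ** Q) \<in> \<mu> \<rightarrow>\<^sub>M restrict_space borel ?G"
        using prod sp by (intro measurable_restrict_space2 m) auto
      then have mU: "(\<lambda>Q. U ** Q) \<in> \<mu> \<rightarrow>\<^sub>M \<mu>" using measurable_cong_sets[OF refl st] by blast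
      have "(\<integral>\<^sup>+Q. f (U ** Q) \<partial>\<mu>) = (\<integral>\<^sup>+Q. f Q \<partial>distr \<mu> \<mu> (\<lambda>Q. U ** Q))"
        using mU m[OF f] by (simp add: nn_integral_distr)
      also have "\<dots> = (\<integral>\<^sup>+Q. f Q \<partial>\<mu>)" using inv[OF U] by simp
      finally show ?thesis by (simp add: nn_integral_distr)
    qed
  qed
qed

subsection \<open>Orthonormal frames\<close>

text \<open>The first block of columns of the identity. Through it, taking the first columns, the
  top block and the corner all become matrix products.\<close>

definition emb :: "complex^'n::finite^('n + 'k::finite)" where
  "emb = (\<chi> a j. if a = Inl j then 1 else 0)"

lemma mult_emb: "(A ** emb) $ a $ j = A $ a $ Inl j"
  by (simp add: emb_def matrix_matrix_mult_def if_distrib[of "\<lambda>x. _ * x"] cong: if_cong)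

lemma adj_emb_mult: "(mat_adj emb ** A) $ i $ b = A $ Inl i $ b"
  by (simp add: emb_def mat_adj_def matrix_matrix_mult_def if_distrib[of cnj] if_distrib[of "\<lambda>x. x * _"] cong: if_cong)

lemma corner_eq: "corner Q = mat_adj emb ** Q ** emb"
  by (simp add: corner_def vec_eq_iff mult_emb adj_emb_mult)

lemma adj_emb_emb: "mat_adj emb ** (emb :: complex^'n^('n::finite + 'k::finite)) = mat 1"
  by (simp add: vec_eq_iff adj_emb_mult) (simp add: emb_def mat_def)

lemma emb_VM: "emb \<in> VM \<beta>"
  by (simp add: VM_def real_matrix_def emb_def)

lemma gram_PD:
  fixes X :: "complex^'n^'m"
  assumes "X \<in> VM \<beta>" "\<And>v. X *v v = 0 \<Longrightarrow> v = 0"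
  shows "mat_adj X ** X \<in> PD \<beta>"
  using assms by (intro PD_I Herm_gram) (auto simp: herm_form_gram)

lemma gram_PD_of_left_factor:
  fixes X :: "complex^'n^'m" and F :: "complex^'m^'n"
  assumes X: "X \<in> VM \<beta>" and d: "det (F ** X) \<noteq> 0"
  shows "mat_adj X ** X \<in> PD \<beta>"
proof (rule gram_PD[OF X])
  fix v assume "X *v v = 0"
  then have "(F ** X) *v v = 0" by (simp add: matrix_vector_mul_assoc[symmetric])
  then show "v = 0" using d det_nonzero_kernel by blast
qed

lemma det_scale_on: "det (scale_on J r :: complex^'n^'n) = of_real r ^ card J"
proof -
  have "det (scale_on J r :: complex^'n^'n) = (\<Prod>i\<in>UNIV. if i \<in> J then of_real r else 1)"
    by (subst det_diagonal) (auto simp: scale_on_def)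
  also have "\<dots> = of_real r ^ card J" by (simp add: prod.If_cases)
  finally show ?thesis .
qed

text \<open>Gram--Schmidt extends the orthonormal columns \<open>V\<close> to a square matrix and
  leaves them unchanged. An invertible top block is a generic condition that makes the remaining
  standard basis vectors a valid choice for the columns to be orthonormalized.\<close>

lemma frame_completion:
  fixes V :: "complex^'n^('n::finite + 'k::finite)"
  assumes \<beta>: "\<beta> \<in> {1, 2}" and V: "V \<in> VM \<beta>" "mat_adj V ** V = mat 1" and top: "det (mat_adj emb ** V) \<noteq> 0"
  obtains Q where "Q \<in> haar_group \<beta>" "Q ** emb = V"
proof -
  \<comment> \<open>\<open>V\<close> followed by the standard basis vectors of the lower block. If a
    combination of these columns vanishes, its top rows kill the coefficients of \<open>V\<close>,
    and then the lower rows kill the others.\<close>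
  define H :: "complex^('n + 'k)^('n + 'k)" where
    "H = (\<chi> a b. case b of Inl j \<Rightarrow> V $ a $ j | Inr k \<Rightarrow> if a = Inr k then 1 else 0)"
  have H: "H \<in> VM \<beta>"
    using V(1) by (auto simp: VM_def real_matrix_def H_def split: sum.splits)
  have Hv: "(H *v v) $ a = (V *v (\<chi> j. v $ Inl j)) $ a + (\<Sum>k\<in>UNIV. if a = Inr k then v $ Inr k else 0)" for v a
  proof -
    have "(H *v v) $ a = (\<Sum>b\<in>range Inl \<union> range Inr. H $ a $ b * v $ b)"
      by (simp add: matrix_vector_mult_def UNIV_sum[symmetric])
    also have "\<dots> = (\<Sum>b\<in>range Inl. H $ a $ b * v $ b) + (\<Sum>b\<in>range Inr. H $ a $ b * v $ b)"
      by (rule sum.union_disjoint) auto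
    also have "(\<Sum>b\<in>range Inl. H $ a $ b * v $ b) = (V *v (\<chi> j. v $ Inl j)) $ a"
      by (subst sum.reindex) (auto simp: matrix_vector_mult_def H_def)
    also have "(\<Sum>b\<in>range Inr. H $ a $ b * v $ b) = (\<Sum>k\<in>UNIV. if a = Inr k then v $ Inr k else 0)"
      by (subst sum.reindex) (auto simp: H_def intro!: sum.cong)
    finally show ?thesis .
  qed
  have PD: "mat_adj H ** H \<in> PD \<beta>"
  proof (rule gram_PD[OF H])
    fix v assume 0: "H *v v = 0"
    let ?w = "\<chi> j. v $ Inl j"
    have "((mat_adj emb ** V) *v ?w) $ i = (H *v v) $ Inl i" for i
      unfolding Hv by (simp add: matrix_vector_mult_def adj_emb_mult)
    then have "(mat_adj emb ** V) *v ?w = 0" using 0 by (simp add: vec_eq_iff)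
    then have w: "?w = 0" using top det_nonzero_kernel by blast
    have "(H *v v) $ Inr k = v $ Inr k" for k unfolding Hv w by simp
    then have "v $ Inr k = 0" for k using 0 by simp
    moreover have "v $ Inl j = 0" for j using w by (simp add: vec_eq_iff)
    ultimately have "v $ a = 0" for a by (cases a) auto
    then show "v = 0" by (simp add: vec_eq_iff)
  qed
  have orth: "orth_on (range Inl) (mat_adj H ** H)"
  proof -
    have "(mat_adj H ** H) $ Inl i $ Inl j = (mat_adj V ** V) $ i $ j" for i j
      unfolding mat_adj_mult_nth by (simp add: H_def)
    then show ?thesis using V(2) by (auto simp: orth_on_def mat_def)
  qed
  obtain E where E: "elem \<beta> E" "orth_on (range Inl \<union> range Inr) (mat_adj E ** (mat_adj H ** H) ** E)"
    "\<And>a b. b \<in> range Inl \<Longrightarrow> E $ a $ b = (if a = b then 1 else 0)"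
    using gram_schmidt[of "range Inr :: ('n + 'k) set" "range Inl" \<beta>] PD orth by fastforce
  have "mat_adj (H ** E) ** (H ** E) = mat_adj E ** (mat_adj H ** H) ** E"
    by (simp only: mat_adj_mult matrix_mul_assoc)
  moreover have "mat_adj E ** (mat_adj H ** H) ** E = mat 1"
    using E(2) unfolding UNIV_sum[symmetric] by (simp add: orth_on_def mat_def vec_eq_iff)
  ultimately have Q0: "H ** E \<in> UF \<beta>"
    using H elem_GLF[OF E(1)] by (auto simp: UF_def GLF_def intro: VM_mult)
  have emb0: "(H ** E) ** emb = V"
  proof -
    have "((H ** E) ** emb) $ a $ j = V $ a $ j" for a j
    proof -
      have "((H ** E) ** emb) $ a $ j = (\<Sum>c\<in>UNIV. H $ a $ c * E $ c $ Inl j)"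
        by (simp add: mult_emb) (simp add: matrix_matrix_mult_def)
      also have "\<dots> = (\<Sum>c\<in>UNIV. if c = Inl j then H $ a $ c else 0)"
        by (intro sum.cong) (auto simp: E(3))
      also have "\<dots> = V $ a $ j" by (simp add: H_def)
      finally show ?thesis .
    qed
    then show ?thesis by (simp add: vec_eq_iff)
  qed
  show ?thesis
  proof (cases "\<beta> = 1 \<longrightarrow> det (H ** E) = 1")
    case True
    then show ?thesis using that[OF haar_group_I[OF \<beta> Q0]] emb0 by blast
  next
    case False
    then have \<beta>1: "\<beta> = 1" and d1: "det (H ** E) \<noteq> 1" by auto
    have "cnj (det (H ** E)) * det (H ** E) = 1"
      using Q0 unfolding UF_def by (metis (mono_tags, lifting) det_I det_mat_adj det_mul mem_Collect_eq)
    moreover have "cnj (det (H ** E)) = det (H ** E)"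
      using Q0 \<beta>1 by (intro det_VM_1) (simp add: UF_def)
    ultimately have "det (H ** E) * det (H ** E) = 1" by simp
    then have dm: "det (H ** E) = -1" using d1 by (simp add: square_eq_1_iff)
    \<comment> \<open>Negating some column outside \<open>V\<close> corrects the sign of the
      determinant; the second index block is never empty.\<close>
    let ?F = "scale_on {Inr undefined} (-1) :: complex^('n + 'k)^('n + 'k)"
    have F: "?F \<in> UF \<beta>"
    proof -
      have "(mat_adj ?F ** ?F) $ a $ b = (mat 1 :: complex^('n + 'k)^('n + 'k)) $ a $ b" for a b
        unfolding scale_on_mult by (simp add: mat_adj_def scale_on_def mat_def)
      then show ?thesis by (simp add: UF_def vec_eq_iff VM_def real_matrix_def scale_on_def)
    qed
    have "?F ** emb = (emb :: complex^'n^('n + 'k))"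
      by (simp add: vec_eq_iff scale_on_mult_left) (simp add: emb_def)
    then have "(H ** E ** ?F) ** emb = V" using emb0 by (simp add: matrix_mul_assoc[symmetric])
    moreover have "det (H ** E ** ?F) = 1" using dm by (simp only: det_mul[of "H ** E"] det_scale_on) simp
    ultimately show ?thesis using that[OF haar_group_I[OF \<beta> UF_mult[OF Q0 F]]] by blast
  qed
qed

text \<open>A polar-type decomposition: with \<open>g\<close> a root of
  \<open>mat_adj X ** X\<close>, the columns of \<open>X ** matrix_inv g\<close> are orthonormal,
  and they extend to a group element.\<close>

lemma frame_transitive:
  fixes X :: "complex^'n^('n::finite + 'k::finite)"
  assumes \<beta>: "\<beta> \<in> {1, 2}" and X: "X \<in> VM \<beta>" and top: "det (mat_adj emb ** X) \<noteq> 0"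
  obtains Q g where "Q \<in> haar_group \<beta>" "g \<in> GLF \<beta>" "X = Q ** emb ** g"
proof -
  obtain g where g: "g \<in> GLF \<beta>" "mat_adj X ** X = mat_adj g ** g"
    using gram_PD_of_left_factor[OF X top] by (rule PD_eq_gram)
  have d: "det g \<noteq> 0" using g by (simp add: GLF_def)
  let ?V = "X ** matrix_inv g"
  have "?V \<in> VM \<beta>" using X GLF_inv[OF g(1)] by (auto simp: GLF_def intro: VM_mult)
  moreover have "mat_adj ?V ** ?V = mat 1"
  proof -
    have "mat_adj ?V ** ?V = mat_adj (matrix_inv g) ** (mat_adj X ** X) ** matrix_inv g"
      by (simp only: mat_adj_mult matrix_mul_assoc)
    then show ?thesis using congruence_inv(1)[OF g(1), of "mat 1"] g(2) by simp
  qed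
  moreover have "det (mat_adj emb ** ?V) \<noteq> 0"
    using top GLF_inv[OF g(1)] by (simp add: matrix_mul_assoc det_mul[of "mat_adj emb ** X"] GLF_def)
  ultimately obtain Q where Q: "Q \<in> haar_group \<beta>" "Q ** emb = ?V" using frame_completion[OF \<beta>] by blast
  have "X = Q ** emb ** g" unfolding Q(2) using matrix_inv(2)[OF d] by (simp add: matrix_mul_assoc[symmetric])
  then show ?thesis using that Q(1) g(1) by blast
qed

lemma dpow_UF: "u \<in> UF \<beta> \<Longrightarrow> dpow u r = 1"
  by (simp add: dpow_def cmod_det_UF)

text \<open>The product of the compact group and \<open>GLF \<beta>\<close> acts by multiplication
  on the two sides of \<open>X\<close>, and almost every \<open>X\<close> lies in the orbit of
  \<open>emb\<close>. The orbit integral is therefore the double integral over \<open>Q\<close> and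
  \<open>g\<close> on the right.\<close>

lemma frame_measure:
  fixes M :: "(complex^('n::finite + 'k::finite)^('n + 'k)) measure"
  assumes \<beta>: "\<beta> \<in> {1, 2}" and haar: "haar_measure (haar_group \<beta>) M"
  obtains c :: real where "c > 0"
    "\<And>F :: complex^'n^('n + 'k) \<Rightarrow> ennreal. F \<in> borel_measurable borel \<Longrightarrow> (\<integral>\<^sup>+X. F X \<partial>LM \<beta>) =
      ennreal c * (\<integral>\<^sup>+Q. \<integral>\<^sup>+g. dpow g (real \<beta> * CARD('n + 'k)) * F (Q ** emb ** g) \<partial>HM \<beta> \<partial>M)"
proof -
  interpret haar_measure "haar_group \<beta>" M by fact
  let ?t = "real \<beta> * CARD('n + 'k)"
  let ?L = "LM \<beta> :: (complex^'n^('n + 'k)) measure"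
  let ?H = "HM \<beta> :: (complex^'n^'n) measure"
  \<comment> \<open>Replacing \<open>X\<close> by \<open>X ** g\<close> scales Lebesgue measure by
    \<open>dpow g (- ?t)\<close>; the Gram determinant picks up the square of
    \<open>cmod (det g)\<close>, so the exponent \<open>- ?t / 2\<close> compensates.\<close>
  let ?w = "\<lambda>X::complex^'n^('n + 'k). dpow (mat_adj X ** X) (- ?t / 2)"
  define P where "P = M \<Otimes>\<^sub>M ?H"
  define \<kappa> where "\<kappa> h = (\<integral>\<^sup>+Q. \<integral>\<^sup>+g. h (Q ** emb ** g) \<partial>?H \<partial>M)" for h :: "complex^'n^('n + 'k) \<Rightarrow> ennreal"
  interpret MH: pair_sigma_finite M ?H
    using sigma_finite_M sigma_finite_HM[OF \<beta>] by (simp add: pair_sigma_finite_def)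
  have sP: "sets P = sets borel"
    unfolding P_def borel_prod[symmetric] by (rule sets_pair_measure_cong[OF sets_M sets_HM])
  have niP: "(\<integral>\<^sup>+p. h p \<partial>P) = (\<integral>\<^sup>+Q. \<integral>\<^sup>+g. h (Q, g) \<partial>?H \<partial>M)" if "h \<in> borel_measurable borel" for h
    unfolding P_def using that sP unfolding P_def
    by (intro sigma_finite_measure.nn_integral_fst[OF sigma_finite_HM[OF \<beta>], symmetric]) (simp cong: measurable_cong_sets)
  have AEP: "AE p in P. fst p \<in> haar_group \<beta> \<and> snd p \<in> GLF \<beta>"
    unfolding P_def
  proof (rule MH.AE_pair_measure)
    have "haar_group \<beta> \<times> GLF \<beta> \<in> sets (M \<Otimes>\<^sub>M ?H)"
      by (intro pair_measureI) (simp_all add: sets_M sets_HM borel_haar_group)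
    moreover have "{x \<in> space (M \<Otimes>\<^sub>M ?H). fst x \<in> haar_group \<beta> \<and> snd x \<in> GLF \<beta>} = haar_group \<beta> \<times> GLF \<beta>"
      using sets_eq_imp_space_eq[OF sets_M] sets_eq_imp_space_eq[OF sets_HM] by (auto simp: space_pair_measure)
    ultimately show "{x \<in> space (M \<Otimes>\<^sub>M ?H). fst x \<in> haar_group \<beta> \<and> snd x \<in> GLF \<beta>} \<in> sets (M \<Otimes>\<^sub>M ?H)" by simp
    show "AE x in M. AE y in ?H. fst (x, y) \<in> haar_group \<beta> \<and> snd (x, y) \<in> GLF \<beta>"
      using AE_G by eventually_elim (use AE_HM_GLF[OF \<beta>] in simp)
  qed
  have top: "AE X in ?L. X \<in> VM \<beta> \<and> det (mat_adj emb ** X) \<noteq> 0"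
    using AE_LM_det_mult[OF \<beta> emb_VM adj_emb_emb] leb_on.AE_leb[OF leb_LM[OF \<beta>]] by eventually_elim simp
  have top_PD: "AE X in ?L. det (mat_adj X ** X) \<noteq> 0"
    using top by eventually_elim (use gram_PD_of_left_factor in \<open>auto simp: PD_def\<close>)
  have L_inv: "(\<integral>\<^sup>+X. F (Q ** X ** g) \<partial>?L) = dpow g (- ?t) * (\<integral>\<^sup>+X. F X \<partial>?L)"
    if Q: "Q \<in> haar_group \<beta>" and g: "g \<in> GLF \<beta>" and F[measurable]: "F \<in> borel_measurable borel" for Q g F
  proof -
    have U: "Q \<in> UF \<beta>" by (rule haar_group_UF[OF \<beta> Q])
    have "(\<integral>\<^sup>+X. F (Q ** X ** g) \<partial>?L) = (\<integral>\<^sup>+X. F (X ** g) \<partial>?L)"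
      using LM_left[OF \<beta> UF_GLF[OF U], of "\<lambda>X. F (X ** g)"] by (simp add: cmod_det_UF[OF U])
    also have "\<dots> = dpow g (- ?t) * (\<integral>\<^sup>+X. F X \<partial>?L)"
      unfolding dpow_def by (rule LM_right[OF \<beta> g]) measurable
    finally show ?thesis .
  qed
  have w_inv: "(\<integral>\<^sup>+X. ?w X * F (Q ** X ** g) \<partial>?L) = (\<integral>\<^sup>+X. ?w X * F X \<partial>?L)"
    if Q: "Q \<in> haar_group \<beta>" and g: "g \<in> GLF \<beta>" and F[measurable]: "F \<in> borel_measurable borel" for Q g F
  proof -
    have d: "det g \<noteq> 0" using g by (simp add: GLF_def)
    have gram: "mat_adj (Q ** X ** g) ** (Q ** X ** g) = mat_adj g ** (mat_adj X ** X) ** g" for X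
    proof -
      have "mat_adj (Q ** X ** g) ** (Q ** X ** g) = mat_adj g ** (mat_adj X ** (mat_adj Q ** Q) ** X) ** g"
        by (simp only: mat_adj_mult matrix_mul_assoc)
      then show ?thesis using unitary_G'[OF Q] by simp
    qed
    have e: "2 * (- ?t / 2) = - ?t" by simp
    have "(\<integral>\<^sup>+X. ?w X * F (Q ** X ** g) \<partial>?L) = (\<integral>\<^sup>+X. (\<lambda>X. dpow g ?t * (dpow (mat_adj X ** X) (- ?t / 2) * F X)) (Q ** X ** g) \<partial>?L)"
      using dpow_cancel(1)[OF d, of ?t] by (intro nn_integral_cong) (simp only: gram dpow_congruence e mult.assoc)
    also have "\<dots> = dpow g (- ?t) * (\<integral>\<^sup>+X. dpow g ?t * (dpow (mat_adj X ** X) (- ?t / 2) * F X) \<partial>?L)"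
      by (rule L_inv[OF Q g]) measurable
    also have "\<dots> = (\<integral>\<^sup>+X. dpow (mat_adj X ** X) (- ?t / 2) * F X \<partial>?L)"
      using dpow_cancel(2)[OF d] by (subst nn_integral_cmult) (simp_all add: measurable_LM)
    finally show ?thesis .
  qed
  have param: "(\<lambda>Q. \<integral>\<^sup>+g. h (Q ** X ** g) \<partial>?H) \<in> borel_measurable borel"
    if [measurable]: "h \<in> borel_measurable borel" for h and X :: "complex^'n^('n + 'k)"
    by (rule borel_measurable_nn_integral_param[OF sigma_finite_HM[OF \<beta>] sets_HM])
      (unfold borel_prod[symmetric], measurable)
  have orbit: "(\<integral>\<^sup>+Q. \<integral>\<^sup>+g. h (Q ** X ** g) \<partial>?H \<partial>M) = \<kappa> h"
    if X: "X \<in> VM \<beta>" "det (mat_adj emb ** X) \<noteq> 0" and h[measurable]: "h \<in> borel_measurable borel" for X h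
  proof -
    obtain Q0 g0 where Q0: "Q0 \<in> haar_group \<beta>" and g0: "g0 \<in> GLF \<beta>" and X0: "X = Q0 ** emb ** g0"
      using frame_transitive[OF \<beta> X] by blast
    have "(\<integral>\<^sup>+g. h (Q ** X ** g) \<partial>?H) = (\<integral>\<^sup>+g. h (Q ** Q0 ** emb ** g) \<partial>?H)" for Q
      using HM_left[OF \<beta> g0, of "\<lambda>g. h (Q ** Q0 ** emb ** g)"] unfolding X0
      by (simp add: matrix_mul_assoc)
    then have "(\<integral>\<^sup>+Q. \<integral>\<^sup>+g. h (Q ** X ** g) \<partial>?H \<partial>M) = (\<integral>\<^sup>+Q. \<integral>\<^sup>+g. h (Q ** Q0 ** emb ** g) \<partial>?H \<partial>M)" by simp
    also have "\<dots> = \<kappa> h" unfolding \<kappa>_def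
      by (rule right[OF Q0 param[OF h], of emb])
    finally show ?thesis .
  qed
  \<comment> \<open>Unimodularity of both factors: inversion is absorbed by \<open>HM_inv\<close> on
    \<open>g\<close> and by \<open>adjoint\<close> on \<open>Q\<close>.\<close>
  have orbit': "(\<integral>\<^sup>+Q. \<integral>\<^sup>+g. h (mat_adj Q ** X ** matrix_inv g) \<partial>?H \<partial>M) = (\<integral>\<^sup>+Q. \<integral>\<^sup>+g. h (Q ** X ** g) \<partial>?H \<partial>M)"
    if h[measurable]: "h \<in> borel_measurable borel" for X h
  proof -
    have "(\<integral>\<^sup>+g. h (mat_adj Q ** X ** matrix_inv g) \<partial>?H) = (\<integral>\<^sup>+g. h (mat_adj Q ** X ** g) \<partial>?H)" for Q
      by (rule HM_inv[OF \<beta>, of "\<lambda>g. h (mat_adj Q ** X ** g)"]) measurable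
    then have "(\<integral>\<^sup>+Q. \<integral>\<^sup>+g. h (mat_adj Q ** X ** matrix_inv g) \<partial>?H \<partial>M) = (\<integral>\<^sup>+Q. \<integral>\<^sup>+g. h (mat_adj Q ** X ** g) \<partial>?H \<partial>M)"
      by simp
    also have "\<dots> = (\<integral>\<^sup>+Q. \<integral>\<^sup>+g. h (Q ** X ** g) \<partial>?H \<partial>M)"
      by (rule adjoint[OF param[OF h]])
    finally show ?thesis .
  qed
  obtain B :: "(complex^'n^'n) set" where B: "B \<in> sets borel" "0 < (\<integral>\<^sup>+g. indicator B (mat_adj g ** g) \<partial>?H)"
    "(\<integral>\<^sup>+g. indicator B (mat_adj g ** g) \<partial>?H) < \<infinity>"
    using HM_gram_pos_finite_set[OF \<beta>] by blast
  have gram_emb: "mat_adj (Q ** emb ** g) ** (Q ** emb ** g) = mat_adj g ** g"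
    if "Q \<in> haar_group \<beta>" for Q :: "complex^('n + 'k)^('n + 'k)" and g :: "complex^'n^'n"
  proof -
    have "mat_adj (Q ** emb ** g) ** (Q ** emb ** g) = mat_adj g ** (mat_adj emb ** (mat_adj Q ** Q) ** emb) ** g"
      by (simp only: mat_adj_mult matrix_mul_assoc)
    then show ?thesis using unitary_G'[OF that] by (simp add: adj_emb_emb)
  qed
  let ?b = "\<lambda>X::complex^'n^('n + 'k). indicator B (mat_adj X ** X) :: ennreal"
  have [measurable]: "B \<in> sets borel" by (rule B)
  \<comment> \<open>The Gram matrix of \<open>Q ** emb ** g\<close> does not see \<open>Q\<close>,
    and \<open>Q\<close> has total mass one.\<close>
  have \<kappa>b: "\<kappa> ?b = (\<integral>\<^sup>+g. indicator B (mat_adj g ** g) \<partial>?H)"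
  proof -
    have "\<kappa> ?b = (\<integral>\<^sup>+Q. \<integral>\<^sup>+g. indicator B (mat_adj g ** g) \<partial>?H \<partial>M)"
      unfolding \<kappa>_def using AE_G by (intro nn_integral_cong_AE) (auto simp: gram_emb elim!: eventually_mono)
    then show ?thesis by (simp add: emeasure_M)
  qed
  obtain c :: real where c: "c > 0" "\<And>F. F \<in> borel_measurable borel \<Longrightarrow> (\<integral>\<^sup>+X. ?w X * F X \<partial>?L) = ennreal c * \<kappa> F"
  proof (rule homogeneous_measure_unique[where P = P and \<nu> = ?L and w = ?w and \<kappa> = \<kappa> and b = ?b
      and a = "\<lambda>p X. fst p ** X ** snd p" and a' = "\<lambda>p X. mat_adj (fst p) ** X ** matrix_inv (snd p)"])
    show "sigma_finite_measure P" unfolding P_def by (rule MH.sigma_finite_measure_axioms)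
    show "sets P = sets borel" by (rule sP)
    show "emeasure ?L (space ?L) \<noteq> 0" by (rule leb_on.leb_nonzero[OF leb_LM[OF \<beta>]])
    show "AE X in ?L. ?w X \<noteq> 0"
      using top_PD
    proof eventually_elim
      case (elim X)
      then show ?case using dpow_pos[of "mat_adj X ** X" "- ?t / 2"] by simp
    qed
    show "(\<lambda>(p::(complex^('n + 'k)^('n + 'k)) \<times> (complex^'n^'n), X::complex^'n^('n + 'k)). fst p ** X ** snd p) \<in> borel \<rightarrow>\<^sub>M borel"
      "(\<lambda>(p::(complex^('n + 'k)^('n + 'k)) \<times> (complex^'n^'n), X::complex^'n^('n + 'k)). mat_adj (fst p) ** X ** matrix_inv (snd p)) \<in> borel \<rightarrow>\<^sub>M borel"
      unfolding borel_prod[symmetric] by measurable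
    show "AE p in P. (\<forall>x. mat_adj (fst p) ** (fst p ** x ** snd p) ** matrix_inv (snd p) = x) \<and>
        (\<forall>F\<in>borel_measurable borel. (\<integral>\<^sup>+x. ?w x * F (fst p ** x ** snd p) \<partial>?L) = (\<integral>\<^sup>+x. ?w x * F x \<partial>?L))"
      using AEP
    proof eventually_elim
      case (elim p)
      have "mat_adj (fst p) ** (fst p ** x ** snd p) ** matrix_inv (snd p) =
          (mat_adj (fst p) ** fst p) ** x ** (snd p ** matrix_inv (snd p))" for x
        by (simp only: matrix_mul_assoc)
      then show ?case using elim w_inv unitary_G' by (simp add: matrix_inv GLF_def)
    qed
    show "AE x in ?L. (\<integral>\<^sup>+p. h (fst p ** x ** snd p) \<partial>P) = \<kappa> h \<and>
        (\<integral>\<^sup>+p. h (mat_adj (fst p) ** x ** matrix_inv (snd p)) \<partial>P) = \<kappa> h"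
      if [measurable]: "h \<in> borel_measurable borel" for h
      using top
    proof eventually_elim
      case (elim x)
      have "(\<lambda>p. h (fst p ** x ** snd p)) \<in> borel_measurable borel"
        "(\<lambda>p. h (mat_adj (fst p) ** x ** matrix_inv (snd p))) \<in> borel_measurable borel"
        unfolding borel_prod[symmetric] by measurable
      then show ?case using elim orbit[of x h] orbit'[of h x] by (simp add: niP)
    qed
    show "?b \<in> borel_measurable borel" by measurable
    show "0 < \<kappa> ?b" "\<kappa> ?b < \<infinity>" using B \<kappa>b by simp_all
  qed (simp_all add: sigma_finite_LM[OF \<beta>] sets_LM dpow_neq_top)
  show ?thesis
  proof (rule that[OF c(1)])
    fix F :: "complex^'n^('n + 'k) \<Rightarrow> ennreal" assume F[measurable]: "F \<in> borel_measurable borel"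
    have "(\<integral>\<^sup>+X. F X \<partial>?L) = (\<integral>\<^sup>+X. dpow (mat_adj X ** X) (- ?t / 2) * (dpow (mat_adj X ** X) (?t / 2) * F X) \<partial>?L)"
    proof (rule nn_integral_cong_AE)
      show "AE X in ?L. F X = dpow (mat_adj X ** X) (- ?t / 2) * (dpow (mat_adj X ** X) (?t / 2) * F X)"
        using top_PD
      proof eventually_elim
        case (elim X)
        then show ?case using dpow_cancel(2)[of "mat_adj X ** X" "?t / 2" "F X"] by simp
      qed
    qed
    also have "\<dots> = ennreal c * \<kappa> (\<lambda>X. dpow (mat_adj X ** X) (?t / 2) * F X)"
      by (rule c(2)) measurable
    also have "\<kappa> (\<lambda>X. dpow (mat_adj X ** X) (?t / 2) * F X) =
        (\<integral>\<^sup>+Q. \<integral>\<^sup>+g. dpow g ?t * F (Q ** emb ** g) \<partial>?H \<partial>M)"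
      unfolding \<kappa>_def using AE_G
      by (intro nn_integral_cong_AE) (auto simp: gram_emb dpow_gram elim!: eventually_mono)
    finally show "(\<integral>\<^sup>+X. F X \<partial>?L) = ennreal c * (\<integral>\<^sup>+Q. \<integral>\<^sup>+g. dpow g ?t * F (Q ** emb ** g) \<partial>?H \<partial>M)" .
  qed
qed

subsection \<open>Gram matrices and Hermitian matrices on the positive cone\<close>

text \<open>The image of \<open>LM \<beta>\<close> under the Gram map inherits from
  \<open>LM_right\<close> the scaling that \<open>cone_measure\<close> requires. At least as many
  rows as columns are needed for Gram matrices to be nonsingular almost everywhere.\<close>

lemma gram_measure:
  fixes \<beta> :: nat
  assumes \<beta>: "\<beta> \<in> {1, 2}" and card: "CARD('k::finite) \<ge> CARD('n::finite)"
  obtains c :: real where "c > 0"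
    "\<And>f :: complex^'n^'n \<Rightarrow> ennreal. f \<in> borel_measurable borel \<Longrightarrow>
      (\<integral>\<^sup>+X. f (mat_adj X ** X) \<partial>(LM \<beta> :: (complex^'n^'k) measure)) =
      ennreal c * (\<integral>\<^sup>+g. dpow g (real \<beta> * CARD('k)) * f (mat_adj g ** g) \<partial>HM \<beta>)"
proof -
  let ?L = "LM \<beta> :: (complex^'n^'k) measure"
  define \<nu> where "\<nu> = distr ?L borel (\<lambda>X. mat_adj X ** X)"
  interpret L: leb_on "VM \<beta>" ?L "real \<beta> * CARD('n) * CARD('k)" using \<beta> by (rule leb_LM)
  have m[measurable]: "(\<lambda>X. mat_adj X ** X) \<in> ?L \<rightarrow>\<^sub>M borel" by measurable
  \<comment> \<open>A coordinate isometry \<open>E\<close> is both the direction and, through its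
    adjoint, the left factor in \<open>AE_LM_det_mult\<close>; a nonsingular
    \<open>mat_adj E ** X\<close> makes \<open>X\<close> injective.\<close>
  obtain \<iota> :: "'n \<Rightarrow> 'k" where \<iota>: "inj \<iota>"
    using card by (metis card_le_inj finite top_greatest inj_on_def UNIV_I)
  define E :: "complex^'n^'k" where "E = (\<chi> a j. if a = \<iota> j then 1 else 0)"
  have EE: "mat_adj E ** E = mat 1"
  proof -
    have "(mat_adj E ** E) $ i $ j = (mat 1 :: complex^'n^'n) $ i $ j" for i j
      using \<iota> by (simp add: mat_adj_mult_nth E_def mat_def inj_eq if_distrib[of cnj] if_distrib[of "\<lambda>x. x * _"] cong: if_cong)
    then show ?thesis by (simp add: vec_eq_iff)
  qed
  have PD: "AE X in ?L. mat_adj X ** X \<in> PD \<beta>"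
  proof -
    have "E \<in> VM \<beta>" by (simp add: VM_def real_matrix_def E_def)
    from AE_LM_det_mult[OF \<beta> this EE] L.AE_leb show ?thesis
      by eventually_elim (rule gram_PD_of_left_factor)
  qed
  have ni: "(\<integral>\<^sup>+S. f S \<partial>\<nu>) = (\<integral>\<^sup>+X. f (mat_adj X ** X) \<partial>?L)" if "f \<in> borel_measurable borel" for f
    unfolding \<nu>_def using that by (simp add: nn_integral_distr)
  have "\<exists>c>0. \<forall>f\<in>borel_measurable borel. (\<integral>\<^sup>+S. f S \<partial>\<nu>) =
      ennreal c * (\<integral>\<^sup>+g. dpow g (real \<beta> * CARD('k)) * f (mat_adj g ** g) \<partial>HM \<beta>)"
  proof (rule cone_measure[OF \<beta>, of \<nu> "real \<beta> * CARD('k)"])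
    show "sigma_finite_measure \<nu>"
    proof
      \<comment> \<open>An image measure need not be sigma-finite. Here the sublevel sets of the
        trace have balls as preimages, because the trace of the Gram matrix is the squared
        norm.\<close>
      let ?A = "\<lambda>k::nat. {S::complex^'n^'n. Re (trace S) \<le> (real k)\<^sup>2}"
      have A: "?A k \<in> sets borel" for k unfolding trace_def by measurable
      have "emeasure \<nu> (?A k) \<noteq> \<infinity>" for k
      proof -
        have "emeasure \<nu> (?A k) = emeasure ?L ((\<lambda>X. mat_adj X ** X) -` ?A k \<inter> space ?L)"
          unfolding \<nu>_def by (rule emeasure_distr[OF m A])
        also have "(\<lambda>X. mat_adj X ** X) -` ?A k \<inter> space ?L = cball 0 (real k)"
          by (auto simp: L.space_leb norm_matrix_square[symmetric] abs_le_square_iff[symmetric])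
        finally show ?thesis using L.leb_cball[of "real k"] by simp
      qed
      moreover have "\<Union>(range ?A) = space \<nu>"
      proof -
        have "S \<in> \<Union>(range ?A)" for S
        proof -
          obtain k :: nat where k: "Re (trace S) \<le> real k" using real_arch_simple by blast
          have "real k \<le> (real k)\<^sup>2" by (cases k) (simp_all add: power2_eq_square)
          then have "S \<in> ?A k" unfolding mem_Collect_eq by (rule order_trans[OF k])
          then show ?thesis by blast
        qed
        then show ?thesis by (auto simp: \<nu>_def)
      qed
      ultimately show "\<exists>A. countable A \<and> A \<subseteq> sets \<nu> \<and> \<Union> A = space \<nu> \<and> (\<forall>a\<in>A. emeasure \<nu> a \<noteq> \<infinity>)"
        using A by (intro exI[of _ "range ?A"]) (auto simp: \<nu>_def)
    qed
    show "sets \<nu> = sets borel" by (simp add: \<nu>_def)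
    show "emeasure \<nu> (space \<nu>) \<noteq> 0"
      using L.leb_nonzero unfolding \<nu>_def by (subst emeasure_distr) (auto simp: L.space_leb)
    show "AE S in \<nu>. S \<in> PD \<beta>" unfolding \<nu>_def using PD by (subst AE_distr_iff) auto
    fix g :: "complex^'n^'n" and f :: "complex^'n^'n \<Rightarrow> ennreal"
    assume g: "g \<in> GLF \<beta>" and f[measurable]: "f \<in> borel_measurable borel"
    have "(\<integral>\<^sup>+S. f (mat_adj g ** S ** g) \<partial>\<nu>) = (\<integral>\<^sup>+X. (\<lambda>X. f (mat_adj X ** X)) (X ** g) \<partial>?L)"
      by (subst ni) (measurable, simp add: mat_adj_mult matrix_mul_assoc)
    also have "\<dots> = dpow g (- (real \<beta> * CARD('k))) * (\<integral>\<^sup>+X. f (mat_adj X ** X) \<partial>?L)"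
      unfolding dpow_def by (rule LM_right[OF \<beta> g]) measurable
    finally show "(\<integral>\<^sup>+S. f (mat_adj g ** S ** g) \<partial>\<nu>) = dpow g (- (real \<beta> * CARD('k))) * (\<integral>\<^sup>+S. f S \<partial>\<nu>)"
      by (simp add: ni)
  qed blast
  then show ?thesis using that by (auto simp: ni)
qed

text \<open>Countably many translates of the cone cover the Hermitian matrices; this is how the cone
  is seen to have positive Lebesgue measure. Any integer above an operator bound of \<open>S\<close>
  works, by Cauchy--Schwarz.\<close>

lemma PD_plus_large_multiple:
  assumes S: "S \<in> Herm \<beta>"
  shows "\<exists>k::nat. S + real k *\<^sub>R mat 1 \<in> PD \<beta>"
proof -
  obtain b where b: "\<And>x. norm (S *v x) \<le> norm x * b"
    using bounded_linear.bounded[OF matrix_vector_mul_bounded_linear[of S]] by blast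
  obtain k :: nat where k: "b < real k" using reals_Archimedean2 by blast
  have "S + real k *\<^sub>R mat 1 \<in> PD \<beta>"
  proof (rule PD_I)
    show "S + real k *\<^sub>R mat 1 \<in> Herm \<beta>"
      using subspace_add[OF subspace_Herm S subspace_scale[OF subspace_Herm Herm_1]] .
    fix x :: "complex^'a" assume x: "x \<noteq> 0"
    have Re_cip: "Re (cip x y) = inner x y" for y :: "complex^'a"
      by (simp add: cip_def inner_vec_def inner_complex_def)
    have k1: "herm_form (real k *\<^sub>R mat 1) x = of_real (real k * (norm x)\<^sup>2)"
    proof -
      have "(real k *\<^sub>R mat 1) *v x = real k *\<^sub>R x"
        by (simp add: matrix_vector_mult_def vec_eq_iff mat_def scaleR_sum_right[symmetric]
          if_distrib[of "\<lambda>x. x * _"] if_distrib[of "scaleR _"] cong: if_cong)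
      then show ?thesis by (simp only: herm_form_cip cip_scaleR cip_self) (simp add: scaleR_conv_of_real)
    qed
    have "\<bar>inner x (S *v x)\<bar> \<le> norm x * norm (S *v x)" by (rule Cauchy_Schwarz_ineq2)
    also have "\<dots> \<le> norm x * (norm x * b)" using b[of x] by (intro mult_left_mono) auto
    also have "\<dots> < real k * (norm x)\<^sup>2" using x k by (simp add: power2_eq_square)
    finally show "0 < Re (herm_form (S + real k *\<^sub>R mat 1) x)"
      unfolding herm_form_add k1 herm_form_cip[of S] by (simp add: Re_cip del: of_real_mult)
  qed
  then show ?thesis ..
qed

lemma herm_cone_measure:
  fixes \<beta> :: nat
  assumes \<beta>: "\<beta> \<in> {1, 2}"
  obtains c :: real where "c > 0"
    "\<And>f :: 'n::{finite,linorder} cmat \<Rightarrow> ennreal. f \<in> borel_measurable borel \<Longrightarrow>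
      (\<integral>\<^sup>+S. indicator (PD \<beta>) S * f S \<partial>herm_lebesgue \<beta>) =
      ennreal c * (\<integral>\<^sup>+g. dpow g (real \<beta> * (real CARD('n) - 1) + 2) * f (mat_adj g ** g) \<partial>HM \<beta>)"
proof -
  let ?L = "herm_lebesgue \<beta> :: 'n cmat measure" and ?\<gamma> = "real \<beta> * (real CARD('n) - 1) + 2"
  interpret L: leb_on "Herm \<beta>" ?L "real (card (herm_param_index \<beta> :: ('n \<times> 'n) set))"
    using \<beta> by (rule leb_herm_lebesgue)
  define \<nu> where "\<nu> = density ?L (indicator (PD \<beta>))"
  have mL: "f \<in> borel_measurable ?L \<longleftrightarrow> f \<in> borel_measurable borel" for f :: "'n cmat \<Rightarrow> ennreal"
    using measurable_cong_sets[OF L.sets_leb refl] by blast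
  have mP: "(indicator (PD \<beta>) :: 'n cmat \<Rightarrow> ennreal) \<in> borel_measurable borel"
    by (rule borel_measurable_indicator[OF borel_PD])
  have ni: "(\<integral>\<^sup>+S. f S \<partial>\<nu>) = (\<integral>\<^sup>+S. indicator (PD \<beta>) S * f S \<partial>?L)" if "f \<in> borel_measurable borel" for f
    unfolding \<nu>_def using that mP by (intro nn_integral_density) (simp_all add: mL)
  have "\<exists>c>0. \<forall>f\<in>borel_measurable borel. (\<integral>\<^sup>+S. f S \<partial>\<nu>) =
      ennreal c * (\<integral>\<^sup>+g. dpow g ?\<gamma> * f (mat_adj g ** g) \<partial>HM \<beta>)"
  proof (rule cone_measure[OF \<beta>, of \<nu> ?\<gamma>])
    show "sigma_finite_measure \<nu>" unfolding \<nu>_def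
      by (rule sigma_finite_density_finite) (simp_all add: L.sigma_finite_leb mL mP indicator_def)
    show "sets \<nu> = sets borel" by (simp add: \<nu>_def L.sets_leb)
    show "emeasure \<nu> (space \<nu>) \<noteq> 0"
    proof
      assume "emeasure \<nu> (space \<nu>) = 0"
      then have "(\<integral>\<^sup>+S. 1 \<partial>\<nu>) = 0" by simp
      then have z: "(\<integral>\<^sup>+S. indicator (PD \<beta>) S \<partial>?L) = 0" by (subst (asm) ni) auto
      \<comment> \<open>By translation invariance a null cone would have null translates, yet these
        cover the whole space.\<close>
      have "AE S in ?L. S + real k *\<^sub>R mat 1 \<notin> PD \<beta>" for k :: nat
      proof -
        have "real k *\<^sub>R mat 1 \<in> Herm \<beta>" by (rule subspace_scale[OF subspace_Herm Herm_1])
        from L.leb_translate[OF this mP] z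
        have "(\<integral>\<^sup>+S. indicator (PD \<beta>) (S + real k *\<^sub>R mat 1) \<partial>?L) = 0" by simp
        moreover have "(\<lambda>S. indicator (PD \<beta>) (S + real k *\<^sub>R mat 1) :: ennreal) \<in> borel_measurable ?L"
          unfolding mL by (rule measurable_compose[OF _ mP]) measurable
        ultimately have "AE S in ?L. indicator (PD \<beta>) (S + real k *\<^sub>R mat 1) = (0::ennreal)"
          by (simp add: nn_integral_0_iff_AE)
        then show ?thesis by eventually_elim (auto simp: indicator_def split: if_splits)
      qed
      then have "AE S in ?L. \<forall>k::nat. S + real k *\<^sub>R mat 1 \<notin> PD \<beta>" by (simp add: AE_all_countable)
      with L.AE_leb have "AE S in ?L. False"
        by eventually_elim (use PD_plus_large_multiple in blast)
      then have "emeasure ?L (space ?L) = 0" by (simp add: AE_iff_null null_setsD1)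
      then show False using L.leb_nonzero by simp
    qed
    show "AE S in \<nu>. S \<in> PD \<beta>"
      unfolding \<nu>_def using mP by (subst AE_density) (auto simp: mL indicator_def)
    fix g :: "'n cmat" and f :: "'n cmat \<Rightarrow> ennreal"
    assume g: "g \<in> GLF \<beta>" and f[measurable]: "f \<in> borel_measurable borel"
    have "(\<integral>\<^sup>+S. f (mat_adj g ** S ** g) \<partial>\<nu>) = (\<integral>\<^sup>+S. (\<lambda>S. indicator (PD \<beta>) S * f S) (mat_adj g ** S ** g) \<partial>?L)"
      by (subst ni) (measurable, simp add: PD_congruence[OF g] indicator_def)
    also have "\<dots> = dpow g (- ?\<gamma>) * (\<integral>\<^sup>+S. indicator (PD \<beta>) S * f S \<partial>?L)"
      unfolding dpow_def using mP by (intro herm_lebesgue_congruence[OF \<beta> g]) measurable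
    finally show "(\<integral>\<^sup>+S. f (mat_adj g ** S ** g) \<partial>\<nu>) = dpow g (- ?\<gamma>) * (\<integral>\<^sup>+S. f S \<partial>\<nu>)" by (simp add: ni)
  qed blast
  then show ?thesis using that by (auto simp: ni)
qed

subsection \<open>The law of the corner\<close>

definition pdens :: "nat \<Rightarrow> real \<Rightarrow> complex^'n^'n \<Rightarrow> ennreal" where
  "pdens \<beta> r S = indicator (PD \<beta>) S * dpow S r"

lemma borel_measurable_pdens[measurable (raw)]:
  assumes A[measurable]: "A \<in> borel_measurable M"
  shows "(\<lambda>x. pdens \<beta> r (A x)) \<in> borel_measurable M"
proof -
  have "(\<lambda>x. indicator (PD \<beta>) (A x) :: ennreal) \<in> borel_measurable M"
    by (rule measurable_compose[OF A borel_measurable_indicator[OF borel_PD]])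
  then show ?thesis unfolding pdens_def by measurable
qed

lemma pdens_congruence: "g \<in> GLF \<beta> \<Longrightarrow> pdens \<beta> r (mat_adj g ** S ** g) = dpow g (2 * r) * pdens \<beta> r S"
  by (simp add: pdens_def dpow_congruence PD_congruence indicator_def ac_simps)

text \<open>Both sides are Haar integrals over \<open>g\<close> of \<open>f (mat_adj g ** g)\<close>
  with powers of \<open>det g\<close>, by \<open>gram_measure\<close> and
  \<open>herm_cone_measure\<close>. The exponents differ by \<open>2 * r\<close>, and a power
  \<open>r\<close> of the determinant of the Gram matrix makes up for it.\<close>

lemma wishart_density:
  fixes \<beta> :: nat
  assumes \<beta>: "\<beta> \<in> {1, 2}" and card: "CARD('k::finite) \<ge> CARD('n)"
    and r: "2 * r = real \<beta> * CARD('k) - (real \<beta> * (real CARD('n) - 1) + 2)"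
  obtains c :: real where "c > 0"
    "\<And>f :: 'n::{finite,linorder} cmat \<Rightarrow> ennreal. f \<in> borel_measurable borel \<Longrightarrow>
      (\<integral>\<^sup>+X. f (mat_adj X ** X) \<partial>(LM \<beta> :: ((complex, 'n) vec, 'k) vec measure)) =
      ennreal c * (\<integral>\<^sup>+S. pdens \<beta> r S * f S \<partial>herm_lebesgue \<beta>)"
proof -
  let ?\<gamma> = "real \<beta> * (real CARD('n) - 1) + 2"
  obtain c1 :: real where c1: "c1 > 0" "\<And>f :: 'n cmat \<Rightarrow> ennreal. f \<in> borel_measurable borel \<Longrightarrow>
      (\<integral>\<^sup>+X. f (mat_adj X ** X) \<partial>(LM \<beta> :: ((complex, 'n) vec, 'k) vec measure)) =
      ennreal c1 * (\<integral>\<^sup>+g. dpow g (real \<beta> * CARD('k)) * f (mat_adj g ** g) \<partial>HM \<beta>)"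
    using gram_measure[OF \<beta> card] by blast
  obtain c2 :: real where c2: "c2 > 0" "\<And>f :: 'n cmat \<Rightarrow> ennreal. f \<in> borel_measurable borel \<Longrightarrow>
      (\<integral>\<^sup>+S. indicator (PD \<beta>) S * f S \<partial>herm_lebesgue \<beta>) =
      ennreal c2 * (\<integral>\<^sup>+g. dpow g ?\<gamma> * f (mat_adj g ** g) \<partial>HM \<beta>)"
    using herm_cone_measure[OF \<beta>] by blast
  show ?thesis
  proof (rule that[of "c1 / c2"])
    show "c1 / c2 > 0" using c1 c2 by simp
    fix f :: "'n cmat \<Rightarrow> ennreal" assume f[measurable]: "f \<in> borel_measurable borel"
    let ?I = "\<integral>\<^sup>+g. dpow g (real \<beta> * CARD('k)) * f (mat_adj g ** g) \<partial>HM \<beta>"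
    have e: "real \<beta> * CARD('k) = ?\<gamma> + 2 * r" using r by simp
    have "(\<integral>\<^sup>+S. pdens \<beta> r S * f S \<partial>herm_lebesgue \<beta>) = (\<integral>\<^sup>+S. indicator (PD \<beta>) S * (dpow S r * f S) \<partial>herm_lebesgue \<beta>)"
      by (simp only: pdens_def mult.assoc)
    also have "\<dots> = ennreal c2 * (\<integral>\<^sup>+g. dpow g ?\<gamma> * (dpow (mat_adj g ** g) r * f (mat_adj g ** g)) \<partial>HM \<beta>)"
      by (rule c2(2)) measurable
    also have "\<dots> = ennreal c2 * ?I"
      unfolding e dpow_gram dpow_plus by (simp only: mult.assoc)
    finally have "ennreal (c1 / c2) * (\<integral>\<^sup>+S. pdens \<beta> r S * f S \<partial>herm_lebesgue \<beta>) = (ennreal (c1 / c2) * ennreal c2) * ?I"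
      by (simp only: mult.assoc)
    also have "ennreal (c1 / c2) * ennreal c2 = ennreal c1"
      using c1 c2 by (simp add: ennreal_mult[symmetric])
    finally show "(\<integral>\<^sup>+X. f (mat_adj X ** X) \<partial>(LM \<beta> :: ((complex, 'n) vec, 'k) vec measure)) =
        ennreal (c1 / c2) * (\<integral>\<^sup>+S. pdens \<beta> r S * f S \<partial>herm_lebesgue \<beta>)"
      using c1(2)[OF f] by simp
  qed
qed

definition stack :: "complex^'n^'m::finite \<Rightarrow> complex^'n^'k::finite \<Rightarrow> complex^'n^('m + 'k)" where
  "stack X Y = (\<chi> a. case a of Inl i \<Rightarrow> X $ i | Inr k \<Rightarrow> Y $ k)"

lemma stack_nth[simp]: "stack X Y $ Inl i = X $ i" "stack X Y $ Inr k = Y $ k"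
  by (simp_all add: stack_def)

lemma adj_emb_stack: "mat_adj emb ** stack X Y = X"
  by (simp add: vec_eq_iff adj_emb_mult)

lemma gram_stack: "mat_adj (stack X Y) ** stack X Y = mat_adj X ** X + mat_adj Y ** Y"
proof -
  have "(mat_adj (stack X Y) ** stack X Y) $ a $ b = (mat_adj X ** X + mat_adj Y ** Y) $ a $ b" for a b
  proof -
    have "(mat_adj (stack X Y) ** stack X Y) $ a $ b =
        (\<Sum>c\<in>range Inl \<union> range Inr. cnj (stack X Y $ c $ a) * stack X Y $ c $ b)"
      by (simp add: mat_adj_mult_nth UNIV_sum[symmetric])
    also have "\<dots> = (\<Sum>c\<in>range Inl. cnj (stack X Y $ c $ a) * stack X Y $ c $ b)
        + (\<Sum>c\<in>range Inr. cnj (stack X Y $ c $ a) * stack X Y $ c $ b)"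
      by (rule sum.union_disjoint) auto
    also have "\<dots> = (mat_adj X ** X + mat_adj Y ** Y) $ a $ b"
      by (simp add: sum.reindex mat_adj_mult_nth)
    finally show ?thesis .
  qed
  then show ?thesis by (simp add: vec_eq_iff)
qed

text \<open>Stacking is a linear bijection of subspaces, so the product of the block measures
  becomes a Lebesgue measure on the large space, where uniqueness applies.\<close>

lemma LM_stack:
  fixes \<beta> :: nat
  assumes \<beta>: "\<beta> \<in> {1, 2}"
  obtains c :: real where "c > 0"
    "\<And>F :: complex^'n^('m::finite + 'k::finite) \<Rightarrow> ennreal. F \<in> borel_measurable borel \<Longrightarrow>
      (\<integral>\<^sup>+X. F X \<partial>LM \<beta>) = ennreal c * (\<integral>\<^sup>+X. \<integral>\<^sup>+Y. F (stack X Y) \<partial>LM \<beta> \<partial>LM \<beta>)"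
proof -
  let ?L1 = "LM \<beta> :: (complex^'n^'m) measure" and ?L2 = "LM \<beta> :: (complex^'n^'k) measure"
  let ?\<phi> = "\<lambda>(X, Y). stack X Y :: complex^'n^('m + 'k)"
  let ?d = "real \<beta> * CARD('n) * CARD('m) + real \<beta> * CARD('n) * CARD('k)"
  interpret P: leb_on "VM \<beta> \<times> VM \<beta>" "?L1 \<Otimes>\<^sub>M ?L2" ?d
    by (intro leb_on_prod leb_LM \<beta>)
  have lin: "linear ?\<phi>"
    by (auto simp: linear_iff vec_eq_iff stack_def split: sum.splits)
  have m[measurable]: "?\<phi> \<in> ?L1 \<Otimes>\<^sub>M ?L2 \<rightarrow>\<^sub>M borel"
    using lin by (subst measurable_cong_sets[OF P.sets_leb refl])
      (intro borel_measurable_continuous_onI linear_continuous_on linear_linear[THEN iffD2])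
  have inj: "inj_on ?\<phi> (VM \<beta> \<times> VM \<beta>)"
  proof (rule inj_onI, clarify)
    fix X X' :: "complex^'n^'m" and Y Y' :: "complex^'n^'k"
    assume "stack X Y = stack X' Y'"
    then have "stack X Y $ Inl i = stack X' Y' $ Inl i" "stack X Y $ Inr k = stack X' Y' $ Inr k" for i k by simp_all
    then show "X = X' \<and> Y = Y'" by (simp add: vec_eq_iff)
  qed
  have im: "?\<phi> ` (VM \<beta> \<times> VM \<beta>) = VM \<beta>"
  proof
    show "?\<phi> ` (VM \<beta> \<times> VM \<beta>) \<subseteq> VM \<beta>"
      by (auto simp: VM_def real_matrix_def stack_def split: sum.splits)
    show "VM \<beta> \<subseteq> ?\<phi> ` (VM \<beta> \<times> VM \<beta>)"
    proof
      fix X :: "complex^'n^('m + 'k)" assume X: "X \<in> VM \<beta>"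
      have "X = ?\<phi> (\<chi> i. X $ Inl i, \<chi> k. X $ Inr k)"
        by (auto simp: vec_eq_iff stack_def split: sum.splits)
      moreover have "(\<chi> i. X $ Inl i) \<in> VM \<beta>" "(\<chi> k. X $ Inr k) \<in> VM \<beta>"
        using X by (auto simp: VM_def real_matrix_def)
      ultimately show "X \<in> ?\<phi> ` (VM \<beta> \<times> VM \<beta>)" by blast
    qed
  qed
  have I: "leb_on (VM \<beta>) (distr (?L1 \<Otimes>\<^sub>M ?L2) borel ?\<phi>) ?d" using P.image[OF lin inj] im by simp
  obtain c :: real where c: "c > 0" "\<And>F :: complex^'n^('m + 'k) \<Rightarrow> ennreal. F \<in> borel_measurable borel \<Longrightarrow>
      (\<integral>\<^sup>+X. F X \<partial>LM \<beta>) = ennreal c * (\<integral>\<^sup>+X. F X \<partial>distr (?L1 \<Otimes>\<^sub>M ?L2) borel ?\<phi>)"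
    using leb_on.unique[OF I leb_LM[OF \<beta>]] by blast
  show ?thesis
  proof (rule that[OF c(1)])
    fix F :: "complex^'n^('m + 'k) \<Rightarrow> ennreal" assume F[measurable]: "F \<in> borel_measurable borel"
    have "(\<integral>\<^sup>+X. F X \<partial>distr (?L1 \<Otimes>\<^sub>M ?L2) borel ?\<phi>) = (\<integral>\<^sup>+z. F (?\<phi> z) \<partial>(?L1 \<Otimes>\<^sub>M ?L2))"
      by (simp add: nn_integral_distr)
    also have "\<dots> = (\<integral>\<^sup>+X. \<integral>\<^sup>+Y. F (?\<phi> (X, Y)) \<partial>?L2 \<partial>?L1)"
      by (rule sigma_finite_measure.nn_integral_fst[OF sigma_finite_LM[OF \<beta>], symmetric]) measurable
    finally show "(\<integral>\<^sup>+X. F X \<partial>LM \<beta>) = ennreal c * (\<integral>\<^sup>+X. \<integral>\<^sup>+Y. F (stack X Y) \<partial>LM \<beta> \<partial>LM \<beta>)"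
      using c(2)[OF F] by simp
  qed
qed

text \<open>The matrix \<open>emb ** u\<close> is completed to a group element \<open>U\<close>, and
  then \<open>corner (Q ** U) = corner Q ** u\<close>. A block diagonal matrix with blocks
  \<open>u\<close> and 1 would not do for \<open>\<beta> = 1\<close>, as \<open>u\<close> may have
  determinant -1.\<close>

lemma corner_right_unitary:
  fixes M :: "(complex^('n::finite + 'k::finite)^('n + 'k)) measure"
  assumes \<beta>: "\<beta> \<in> {1, 2}" and haar: "haar_measure (haar_group \<beta>) M" and u: "u \<in> UF \<beta>"
    and f[measurable]: "f \<in> borel_measurable borel"
  shows "(\<integral>\<^sup>+Q. f (corner Q ** u) \<partial>M) = (\<integral>\<^sup>+Q. f (corner Q) \<partial>M)"
proof -
  interpret haar_measure "haar_group \<beta>" M by fact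
  let ?V = "emb ** u :: complex^'n^('n + 'k)"
  have "mat_adj ?V ** ?V = mat_adj u ** (mat_adj emb ** (emb :: complex^'n^('n + 'k))) ** u"
    by (simp only: mat_adj_mult matrix_mul_assoc)
  then have "mat_adj ?V ** ?V = mat 1" using u by (simp add: adj_emb_emb UF_def)
  moreover have "det (mat_adj emb ** ?V) \<noteq> 0"
    using UF_GLF[OF u] by (simp add: matrix_mul_assoc adj_emb_emb GLF_def)
  moreover have "?V \<in> VM \<beta>" using u by (intro VM_mult emb_VM) (simp add: UF_def)
  ultimately obtain U where U: "U \<in> haar_group \<beta>" "U ** emb = ?V"
    using frame_completion[OF \<beta>, of ?V] by blast
  have "corner Q ** u = corner (Q ** U)" for Q :: "complex^('n + 'k)^('n + 'k)"
    unfolding corner_eq using U(2) by (simp add: matrix_mul_assoc[symmetric])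
  moreover have "(\<lambda>Q. f (corner Q)) \<in> borel_measurable borel" unfolding corner_eq by measurable
  ultimately show ?thesis using right[OF U(1), of "\<lambda>Q. f (corner Q)"] by simp
qed

text \<open>A test function of the stacked matrix is integrated twice, once through
  \<open>frame_measure\<close> and once through the blocks. It must recover the corner from
  \<open>X\<close> alone; \<open>E\<close> applied to the Gram matrix serves as an inverse of
  \<open>g\<close> up to a unitary factor, and both laws are invariant under that factor.\<close>

lemma corner_density:
  fixes M :: "((complex, 'n::{finite,linorder} + 'k::finite) vec, 'n + 'k) vec measure"
  assumes \<beta>: "\<beta> \<in> {1, 2}" and card: "CARD('k) \<ge> CARD('n)" and haar: "haar_measure (haar_group \<beta>) M"
    and r: "2 * r = real \<beta> * CARD('k) - (real \<beta> * (real CARD('n) - 1) + 2)"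
  obtains c :: real where "c > 0"
    "\<And>\<phi> :: 'n cmat \<Rightarrow> ennreal. \<phi> \<in> borel_measurable borel \<Longrightarrow>
      (\<integral>\<^sup>+Q. \<phi> (corner Q) \<partial>M) = ennreal c * (\<integral>\<^sup>+A. pdens \<beta> r (mat 1 - mat_adj A ** A) * \<phi> A \<partial>LM \<beta>)"
proof -
  interpret haar_measure "haar_group \<beta>" M by fact
  let ?\<gamma> = "real \<beta> * (real CARD('n) - 1) + 2" and ?b = "real \<beta> * CARD('n)"
  let ?t = "real \<beta> * CARD('n + 'k)"
  let ?H = "HM \<beta> :: 'n cmat measure" and ?L = "LM \<beta> :: 'n cmat measure" and ?S = "herm_lebesgue \<beta> :: 'n cmat measure"
  interpret S: leb_on "Herm \<beta>" ?S "real (card (herm_param_index \<beta> :: ('n \<times> 'n) set))"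
    using \<beta> by (rule leb_herm_lebesgue)
  \<comment> \<open>The powers of \<open>cmod (det g)\<close> come from the measure of
    \<open>S\<close>, the substitution \<open>X = A ** g\<close>, the density of the second block,
    and the weight in \<open>D\<close>. They cancel because the number of rows is
    \<open>CARD('n) + CARD('k)\<close>.\<close>
  have sums: "?\<gamma> + (?b + (2 * r + - ?t)) = 0" using r by (simp add: algebra_simps)
  obtain c1 :: real where c1: "c1 > 0" "\<And>F :: ((complex, 'n) vec, 'n + 'k) vec \<Rightarrow> ennreal. F \<in> borel_measurable borel \<Longrightarrow>
      (\<integral>\<^sup>+X. F X \<partial>LM \<beta>) = ennreal c1 * (\<integral>\<^sup>+Q. \<integral>\<^sup>+g. dpow g ?t * F (Q ** emb ** g) \<partial>?H \<partial>M)"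
    using frame_measure[OF \<beta> haar] by blast
  obtain c2 :: real where c2: "c2 > 0" "\<And>F :: ((complex, 'n) vec, 'n + 'k) vec \<Rightarrow> ennreal. F \<in> borel_measurable borel \<Longrightarrow>
      (\<integral>\<^sup>+X. F X \<partial>LM \<beta>) = ennreal c2 * (\<integral>\<^sup>+X. \<integral>\<^sup>+Y. F (stack X Y) \<partial>LM \<beta> \<partial>LM \<beta>)"
    using LM_stack[OF \<beta>] by blast
  obtain c3 :: real where c3: "c3 > 0" "\<And>f :: 'n cmat \<Rightarrow> ennreal. f \<in> borel_measurable borel \<Longrightarrow>
      (\<integral>\<^sup>+X. f (mat_adj X ** X) \<partial>(LM \<beta> :: ((complex, 'n) vec, 'k) vec measure)) = ennreal c3 * (\<integral>\<^sup>+S. pdens \<beta> r S * f S \<partial>?S)"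
    using wishart_density[OF \<beta> card r] by blast
  obtain c4 :: real where c4: "c4 > 0" "\<And>f :: 'n cmat \<Rightarrow> ennreal. f \<in> borel_measurable borel \<Longrightarrow>
      (\<integral>\<^sup>+S. indicator (PD \<beta>) S * f S \<partial>?S) = ennreal c4 * (\<integral>\<^sup>+g. dpow g ?\<gamma> * f (mat_adj g ** g) \<partial>?H)"
    using herm_cone_measure[OF \<beta>] by blast
  obtain B :: "'n cmat set" where B: "B \<in> sets borel" "0 < (\<integral>\<^sup>+g. indicator B (mat_adj g ** g) \<partial>?H)"
    "(\<integral>\<^sup>+g. indicator B (mat_adj g ** g) \<partial>?H) < \<infinity>"
    using HM_gram_pos_finite_set[OF \<beta>] by blast
  have [measurable]: "B \<in> sets borel" by (rule B)
  let ?\<kappa> = "\<integral>\<^sup>+g. indicator B (mat_adj g ** g) \<partial>?H"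
  obtain E :: "'n cmat \<Rightarrow> 'n cmat" where E[measurable]: "E \<in> borel \<rightarrow>\<^sub>M borel"
    and elem: "\<And>S. S \<in> PD \<beta> \<Longrightarrow> elem \<beta> (E S)" and ESE: "\<And>S. S \<in> PD \<beta> \<Longrightarrow> mat_adj (E S) ** S ** E S = mat 1"
    using orthonormalizer[of \<beta>] by blast
  have unitary: "g ** E (mat_adj g ** g) \<in> UF \<beta>" if g: "g \<in> GLF \<beta>" for g
  proof -
    let ?S = "mat_adj g ** g"
    have S: "?S \<in> PD \<beta>" by (rule PD_gram[OF g])
    have "mat_adj (g ** E ?S) ** (g ** E ?S) = mat_adj (E ?S) ** ?S ** E ?S"
      by (simp only: mat_adj_mult matrix_mul_assoc)
    then show ?thesis using ESE[OF S] GLF_mult[OF g elem_GLF[OF elem[OF S]]] by (auto simp: UF_def GLF_def)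
  qed
  have main: "ennreal c1 * (?\<kappa> * (\<integral>\<^sup>+Q. \<phi> (corner Q) \<partial>M)) =
      ennreal (c2 * c3 * c4) * (?\<kappa> * (\<integral>\<^sup>+A. pdens \<beta> r (mat 1 - mat_adj A ** A) * \<phi> A \<partial>?L))"
    if \<phi>[measurable]: "\<phi> \<in> borel_measurable borel" for \<phi> :: "'n cmat \<Rightarrow> ennreal"
  proof -
    define F where "F X S = \<phi> (X ** E S) * indicator B S" for X S
    have F[measurable (raw)]: "(\<lambda>x. F (u x) (v x)) \<in> borel_measurable N"
      if [measurable]: "u \<in> borel_measurable N" "v \<in> borel_measurable N" for u v and N :: "'z measure"
    proof -
      have "(\<lambda>x. indicator B (v x) :: ennreal) \<in> borel_measurable N"
        by (rule measurable_compose[OF that(2) borel_measurable_indicator[OF B(1)]])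
      then show ?thesis unfolding F_def by measurable
    qed
    \<comment> \<open>The power of the Gram determinant cancels the weight of
      \<open>frame_measure\<close>, and the cutoff \<open>B\<close> inside \<open>F\<close> makes
      the integral over the infinite Haar measure a finite positive factor
      \<open>?\<kappa>\<close>.\<close>
    define D where "D X = dpow (mat_adj X ** X) (- ?t / 2) * F (mat_adj emb ** X) (mat_adj X ** X)"
      for X :: "((complex, 'n) vec, 'n + 'k) vec"
    have D[measurable]: "D \<in> borel_measurable borel" unfolding D_def by measurable
    have e: "2 * (- ?t / 2) = - ?t" by simp
    have "(\<integral>\<^sup>+X. D X \<partial>LM \<beta>) = ennreal c1 * (\<integral>\<^sup>+Q. \<integral>\<^sup>+g. dpow g ?t * D (Q ** emb ** g) \<partial>?H \<partial>M)"
      by (rule c1(2)) measurable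
    also have "(\<integral>\<^sup>+Q. \<integral>\<^sup>+g. dpow g ?t * D (Q ** emb ** g) \<partial>?H \<partial>M)
        = (\<integral>\<^sup>+Q. \<integral>\<^sup>+g. \<phi> (corner Q ** (g ** E (mat_adj g ** g))) * indicator B (mat_adj g ** g) \<partial>?H \<partial>M)"
    proof (rule nn_integral_cong_AE)
      show "AE Q in M. (\<integral>\<^sup>+g. dpow g ?t * D (Q ** emb ** g) \<partial>?H) =
          (\<integral>\<^sup>+g. \<phi> (corner Q ** (g ** E (mat_adj g ** g))) * indicator B (mat_adj g ** g) \<partial>?H)"
        using AE_G
      proof eventually_elim
        case (elim Q)
        have gram: "mat_adj (Q ** emb ** g) ** (Q ** emb ** g) = mat_adj g ** g" for g :: "'n cmat"
        proof -
          have "mat_adj (Q ** emb ** g) ** (Q ** emb ** g) = mat_adj g ** (mat_adj emb ** (mat_adj Q ** Q) ** emb) ** g"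
            by (simp only: mat_adj_mult matrix_mul_assoc)
          then show ?thesis using unitary_G'[OF elim] by (simp add: adj_emb_emb)
        qed
        show ?case
        proof (rule nn_integral_cong_AE)
          show "AE g in ?H. dpow g ?t * D (Q ** emb ** g) = \<phi> (corner Q ** (g ** E (mat_adj g ** g))) * indicator B (mat_adj g ** g)"
            using AE_HM_GLF[OF \<beta>]
          proof eventually_elim
            case (elim g)
            then have d: "det g \<noteq> 0" by (simp add: GLF_def)
            have "dpow g ?t * D (Q ** emb ** g) = F (mat_adj emb ** (Q ** emb ** g)) (mat_adj g ** g)"
              unfolding D_def gram unfolding dpow_gram e using d by (simp only: dpow_cancel(1) not_False_eq_True)
            then show ?case by (simp add: F_def corner_eq matrix_mul_assoc)
          qed
        qed
      qed
    qed
    also have "\<dots> = (\<integral>\<^sup>+g. \<integral>\<^sup>+Q. \<phi> (corner Q ** (g ** E (mat_adj g ** g))) * indicator B (mat_adj g ** g) \<partial>M \<partial>?H)"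
    proof (rule nn_integral_swap_borel)
      show "(\<lambda>(Q, g). \<phi> (corner Q ** (g ** E (mat_adj g ** g))) * indicator B (mat_adj g ** g)) \<in> borel_measurable borel"
        unfolding borel_prod[symmetric] corner_eq by measurable
    qed (simp_all add: sigma_finite_M sets_M sigma_finite_HM[OF \<beta>] sets_HM)
    also have "\<dots> = (\<integral>\<^sup>+g. indicator B (mat_adj g ** g) * (\<integral>\<^sup>+Q. \<phi> (corner Q) \<partial>M) \<partial>?H)"
    proof (rule nn_integral_cong_AE)
      show "AE g in ?H. (\<integral>\<^sup>+Q. \<phi> (corner Q ** (g ** E (mat_adj g ** g))) * indicator B (mat_adj g ** g) \<partial>M)
          = indicator B (mat_adj g ** g) * (\<integral>\<^sup>+Q. \<phi> (corner Q) \<partial>M)"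
        using AE_HM_GLF[OF \<beta>]
      proof eventually_elim
        case (elim g)
        have "(\<lambda>Q. \<phi> (corner Q ** (g ** E (mat_adj g ** g)))) \<in> borel_measurable M"
          unfolding corner_eq by measurable
        from nn_integral_multc[OF this, of "indicator B (mat_adj g ** g)"]
          corner_right_unitary[OF \<beta> haar unitary[OF elim] \<phi>]
        show ?case by (simp only: mult.commute)
      qed
    qed
    also have "\<dots> = ?\<kappa> * (\<integral>\<^sup>+Q. \<phi> (corner Q) \<partial>M)"
      by (rule nn_integral_multc) (simp add: measurable_HM)
    finally have lhs: "(\<integral>\<^sup>+X. D X \<partial>LM \<beta>) = ennreal c1 * (?\<kappa> * (\<integral>\<^sup>+Q. \<phi> (corner Q) \<partial>M))" .
    \<comment> \<open>The integrand in terms of the top block \<open>X\<close> and the full Gram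
      matrix \<open>S\<close>: the difference \<open>S - mat_adj X ** X\<close> is the Gram matrix
      of the lower block.\<close>
    define K where "K X S = pdens \<beta> r (S - mat_adj X ** X) * (dpow S (- ?t / 2) * F X S)" for X S
    have K[measurable (raw)]: "(\<lambda>x. K (u x) (v x)) \<in> borel_measurable N"
      if [measurable]: "u \<in> borel_measurable N" "v \<in> borel_measurable N" for u v and N :: "'z measure"
      unfolding K_def by measurable
    have "(\<integral>\<^sup>+X. D X \<partial>LM \<beta>) = ennreal c2 * (\<integral>\<^sup>+X. \<integral>\<^sup>+Y. D (stack X Y) \<partial>(LM \<beta> :: ((complex, 'n) vec, 'k) vec measure) \<partial>?L)"
      by (rule c2(2)) measurable
    also have "(\<integral>\<^sup>+X. \<integral>\<^sup>+Y. D (stack X Y) \<partial>(LM \<beta> :: ((complex, 'n) vec, 'k) vec measure) \<partial>?L) = (\<integral>\<^sup>+X. ennreal c3 * (\<integral>\<^sup>+S. K X S \<partial>?S) \<partial>?L)"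
    proof (rule nn_integral_cong_AE)
      have "AE X in ?L. X \<in> VM \<beta>" by (rule leb_on.AE_leb[OF leb_LM[OF \<beta>]])
      then show "AE X in ?L. (\<integral>\<^sup>+Y. D (stack X Y) \<partial>(LM \<beta> :: ((complex, 'n) vec, 'k) vec measure)) = ennreal c3 * (\<integral>\<^sup>+S. K X S \<partial>?S)"
      proof eventually_elim
        case (elim X)
        let ?f = "\<lambda>W. dpow (W + mat_adj X ** X) (- ?t / 2) * F X (W + mat_adj X ** X)"
        have "(\<integral>\<^sup>+Y. D (stack X Y) \<partial>(LM \<beta> :: ((complex, 'n) vec, 'k) vec measure)) = (\<integral>\<^sup>+Y. ?f (mat_adj Y ** Y) \<partial>(LM \<beta> :: ((complex, 'n) vec, 'k) vec measure))"
          unfolding D_def gram_stack adj_emb_stack by (simp add: add.commute)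
        also have "\<dots> = ennreal c3 * (\<integral>\<^sup>+S. pdens \<beta> r S * ?f S \<partial>?S)"
          by (rule c3(2)) measurable
        also have "(\<integral>\<^sup>+S. pdens \<beta> r S * ?f S \<partial>?S) = (\<integral>\<^sup>+S. K X (S + mat_adj X ** X) \<partial>?S)"
          by (simp add: K_def)
        also have "\<dots> = (\<integral>\<^sup>+S. K X S \<partial>?S)"
          by (rule S.leb_translate[OF Herm_gram[OF elim]]) measurable
        finally show ?case .
      qed
    qed
    also have "\<dots> = ennreal c3 * (\<integral>\<^sup>+X. \<integral>\<^sup>+S. K X S \<partial>?S \<partial>?L)"
    proof (rule nn_integral_cmult)
      have "(\<lambda>X. \<integral>\<^sup>+S. K X S \<partial>?S) \<in> borel_measurable borel"
        by (rule borel_measurable_nn_integral_param[OF S.sigma_finite_leb S.sets_leb])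
          (unfold borel_prod[symmetric], measurable)
      then show "(\<lambda>X. \<integral>\<^sup>+S. K X S \<partial>?S) \<in> borel_measurable ?L" by (simp add: measurable_LM)
    qed
    also have "(\<integral>\<^sup>+X. \<integral>\<^sup>+S. K X S \<partial>?S \<partial>?L) = (\<integral>\<^sup>+S. \<integral>\<^sup>+X. K X S \<partial>?L \<partial>?S)"
    proof (rule nn_integral_swap_borel)
      show "(\<lambda>(X, S). K X S) \<in> borel_measurable borel" unfolding borel_prod[symmetric] by measurable
    qed (simp_all add: sigma_finite_LM[OF \<beta>] sets_LM S.sigma_finite_leb S.sets_leb)
    \<comment> \<open>If \<open>S\<close> is not in the cone, neither is \<open>S\<close> minus a
      Gram matrix, so restricting to the cone loses nothing and allows the passage to
      \<open>g\<close>.\<close>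
    also have "\<dots> = (\<integral>\<^sup>+S. indicator (PD \<beta>) S * (\<integral>\<^sup>+X. K X S \<partial>?L) \<partial>?S)"
    proof (rule nn_integral_cong)
      fix S
      show "(\<integral>\<^sup>+X. K X S \<partial>?L) = indicator (PD \<beta>) S * (\<integral>\<^sup>+X. K X S \<partial>?L)"
      proof (cases "S \<in> PD \<beta>")
        case False
        have "AE X in ?L. X \<in> VM \<beta>" by (rule leb_on.AE_leb[OF leb_LM[OF \<beta>]])
        then have "AE X in ?L. K X S = 0"
        proof eventually_elim
          case (elim X)
          have "S - mat_adj X ** X \<notin> PD \<beta>"
          proof
            assume "S - mat_adj X ** X \<in> PD \<beta>"
            from PD_add_nonneg[OF this Herm_gram[OF elim]] have "S \<in> PD \<beta>"
              by (simp add: herm_form_gram)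
            then show False using False by simp
          qed
          then show ?case by (simp add: K_def pdens_def)
        qed
        then have "(\<integral>\<^sup>+X. K X S \<partial>?L) = (\<integral>\<^sup>+X. 0 \<partial>?L)" by (rule nn_integral_cong_AE)
        then show ?thesis by simp
      qed simp
    qed
    also have "\<dots> = ennreal c4 * (\<integral>\<^sup>+g. dpow g ?\<gamma> * (\<integral>\<^sup>+X. K X (mat_adj g ** g) \<partial>?L) \<partial>?H)"
    proof (rule c4(2))
      show "(\<lambda>S. \<integral>\<^sup>+X. K X S \<partial>?L) \<in> borel_measurable borel"
        by (rule borel_measurable_nn_integral_param[OF sigma_finite_LM[OF \<beta>] sets_LM])
          (unfold borel_prod[symmetric], measurable)
    qed
    also have "(\<integral>\<^sup>+g. dpow g ?\<gamma> * (\<integral>\<^sup>+X. K X (mat_adj g ** g) \<partial>?L) \<partial>?H)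
        = (\<integral>\<^sup>+g. indicator B (mat_adj g ** g) * (\<integral>\<^sup>+A. pdens \<beta> r (mat 1 - mat_adj A ** A) * \<phi> A \<partial>?L) \<partial>?H)"
    proof (rule nn_integral_cong_AE)
      show "AE g in ?H. dpow g ?\<gamma> * (\<integral>\<^sup>+X. K X (mat_adj g ** g) \<partial>?L) =
          indicator B (mat_adj g ** g) * (\<integral>\<^sup>+A. pdens \<beta> r (mat 1 - mat_adj A ** A) * \<phi> A \<partial>?L)"
        using AE_HM_GLF[OF \<beta>]
      proof eventually_elim
        case (elim g)
        then have d: "det g \<noteq> 0" by (simp add: GLF_def)
        \<comment> \<open>After the substitution \<open>X = A ** g\<close> the argument of
          \<open>\<phi>\<close> is \<open>A ** ?u\<close>, while \<open>g\<close> otherwise enters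
          only through determinants and the cutoff.\<close>
        let ?u = "g ** E (mat_adj g ** g)"
        let ?p = "\<lambda>A::'n cmat. pdens \<beta> r (mat 1 - mat_adj A ** A)"
        have u: "?u \<in> UF \<beta>" by (rule unitary[OF elim])
        have "(\<integral>\<^sup>+A. K (A ** g) (mat_adj g ** g) \<partial>?L) = dpow g (- ?b) * (\<integral>\<^sup>+X. K X (mat_adj g ** g) \<partial>?L)"
          unfolding dpow_def by (rule LM_right[OF \<beta> elim, of "\<lambda>X. K X (mat_adj g ** g)"]) measurable
        then have "(\<integral>\<^sup>+X. K X (mat_adj g ** g) \<partial>?L) = dpow g ?b * (\<integral>\<^sup>+A. K (A ** g) (mat_adj g ** g) \<partial>?L)"
          using dpow_cancel(1)[OF d] by simp
        also have "(\<integral>\<^sup>+A. K (A ** g) (mat_adj g ** g) \<partial>?L) =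
            (\<integral>\<^sup>+A. (dpow g (2 * r) * dpow g (- ?t)) * (indicator B (mat_adj g ** g) * (?p A * \<phi> (A ** ?u))) \<partial>?L)"
        proof (rule nn_integral_cong)
          fix A :: "'n cmat"
          have "mat_adj g ** g - mat_adj (A ** g) ** (A ** g) = mat_adj g ** (mat 1 - mat_adj A ** A) ** g"
            by (simp add: mat_adj_mult matrix_mul_assoc matrix_mult_diff_ldistrib matrix_mult_diff_rdistrib)
          then have "K (A ** g) (mat_adj g ** g) = (dpow g (2 * r) * ?p A) * (dpow g (- ?t) * (\<phi> (A ** g ** E (mat_adj g ** g)) * indicator B (mat_adj g ** g)))"
            unfolding K_def F_def dpow_gram e by (simp only: pdens_congruence[OF elim])
          also have "A ** g ** E (mat_adj g ** g) = A ** ?u" by (simp only: matrix_mul_assoc)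
          finally show "K (A ** g) (mat_adj g ** g) = (dpow g (2 * r) * dpow g (- ?t)) * (indicator B (mat_adj g ** g) * (?p A * \<phi> (A ** ?u)))"
            by (simp only: ac_simps)
        qed
        also have "\<dots> = (dpow g (2 * r) * dpow g (- ?t)) * (indicator B (mat_adj g ** g) * (\<integral>\<^sup>+A. ?p A * \<phi> (A ** ?u) \<partial>?L))"
          by (subst nn_integral_cmult, simp add: measurable_LM, subst nn_integral_cmult) (simp_all add: measurable_LM)
        also have "(\<integral>\<^sup>+A. ?p A * \<phi> (A ** ?u) \<partial>?L) = (\<integral>\<^sup>+A. ?p A * \<phi> A \<partial>?L)"
        proof -
          \<comment> \<open>The density of \<open>A\<close> is constant along right multiplication
            by unitary matrices, so \<open>?u\<close> can be integrated away.\<close>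
          have "?p (A ** ?u) = ?p A" for A
          proof -
            have "mat 1 - mat_adj (A ** ?u) ** (A ** ?u) = mat_adj ?u ** ?u - mat_adj (A ** ?u) ** (A ** ?u)"
              using u by (simp add: UF_def)
            also have "\<dots> = mat_adj ?u ** (mat 1 - mat_adj A ** A) ** ?u"
              by (simp add: mat_adj_mult matrix_mul_assoc matrix_mult_diff_ldistrib matrix_mult_diff_rdistrib)
            finally show ?thesis using pdens_congruence[OF UF_GLF[OF u], of r] by (simp add: dpow_UF[OF u])
          qed
          then have "(\<integral>\<^sup>+A. ?p A * \<phi> (A ** ?u) \<partial>?L) = (\<integral>\<^sup>+A. (\<lambda>A. ?p A * \<phi> A) (A ** ?u) \<partial>?L)" by simp
          also have "\<dots> = dpow ?u (- ?b) * (\<integral>\<^sup>+A. ?p A * \<phi> A \<partial>?L)"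
            unfolding dpow_def by (rule LM_right[OF \<beta> UF_GLF[OF u]]) measurable
          finally show ?thesis by (simp add: dpow_UF[OF u])
        qed
        finally have "dpow g ?\<gamma> * (\<integral>\<^sup>+X. K X (mat_adj g ** g) \<partial>?L) =
            (dpow g ?\<gamma> * (dpow g ?b * (dpow g (2 * r) * dpow g (- ?t)))) *
            (indicator B (mat_adj g ** g) * (\<integral>\<^sup>+A. ?p A * \<phi> A \<partial>?L))"
          by (simp only: mult.assoc)
        also have "dpow g ?\<gamma> * (dpow g ?b * (dpow g (2 * r) * dpow g (- ?t))) = 1"
          unfolding dpow_plus[symmetric] sums using d by (rule dpow_0)
        finally show ?case by simp
      qed
    qed
    also have "\<dots> = ?\<kappa> * (\<integral>\<^sup>+A. pdens \<beta> r (mat 1 - mat_adj A ** A) * \<phi> A \<partial>?L)"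
      by (rule nn_integral_multc) (simp add: measurable_HM)
    finally have "(\<integral>\<^sup>+X. D X \<partial>LM \<beta>) = ennreal c2 * (ennreal c3 * (ennreal c4 * (?\<kappa> *
        (\<integral>\<^sup>+A. pdens \<beta> r (mat 1 - mat_adj A ** A) * \<phi> A \<partial>?L))))" .
    also have "\<dots> = ennreal (c2 * c3 * c4) * (?\<kappa> * (\<integral>\<^sup>+A. pdens \<beta> r (mat 1 - mat_adj A ** A) * \<phi> A \<partial>?L))"
      using c2(1) c3(1) c4(1) by (simp add: ennreal_mult mult.assoc)
    finally show ?thesis using lhs by simp
  qed
  show ?thesis
  proof (rule that[of "c2 * c3 * c4 / c1"])
    show "c2 * c3 * c4 / c1 > 0" using c1 c2 c3 c4 by simp
    fix \<phi> :: "'n cmat \<Rightarrow> ennreal" assume \<phi>: "\<phi> \<in> borel_measurable borel"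
    let ?I = "\<integral>\<^sup>+A. pdens \<beta> r (mat 1 - mat_adj A ** A) * \<phi> A \<partial>?L"
    have "?\<kappa> * (\<integral>\<^sup>+Q. \<phi> (corner Q) \<partial>M) = (ennreal (1 / c1) * ennreal c1) * (?\<kappa> * (\<integral>\<^sup>+Q. \<phi> (corner Q) \<partial>M))"
      using c1(1) by (simp add: ennreal_mult[symmetric])
    also have "\<dots> = ennreal (1 / c1) * (ennreal (c2 * c3 * c4) * (?\<kappa> * ?I))"
      unfolding main[OF \<phi>, symmetric] by (simp only: mult.assoc)
    also have "\<dots> = ?\<kappa> * (ennreal (c2 * c3 * c4 / c1) * ?I)"
    proof -
      have "ennreal (1 / c1) * ennreal (c2 * c3 * c4) = ennreal (c2 * c3 * c4 / c1)"
        using c1(1) c2(1) c3(1) c4(1) by (simp add: ennreal_mult[symmetric])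
      moreover have "ennreal (1 / c1) * (ennreal (c2 * c3 * c4) * (?\<kappa> * ?I)) = ?\<kappa> * ((ennreal (1 / c1) * ennreal (c2 * c3 * c4)) * ?I)"
        by (simp only: ac_simps)
      ultimately show ?thesis by simp
    qed
    finally show "(\<integral>\<^sup>+Q. \<phi> (corner Q) \<partial>M) = ennreal (c2 * c3 * c4 / c1) * ?I"
      using B(2,3) by (subst (asm) ennreal_mult_cancel_left) auto
  qed
qed

subsection \<open>Splitting off the skew-Hermitian part\<close>

lemma LM_congruence:
  fixes g :: "complex^'n^'n"
  assumes \<beta>: "\<beta> \<in> {1, 2}" and g: "g \<in> GLF \<beta>" and f[measurable]: "f \<in> borel_measurable borel"
  shows "(\<integral>\<^sup>+B. f (mat_adj g ** B ** g) \<partial>LM \<beta>) = dpow g (- (2 * (real \<beta> * CARD('n)))) * (\<integral>\<^sup>+B. f B \<partial>LM \<beta>)"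
proof -
  let ?b = "real \<beta> * CARD('n)"
  have "(\<integral>\<^sup>+B. f (mat_adj g ** B ** g) \<partial>LM \<beta>) = dpow (mat_adj g) (- ?b) * (\<integral>\<^sup>+B. f (B ** g) \<partial>LM \<beta>)"
    unfolding dpow_def by (rule LM_left[OF \<beta> GLF_adj[OF g], of "\<lambda>B. f (B ** g)"]) measurable
  also have "(\<integral>\<^sup>+B. f (B ** g) \<partial>LM \<beta>) = dpow g (- ?b) * (\<integral>\<^sup>+B. f B \<partial>LM \<beta>)"
    unfolding dpow_def by (rule LM_right[OF \<beta> g f])
  finally show ?thesis
    using dpow_plus[of g "- ?b" "- ?b"] by (simp add: dpow_adj mult.assoc)
qed

lemma LM_adj:
  fixes f :: "complex^'n^'n \<Rightarrow> ennreal"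
  assumes \<beta>: "\<beta> \<in> {1, 2}" and f[measurable]: "f \<in> borel_measurable borel"
  shows "(\<integral>\<^sup>+B. f (mat_adj B) \<partial>LM \<beta>) = (\<integral>\<^sup>+B. f B \<partial>LM \<beta>)"
proof (rule leb_on.isometry_change[OF leb_LM[OF \<beta>] linear_mat_adj _ norm_mat_adj f])
  show "mat_adj ` VM \<beta> = (VM \<beta> :: (complex^'n^'n) set)"
    using VM_adj by (force simp: image_iff intro: mat_adj_mat_adj[symmetric])
qed

lemma HM_adj:
  fixes f :: "complex^'n^'n \<Rightarrow> ennreal"
  assumes \<beta>: "\<beta> \<in> {1, 2}" and f[measurable]: "f \<in> borel_measurable borel"
  shows "(\<integral>\<^sup>+g. f (mat_adj g) \<partial>HM \<beta>) = (\<integral>\<^sup>+g. f g \<partial>HM \<beta>)"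
proof -
  let ?b = "real \<beta> * CARD('n)"
  have "(\<integral>\<^sup>+g. f (mat_adj g) \<partial>HM \<beta>) = (\<integral>\<^sup>+g. (\<lambda>g. dpow g (- ?b) * f g) (mat_adj g) \<partial>LM \<beta>)"
    by (subst nn_integral_HM) (simp_all add: dpow_adj)
  also have "\<dots> = (\<integral>\<^sup>+g. dpow g (- ?b) * f g \<partial>LM \<beta>)"
    by (rule LM_adj[OF \<beta>]) measurable
  finally show ?thesis by (simp add: nn_integral_HM)
qed

lemma Herm_sym: "B \<in> VM \<beta> \<Longrightarrow> B + mat_adj B \<in> Herm \<beta>"
  by (simp add: Herm_def VM_add VM_adj mat_adj_add add.commute)

text \<open>Separates Hermitian and skew-Hermitian part without a Lebesgue measure on skew-Hermitian
  matrices: integrating over all \<open>B\<close> with a factor \<open>\<psi>\<close> of the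
  Hermitian part takes its place. The right side is transformed by moving \<open>S\<close> by
  \<open>B + mat_adj B\<close>, then moving \<open>B\<close> by half of \<open>S\<close>;
  \<open>S\<close> remains only inside \<open>\<psi>\<close> and is integrated out.\<close>

lemma LM_herm_skew_swap:
  fixes \<psi> :: "'n::{finite,linorder} cmat \<Rightarrow> ennreal"
  assumes \<beta>: "\<beta> \<in> {1, 2}" and \<psi>[measurable]: "\<psi> \<in> borel_measurable borel"
    and F: "\<And>u v. u \<in> borel \<rightarrow>\<^sub>M borel \<Longrightarrow> v \<in> borel \<rightarrow>\<^sub>M borel \<Longrightarrow>
      (\<lambda>x :: 'n cmat \<times> 'n cmat. F (u x) (v x)) \<in> borel_measurable borel"
  shows "(\<integral>\<^sup>+S. \<psi> S \<partial>herm_lebesgue \<beta>) * (\<integral>\<^sup>+B. F (B + mat_adj B) (B - mat_adj B) \<partial>LM \<beta>) =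
    (\<integral>\<^sup>+S. \<integral>\<^sup>+B. \<psi> (B + mat_adj B) * F S (B - mat_adj B) \<partial>LM \<beta> \<partial>herm_lebesgue \<beta>)"
proof -
  let ?L = "LM \<beta> :: 'n cmat measure" and ?S = "herm_lebesgue \<beta> :: 'n cmat measure"
  interpret S: leb_on "Herm \<beta>" ?S "real (card (herm_param_index \<beta> :: ('n \<times> 'n) set))"
    using \<beta> by (rule leb_herm_lebesgue)
  interpret L: leb_on "VM \<beta>" ?L "real \<beta> * CARD('n) * CARD('n)" using \<beta> by (rule leb_LM)
  note sf = S.sigma_finite_leb S.sets_leb L.sigma_finite_leb L.sets_leb
  have c1: "(\<lambda>x::'n cmat \<times> 'n cmat. fst x) \<in> borel \<rightarrow>\<^sub>M borel" "(\<lambda>x::'n cmat \<times> 'n cmat. snd x) \<in> borel \<rightarrow>\<^sub>M borel"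
    by (intro borel_measurable_continuous_onI continuous_intros)+
  note [measurable] = c1
  have ap: "(\<lambda>y. G x y) \<in> borel_measurable borel" if "(\<lambda>(x, y). G x y) \<in> borel_measurable borel"
    for G :: "'n cmat \<Rightarrow> 'n cmat \<Rightarrow> ennreal" and x
  proof -
    have "(\<lambda>y. (x, y)) \<in> borel \<rightarrow>\<^sub>M (borel :: ('n cmat \<times> 'n cmat) measure)"
      by (intro borel_measurable_continuous_onI continuous_intros)
    from measurable_compose[OF this that] show ?thesis by simp
  qed
  have F1: "(\<lambda>(S, B). \<psi> (u (S, B)) * F (v (S, B)) (w (S, B))) \<in> borel_measurable borel"
    if u: "u \<in> borel \<rightarrow>\<^sub>M borel" and "v \<in> borel \<rightarrow>\<^sub>M borel" "w \<in> borel \<rightarrow>\<^sub>M borel" for u v w :: "'n cmat \<times> 'n cmat \<Rightarrow> 'n cmat"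
    using measurable_compose[OF u \<psi>] F[OF that(2,3)] by simp
  have m1: "(\<lambda>(S, B). \<psi> (B + mat_adj B) * F S (B - mat_adj B)) \<in> borel_measurable borel"
    using F1[of "\<lambda>(S, B). B + mat_adj B" "\<lambda>(S, B). S" "\<lambda>(S, B). B - mat_adj B"] by (simp add: case_prod_beta')
  have m2: "(\<lambda>(S, B). \<psi> (B + mat_adj B) * F (S + (B + mat_adj B)) (B - mat_adj B)) \<in> borel_measurable borel"
    using F1[of "\<lambda>(S, B). B + mat_adj B" "\<lambda>(S, B). S + (B + mat_adj B)" "\<lambda>(S, B). B - mat_adj B"] by (simp add: case_prod_beta')
  have m3: "(\<lambda>(S, B). \<psi> (B + mat_adj B - S) * F (B + mat_adj B) (B - mat_adj B)) \<in> borel_measurable borel"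
    using F1[of "\<lambda>(S, B). B + mat_adj B - S" "\<lambda>(S, B). B + mat_adj B" "\<lambda>(S, B). B - mat_adj B"] by (simp add: case_prod_beta')
  have swap: "(\<lambda>(B, S). G S B) \<in> borel_measurable borel" if "(\<lambda>(S, B). G S B) \<in> borel_measurable borel" for G :: "'n cmat \<Rightarrow> 'n cmat \<Rightarrow> ennreal"
  proof -
    have "(\<lambda>z::'n cmat \<times> 'n cmat. (snd z, fst z)) \<in> borel \<rightarrow>\<^sub>M borel"
      by (intro borel_measurable_continuous_onI continuous_intros)
    from measurable_compose[OF this that] show ?thesis by (simp add: case_prod_beta')
  qed
  have "(\<integral>\<^sup>+S. \<integral>\<^sup>+B. \<psi> (B + mat_adj B) * F S (B - mat_adj B) \<partial>?L \<partial>?S)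
      = (\<integral>\<^sup>+B. \<integral>\<^sup>+S. \<psi> (B + mat_adj B) * F S (B - mat_adj B) \<partial>?S \<partial>?L)"
    by (rule nn_integral_swap_borel[OF sf m1])
  also have "\<dots> = (\<integral>\<^sup>+B. \<integral>\<^sup>+S. \<psi> (B + mat_adj B) * F (S + (B + mat_adj B)) (B - mat_adj B) \<partial>?S \<partial>?L)"
  proof (rule nn_integral_cong_AE)
    show "AE B in ?L. (\<integral>\<^sup>+S. \<psi> (B + mat_adj B) * F S (B - mat_adj B) \<partial>?S) =
        (\<integral>\<^sup>+S. \<psi> (B + mat_adj B) * F (S + (B + mat_adj B)) (B - mat_adj B) \<partial>?S)"
      using L.AE_leb by eventually_elim (rule S.leb_translate[OF Herm_sym ap[OF swap[OF m1]], symmetric])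
  qed
  also have "\<dots> = (\<integral>\<^sup>+S. \<integral>\<^sup>+B. \<psi> (B + mat_adj B) * F (S + (B + mat_adj B)) (B - mat_adj B) \<partial>?L \<partial>?S)"
    by (rule nn_integral_swap_borel[OF sf m2, symmetric])
  also have "\<dots> = (\<integral>\<^sup>+S. \<integral>\<^sup>+B. \<psi> (B + mat_adj B - S) * F (B + mat_adj B) (B - mat_adj B) \<partial>?L \<partial>?S)"
  proof (rule nn_integral_cong_AE)
    show "AE S in ?S. (\<integral>\<^sup>+B. \<psi> (B + mat_adj B) * F (S + (B + mat_adj B)) (B - mat_adj B) \<partial>?L) =
        (\<integral>\<^sup>+B. \<psi> (B + mat_adj B - S) * F (B + mat_adj B) (B - mat_adj B) \<partial>?L)"
      using S.AE_leb
    proof eventually_elim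
      case (elim S)
      \<comment> \<open>Half of \<open>S\<close>, since moving \<open>B\<close> by a Hermitian
        matrix moves \<open>B + mat_adj B\<close> by twice that matrix and leaves
        \<open>B - mat_adj B\<close> alone.\<close>
      let ?s = "(1/2) *\<^sub>R S"
      have adj: "mat_adj ?s = ?s" using elim by (simp add: Herm_def mat_adj_scaleR)
      have ss: "?s + ?s = S" by (simp add: scaleR_add_left[symmetric])
      have "?s \<in> VM \<beta>" using elim by (auto simp: Herm_def intro: VM_scaleR)
      from L.leb_translate[OF this ap[OF m3, of S]]
      have "(\<integral>\<^sup>+B. \<psi> (B + mat_adj B - S) * F (B + mat_adj B) (B - mat_adj B) \<partial>?L) =
         (\<integral>\<^sup>+B. \<psi> ((B + ?s) + mat_adj (B + ?s) - S) * F ((B + ?s) + mat_adj (B + ?s)) ((B + ?s) - mat_adj (B + ?s)) \<partial>?L)" by simp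
      also have "\<dots> = (\<integral>\<^sup>+B. \<psi> (B + mat_adj B) * F (S + (B + mat_adj B)) (B - mat_adj B) \<partial>?L)"
      proof (rule nn_integral_cong)
        fix B :: "'n cmat"
        have "(B + ?s) + mat_adj (B + ?s) = (?s + ?s) + (B + mat_adj B)" by (simp only: mat_adj_add adj ac_simps)
        then have a: "(B + ?s) + mat_adj (B + ?s) = S + (B + mat_adj B)" by (simp only: ss)
        then have b: "(B + ?s) + mat_adj (B + ?s) - S = B + mat_adj B" unfolding a by simp
        have c: "(B + ?s) - mat_adj (B + ?s) = B - mat_adj B" by (simp add: mat_adj_add adj)
        show "\<psi> ((B + ?s) + mat_adj (B + ?s) - S) * F ((B + ?s) + mat_adj (B + ?s)) ((B + ?s) - mat_adj (B + ?s)) =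
          \<psi> (B + mat_adj B) * F (S + (B + mat_adj B)) (B - mat_adj B)" unfolding b c unfolding a ..
      qed
      finally show ?case by simp
    qed
  qed
  also have "\<dots> = (\<integral>\<^sup>+B. \<integral>\<^sup>+S. \<psi> (B + mat_adj B - S) * F (B + mat_adj B) (B - mat_adj B) \<partial>?S \<partial>?L)"
    by (rule nn_integral_swap_borel[OF sf m3])
  also have "\<dots> = (\<integral>\<^sup>+B. (\<integral>\<^sup>+S. \<psi> S \<partial>?S) * F (B + mat_adj B) (B - mat_adj B) \<partial>?L)"
  proof (rule nn_integral_cong_AE)
    show "AE B in ?L. (\<integral>\<^sup>+S. \<psi> (B + mat_adj B - S) * F (B + mat_adj B) (B - mat_adj B) \<partial>?S) =
        (\<integral>\<^sup>+S. \<psi> S \<partial>?S) * F (B + mat_adj B) (B - mat_adj B)"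
      using L.AE_leb
    proof eventually_elim
      case (elim B)
      let ?v = "B + mat_adj B"
      have "(\<lambda>S. \<psi> (S + ?v)) \<in> borel_measurable borel" by measurable
      from S.reflect[OF this] S.leb_translate[OF Herm_sym[OF elim] \<psi>]
      have "(\<integral>\<^sup>+S. \<psi> (?v - S) \<partial>?S) = (\<integral>\<^sup>+S. \<psi> S \<partial>?S)" by simp
      moreover have "(\<lambda>S. \<psi> (?v - S)) \<in> borel_measurable ?S" by measurable
      ultimately show ?case by (simp add: nn_integral_multc)
    qed
  qed
  also have "\<dots> = (\<integral>\<^sup>+S. \<psi> S \<partial>?S) * (\<integral>\<^sup>+B. F (B + mat_adj B) (B - mat_adj B) \<partial>?L)"
  proof (rule nn_integral_cmult)
    have "(\<lambda>B. (B, B)) \<in> borel \<rightarrow>\<^sub>M (borel :: ('n cmat \<times> 'n cmat) measure)"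
      by (intro borel_measurable_continuous_onI continuous_intros)
    from measurable_compose[OF this F[of "\<lambda>x. fst x + mat_adj (fst x)" "\<lambda>x. fst x - mat_adj (fst x)"]]
    show "(\<lambda>B. F (B + mat_adj B) (B - mat_adj B)) \<in> borel_measurable ?L" by (simp add: measurable_LM)
  qed
  finally show ?thesis by simp
qed

text \<open>As a function of \<open>h\<close>, the integral of \<open>\<psi>(B + B^*) h(B - B^*)\<close> is a multiple of Lebesgue measure on
skew-Hermitian matrices, by the previous lemma.\<close>
lemma skew_congruence:
  fixes \<psi> h :: "'n::{finite,linorder} cmat \<Rightarrow> ennreal"
  assumes \<beta>: "\<beta> \<in> {1, 2}" and \<psi>[measurable]: "\<psi> \<in> borel_measurable borel" and h[measurable]: "h \<in> borel_measurable borel"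
    and fin: "0 < (\<integral>\<^sup>+S. \<psi> S \<partial>herm_lebesgue \<beta>)" "(\<integral>\<^sup>+S. \<psi> S \<partial>herm_lebesgue \<beta>) < \<infinity>"
    and g: "g \<in> GLF \<beta>"
  shows "(\<integral>\<^sup>+B. \<psi> (B + mat_adj B) * h (mat_adj g ** (B - mat_adj B) ** g) \<partial>LM \<beta>) =
    dpow g (real \<beta> * (real CARD('n) - 1) + 2 - 2 * (real \<beta> * CARD('n))) *
      (\<integral>\<^sup>+B. \<psi> (B + mat_adj B) * h (B - mat_adj B) \<partial>LM \<beta>)"
proof -
  let ?L = "LM \<beta> :: 'n cmat measure" and ?S = "herm_lebesgue \<beta> :: 'n cmat measure"
  let ?\<gamma> = "real \<beta> * (real CARD('n) - 1) + 2" and ?b = "2 * (real \<beta> * CARD('n))"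
  interpret S: leb_on "Herm \<beta>" ?S "real (card (herm_param_index \<beta> :: ('n \<times> 'n) set))"
    using \<beta> by (rule leb_herm_lebesgue)
  have d: "det g \<noteq> 0" using g by (simp add: GLF_def)
  let ?c = "\<integral>\<^sup>+S. \<psi> S \<partial>?S"
  let ?I = "\<integral>\<^sup>+B. \<psi> (B + mat_adj B) * h (B - mat_adj B) \<partial>?L"
  let ?J = "\<integral>\<^sup>+B. \<psi> (B + mat_adj B) * h (mat_adj g ** (B - mat_adj B) ** g) \<partial>?L"
  let ?F = "\<lambda>S K. \<psi> (mat_adj g ** S ** g) * h (mat_adj g ** K ** g)"
  have F: "(\<lambda>x :: 'n cmat \<times> 'n cmat. ?F (u x) (v x)) \<in> borel_measurable borel"
    if [measurable]: "u \<in> borel \<rightarrow>\<^sub>M borel" "v \<in> borel \<rightarrow>\<^sub>M borel" for u v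
    by measurable
  have "(\<integral>\<^sup>+B. ?F (B + mat_adj B) (B - mat_adj B) \<partial>?L) =
      (\<integral>\<^sup>+B. (\<lambda>B. \<psi> (B + mat_adj B) * h (B - mat_adj B)) (mat_adj g ** B ** g) \<partial>?L)"
    by (intro nn_integral_cong)
      (simp add: mat_adj_mult matrix_mul_assoc matrix_add_ldistrib matrix_mult_add_rdistrib
        matrix_mult_diff_ldistrib matrix_mult_diff_rdistrib)
  also have "\<dots> = dpow g (- ?b) * ?I"
    by (rule LM_congruence[OF \<beta> g]) measurable
  finally have lin: "(\<integral>\<^sup>+B. ?F (B + mat_adj B) (B - mat_adj B) \<partial>?L) = dpow g (- ?b) * ?I" .
  have "?c * (dpow g (- ?b) * ?I) = (\<integral>\<^sup>+S. \<integral>\<^sup>+B. \<psi> (B + mat_adj B) * ?F S (B - mat_adj B) \<partial>?L \<partial>?S)"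
    unfolding lin[symmetric] by (rule LM_herm_skew_swap[OF \<beta> \<psi>, where F = ?F, OF F])
  also have "\<dots> = (\<integral>\<^sup>+S. \<psi> (mat_adj g ** S ** g) * ?J \<partial>?S)"
  proof (rule nn_integral_cong)
    fix S
    have "(\<integral>\<^sup>+B. \<psi> (B + mat_adj B) * ?F S (B - mat_adj B) \<partial>?L) =
       (\<integral>\<^sup>+B. \<psi> (mat_adj g ** S ** g) * (\<psi> (B + mat_adj B) * h (mat_adj g ** (B - mat_adj B) ** g)) \<partial>?L)"
      by (simp only: ac_simps)
    also have "\<dots> = \<psi> (mat_adj g ** S ** g) * ?J"
      by (rule nn_integral_cmult) (simp add: measurable_LM)
    finally show "(\<integral>\<^sup>+B. \<psi> (B + mat_adj B) * ?F S (B - mat_adj B) \<partial>?L) = \<psi> (mat_adj g ** S ** g) * ?J" .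
  qed
  also have "\<dots> = (\<integral>\<^sup>+S. \<psi> (mat_adj g ** S ** g) \<partial>?S) * ?J"
    by (rule nn_integral_multc) measurable
  also have "(\<integral>\<^sup>+S. \<psi> (mat_adj g ** S ** g) \<partial>?S) = dpow g (- ?\<gamma>) * ?c"
    unfolding dpow_def by (rule herm_lebesgue_congruence[OF \<beta> g]) measurable
  \<comment> \<open>The scaling of the full matrix space is the product of those of its Hermitian
    and skew-Hermitian parts, so the skew exponent is a difference.\<close>
  finally have "?c * (dpow g (- ?b) * ?I) = ?c * (dpow g (- ?\<gamma>) * ?J)" by (simp only: ac_simps)
  then have "dpow g (- ?b) * ?I = dpow g (- ?\<gamma>) * ?J"
    using fin by (subst (asm) ennreal_mult_cancel_left) auto
  then have "?J = dpow g ?\<gamma> * (dpow g (- ?b) * ?I)" using dpow_cancel(1)[OF d, of ?\<gamma> ?J] by simp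
  also have "\<dots> = dpow g (?\<gamma> - ?b) * ?I" using dpow_plus[of g ?\<gamma> "- ?b"] by (simp add: mult.assoc)
  finally show ?thesis .
qed

subsection \<open>Inversion on the cone\<close>

text \<open>Adjoint and inverse both preserve \<open>HM \<beta>\<close>; applied together they turn
  the Gram matrix of \<open>g\<close> into its inverse.\<close>

lemma HM_gram_inv:
  fixes f :: "complex^'n^'n \<Rightarrow> ennreal"
  assumes \<beta>: "\<beta> \<in> {1, 2}" and f[measurable]: "f \<in> borel_measurable borel"
  shows "(\<integral>\<^sup>+g. f (mat_adj g ** g) \<partial>HM \<beta>) = (\<integral>\<^sup>+g. f (matrix_inv (mat_adj g ** g)) \<partial>HM \<beta>)"
proof -
  have "(\<integral>\<^sup>+g. f (mat_adj g ** g) \<partial>HM \<beta>) = (\<integral>\<^sup>+g. f (mat_adj (mat_adj g) ** mat_adj g) \<partial>HM \<beta>)"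
    by (rule HM_adj[OF \<beta>, of "\<lambda>g. f (mat_adj g ** g)", symmetric]) measurable
  also have "\<dots> = (\<integral>\<^sup>+g. f (matrix_inv g ** mat_adj (matrix_inv g)) \<partial>HM \<beta>)"
    using HM_inv[OF \<beta>, of "\<lambda>g. f (g ** mat_adj g)"] by simp
  also have "\<dots> = (\<integral>\<^sup>+g. f (matrix_inv (mat_adj g ** g)) \<partial>HM \<beta>)"
    using AE_HM_GLF[OF \<beta>]
    by (intro nn_integral_cong_AE)
      (auto simp: GLF_def matrix_inv_mult matrix_inv_adj det_mat_adj elim!: eventually_mono)
  finally show ?thesis .
qed

text \<open>A strict contraction has a strictly contracting adjoint. For
  \<open>y = mat_adj g *v x\<close>, the squared norm of \<open>y\<close> is the inner product of
  \<open>x\<close> with \<open>g *v y\<close>, and Cauchy--Schwarz gives the bound.\<close>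

lemma contraction_adj:
  assumes g: "g \<in> GLF \<beta>" and PD: "mat 1 - mat_adj g ** g \<in> PD \<beta>"
  shows "mat 1 - g ** mat_adj g \<in> PD \<beta>"
proof (rule PD_I)
  have "mat_adj (mat_adj g) ** mat_adj g \<in> Herm \<beta>"
    using GLF_adj[OF g] by (intro Herm_gram) (simp add: GLF_def)
  then show "mat 1 - g ** mat_adj g \<in> Herm \<beta>"
    using subspace_diff[OF subspace_Herm Herm_1] by simp
  fix x :: "complex^'a" assume x: "x \<noteq> 0"
  let ?y = "mat_adj g *v x"
  have y: "?y \<noteq> 0" using GLF_vec_nonzero[OF GLF_adj[OF g] x] .
  have "0 < Re (herm_form (mat 1 - mat_adj g ** g) ?y)" by (rule PD_pos[OF PD y])
  then have "(norm (g *v ?y))\<^sup>2 < (norm ?y)\<^sup>2" by (simp add: herm_form_diff herm_form_1 herm_form_gram)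
  then have lt: "norm (g *v ?y) < norm ?y" by (rule power2_less_imp_less) simp
  have Re_cip: "Re (cip x z) = inner x z" for z :: "complex^'a"
    by (simp add: cip_def inner_vec_def inner_complex_def)
  have "(norm ?y)\<^sup>2 = Re (cip ?y ?y)" by (simp only: cip_self Re_complex_of_real)
  also have "\<dots> = Re (cip x (g *v ?y))" by (simp add: cip_adj)
  also have "\<dots> \<le> norm x * norm (g *v ?y)" unfolding Re_cip by (rule norm_cauchy_schwarz)
  also have "\<dots> < norm x * norm ?y" using lt x by simp
  finally have "norm ?y < norm x" using y by (simp add: power2_eq_square)
  then have "(norm ?y)\<^sup>2 < (norm x)\<^sup>2" by (simp add: power_strict_mono)
  moreover have "herm_form (g ** mat_adj g) x = of_real ((norm ?y)\<^sup>2)"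
    using herm_form_gram[of "mat_adj g" x] by simp
  ultimately show "0 < Re (herm_form (mat 1 - g ** mat_adj g) x)"
    by (simp add: herm_form_diff herm_form_1)
qed

text \<open>The determinant follows from factoring out the inverse, but that product does not show
  positivity. For positivity the difference is congruent to \<open>mat 1 - g ** mat_adj g\<close>,
  which \<open>contraction_adj\<close> relates to \<open>mat 1 - mat_adj g ** g\<close>.\<close>

lemma pdens_inv_diff:
  assumes g: "g \<in> GLF \<beta>"
  shows "pdens \<beta> r (matrix_inv (mat_adj g ** g) - mat 1) = dpow (mat_adj g ** g) (- r) * pdens \<beta> r (mat 1 - mat_adj g ** g)"
proof -
  let ?M = "mat_adj g ** g" and ?h = "mat_adj (matrix_inv g)"
  have d: "det g \<noteq> 0" using g by (simp add: GLF_def)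
  have dM: "det ?M \<noteq> 0" using d by (simp add: det_mul det_mat_adj)
  have h: "?h \<in> GLF \<beta>" by (intro GLF_adj GLF_inv g)
  have inv: "matrix_inv ?M = matrix_inv g ** ?h"
    using d by (simp add: matrix_inv_mult matrix_inv_adj det_mat_adj)
  have 1: "matrix_inv g ** g = mat 1" "mat_adj g ** ?h = mat 1"
    using matrix_inv(2)[OF d] by (simp_all flip: mat_adj_mult)
  have "mat_adj ?h ** (mat 1 - g ** mat_adj g) ** ?h = matrix_inv g ** ?h - (matrix_inv g ** g) ** (mat_adj g ** ?h)"
    by (simp add: matrix_mult_diff_ldistrib matrix_mult_diff_rdistrib matrix_mul_assoc)
  then have "matrix_inv ?M - mat 1 = mat_adj ?h ** (mat 1 - g ** mat_adj g) ** ?h"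
    unfolding inv 1 by simp
  then have "matrix_inv ?M - mat 1 \<in> PD \<beta> \<longleftrightarrow> mat 1 - g ** mat_adj g \<in> PD \<beta>"
    using PD_congruence[OF h] by simp
  also have "\<dots> \<longleftrightarrow> mat 1 - ?M \<in> PD \<beta>"
    using contraction_adj[OF g] contraction_adj[OF GLF_adj[OF g]] by auto
  finally have PD: "matrix_inv ?M - mat 1 \<in> PD \<beta> \<longleftrightarrow> mat 1 - ?M \<in> PD \<beta>" .
  have "matrix_inv ?M - mat 1 = matrix_inv ?M ** (mat 1 - ?M)"
    using matrix_inv(2)[OF dM] by (simp add: matrix_mult_diff_ldistrib)
  then have "dpow (matrix_inv ?M - mat 1) r = dpow ?M (- r) * dpow (mat 1 - ?M) r"
    by (simp add: dpow_mult[of "matrix_inv ?M"] dpow_inv[OF dM])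
  then show ?thesis using PD by (simp add: pdens_def indicator_def)
qed

subsection \<open>The law of \<open>M\<close>\<close>

text \<open>With \<open>C = matrix_inv B\<close> in the role of \<open>mat 1 + A\<close>, the matrix
  to be inverted is \<open>C + mat_adj C = mat_adj C ** (B + mat_adj B) ** C\<close>, and the outer
  factors of \<open>Mmap\<close> cancel.\<close>

lemma Mmap_inv:
  assumes "det B \<noteq> 0" "det (B + mat_adj B) \<noteq> 0"
  shows "Mmap (matrix_inv B - mat 1) = matrix_inv (B + mat_adj B)"
proof -
  let ?C = "matrix_inv B" and ?S = "B + mat_adj B"
  have BC: "B ** ?C = mat 1" "?C ** B = mat 1" using matrix_inv[OF assms(1)] .
  have BC': "mat_adj ?C ** mat_adj B = mat 1" "mat_adj B ** mat_adj ?C = mat 1"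
    using BC by (simp_all flip: mat_adj_mult)
  have 2: "mat 2 + (?C - mat 1) + mat_adj (?C - mat 1) = ?C + mat_adj ?C"
    by (simp add: mat_adj_diff) (simp add: mat_def vec_eq_iff)
  have "?C + mat_adj ?C = mat_adj ?C ** ?S ** ?C"
  proof -
    have "mat_adj ?C ** ?S ** ?C = mat_adj ?C ** (B ** ?C) + (mat_adj ?C ** mat_adj B) ** ?C"
      by (simp add: matrix_add_ldistrib matrix_mult_add_rdistrib matrix_mul_assoc)
    then show ?thesis by (simp add: BC BC' add.commute)
  qed
  moreover have "(mat_adj ?C ** ?S ** ?C) ** (B ** matrix_inv ?S ** mat_adj B) = mat 1"
  proof -
    have "(mat_adj ?C ** ?S ** ?C) ** (B ** matrix_inv ?S ** mat_adj B) =
        mat_adj ?C ** ?S ** (?C ** B) ** matrix_inv ?S ** mat_adj B" by (simp only: matrix_mul_assoc)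
    also have "\<dots> = mat_adj ?C ** (?S ** matrix_inv ?S) ** mat_adj B" by (simp add: BC matrix_mul_assoc)
    finally show ?thesis by (simp add: matrix_inv(1)[OF assms(2)] BC')
  qed
  ultimately have inv: "matrix_inv (?C + mat_adj ?C) = B ** matrix_inv ?S ** mat_adj B"
    by (intro matrix_inv_eqI) simp
  have "Mmap (?C - mat 1) = ?C ** matrix_inv (?C + mat_adj ?C) ** mat_adj ?C"
    unfolding Mmap_def 2 by (simp add: mat_adj_diff)
  also have "\<dots> = (?C ** B) ** matrix_inv ?S ** (mat_adj B ** mat_adj ?C)"
    unfolding inv by (simp only: matrix_mul_assoc)
  finally show ?thesis by (simp add: BC BC')
qed

lemma borel_measurable_Mmap[measurable (raw)]:
  assumes [measurable]: "A \<in> borel_measurable M"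
  shows "(\<lambda>x. Mmap (A x)) \<in> borel_measurable M"
  unfolding Mmap_def by measurable

lemma PD_minus_1_imp: "S - mat 1 \<in> PD \<beta> \<Longrightarrow> S \<in> PD \<beta>"
  using PD_add_nonneg[of "S - mat 1" \<beta> "mat 1"] by (simp add: Herm_1 herm_form_1)

lemma Mmap_law:
  fixes M :: "((complex, 'n::{finite,linorder} + 'k::finite) vec, 'n + 'k) vec measure"
  assumes \<beta>: "\<beta> \<in> {1, 2}" and card: "CARD('k) \<ge> CARD('n)" and haar: "haar_measure (haar_group \<beta>) M"
    and r: "2 * r = real \<beta> * CARD('k) - (real \<beta> * (real CARD('n) - 1) + 2)"
    and w: "2 * w = real \<beta> * CARD('k) + 2 * real \<beta> - 4"
  obtains c :: real where "c > 0"
    "\<And>f :: 'n cmat \<Rightarrow> ennreal. f \<in> borel_measurable borel \<Longrightarrow>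
      (\<integral>\<^sup>+Q. f (Mmap (corner Q)) \<partial>M) = ennreal c *
        (\<integral>\<^sup>+S. pdens \<beta> w S * pdens \<beta> r (mat 1 - S) * f S \<partial>herm_lebesgue \<beta>)"
proof -
  interpret haar_measure "haar_group \<beta>" M by fact
  let ?\<gamma> = "real \<beta> * (real CARD('n) - 1) + 2" and ?b = "real \<beta> * CARD('n)"
  let ?H = "HM \<beta> :: 'n cmat measure" and ?L = "LM \<beta> :: 'n cmat measure" and ?S = "herm_lebesgue \<beta> :: 'n cmat measure"
  \<comment> \<open>Power of \<open>det B\<close> in the density of \<open>B\<close>: one
    \<open>?b\<close> for each of the two passages between \<open>LM\<close> and \<open>HM\<close>
    around the inversion, and \<open>2 * r\<close> from the congruence inside
    \<open>pdens\<close>.\<close>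
  define q where "q = 2 * ?b + 2 * r"
  \<comment> \<open>Degree of homogeneity of the skew integral \<open>J\<close> as a power of the
    determinant: \<open>2 * e\<close> collects the skew scaling \<open>2 * ?b - ?\<gamma>\<close>
    and the factor \<open>- 2 * q\<close> of the integrand.\<close>
  define e where "e = (2 * ?b - ?\<gamma>) / 2 - q"
  \<comment> \<open>Inverting the cone flips the exponent \<open>?\<gamma> / 2 + e\<close>, and
    \<open>pdens_inv_diff\<close> contributes \<open>- r\<close>; what exceeds the invariant part
    \<open>?\<gamma> / 2\<close> is the exponent \<open>w\<close> of the claimed density.\<close>
  have ex: "- (?\<gamma> / 2 + e) + - r = ?\<gamma> / 2 + w"
  proof -
    have g: "?\<gamma> = ?b - real \<beta> + 2" by (simp add: algebra_simps)
    have "- ((b - x + 2) / 2 + ((2 * b - (b - x + 2)) / 2 - (2 * b + 2 * r))) + - r = (b - x + 2) / 2 + w"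
      if "2 * r = y - (b - x + 2)" "2 * w = y + 2 * x - 4" for b x y :: real
      using that by (simp add: field_simps)
    from this[of _ ?b "real \<beta>"] show ?thesis using r w unfolding e_def q_def g .
  qed
  interpret S: leb_on "Herm \<beta>" ?S "real (card (herm_param_index \<beta> :: ('n \<times> 'n) set))"
    using \<beta> by (rule leb_herm_lebesgue)
  interpret L: leb_on "VM \<beta>" ?L "real \<beta> * CARD('n) * CARD('n)" using \<beta> by (rule leb_LM)
  have gram_half: "dpow (mat_adj g ** g) (?\<gamma> / 2) = dpow g ?\<gamma>" for g :: "'n cmat"
    unfolding dpow_gram by (simp only: times_divide_eq_right nonzero_mult_div_cancel_left zero_neq_numeral[symmetric] not_False_eq_True)
  obtain c1 :: real where c1: "c1 > 0" "\<And>\<phi> :: 'n cmat \<Rightarrow> ennreal. \<phi> \<in> borel_measurable borel \<Longrightarrow>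
      (\<integral>\<^sup>+Q. \<phi> (corner Q) \<partial>M) = ennreal c1 * (\<integral>\<^sup>+A. pdens \<beta> r (mat 1 - mat_adj A ** A) * \<phi> A \<partial>?L)"
    using corner_density[OF \<beta> card haar r] by blast
  obtain c2 :: real where c2: "c2 > 0" "\<And>f :: 'n cmat \<Rightarrow> ennreal. f \<in> borel_measurable borel \<Longrightarrow>
      (\<integral>\<^sup>+S. indicator (PD \<beta>) S * f S \<partial>?S) = ennreal c2 * (\<integral>\<^sup>+g. dpow g ?\<gamma> * f (mat_adj g ** g) \<partial>?H)"
    using herm_cone_measure[OF \<beta>] by blast
  \<comment> \<open>An arbitrary integrable function of the Hermitian part would do; its integral
    \<open>?c0\<close> cancels in the end.\<close>
  define \<psi> :: "'n cmat \<Rightarrow> ennreal" where "\<psi> = indicator (cball 0 1)"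
  have \<psi>[measurable]: "\<psi> \<in> borel_measurable borel"
    unfolding \<psi>_def by (intro borel_measurable_indicator) simp
  let ?c0 = "\<integral>\<^sup>+S. \<psi> S \<partial>?S"
  have c0: "0 < ?c0" "?c0 < \<infinity>"
    using S.cball_pos[of 1] S.leb_cball[of 1] S.cball_integral by (simp_all add: \<psi>_def)
  \<comment> \<open>The integral over the skew-Hermitian part. It may be infinite at this stage:
    only its dependence on \<open>S\<close> is computed.\<close>
  define J where "J S = (\<integral>\<^sup>+B. \<psi> (B + mat_adj B) * dpow (S + (B - mat_adj B)) (- q) \<partial>?L)" for S
  have J_gram: "J (mat_adj g ** g) = dpow g (2 * e) * J (mat 1)" if g: "g \<in> GLF \<beta>" for g
  proof -
    have d: "det g \<noteq> 0" using g by (simp add: GLF_def)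
    let ?h = "\<lambda>K. dpow (mat_adj g ** g + K) (- q)"
    have "(\<integral>\<^sup>+B. \<psi> (B + mat_adj B) * ?h (mat_adj g ** (B - mat_adj B) ** g) \<partial>?L) =
        dpow g (?\<gamma> - 2 * ?b) * J (mat_adj g ** g)"
      unfolding J_def by (rule skew_congruence[OF \<beta> \<psi> _ c0 g]) measurable
    moreover have "(\<integral>\<^sup>+B. \<psi> (B + mat_adj B) * ?h (mat_adj g ** (B - mat_adj B) ** g) \<partial>?L) =
        (\<integral>\<^sup>+B. dpow g (- 2 * q) * (\<psi> (B + mat_adj B) * dpow (mat 1 + (B - mat_adj B)) (- q)) \<partial>?L)"
    proof (rule nn_integral_cong)
      fix B :: "'n cmat"
      have "mat_adj g ** g + mat_adj g ** (B - mat_adj B) ** g = mat_adj g ** (mat 1 + (B - mat_adj B)) ** g"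
        by (simp add: matrix_add_ldistrib matrix_mult_add_rdistrib)
      then have "?h (mat_adj g ** (B - mat_adj B) ** g) = dpow g (2 * - q) * dpow (mat 1 + (B - mat_adj B)) (- q)"
        by (simp only: dpow_congruence)
      then show "\<psi> (B + mat_adj B) * ?h (mat_adj g ** (B - mat_adj B) ** g) =
          dpow g (- 2 * q) * (\<psi> (B + mat_adj B) * dpow (mat 1 + (B - mat_adj B)) (- q))"
        by (simp add: ac_simps)
    qed
    moreover have "\<dots> = dpow g (- 2 * q) * J (mat 1)"
      unfolding J_def by (rule nn_integral_cmult) (simp add: measurable_LM)
    ultimately have "dpow g (?\<gamma> - 2 * ?b) * J (mat_adj g ** g) = dpow g (- 2 * q) * J (mat 1)" by simp
    then have "dpow g (- (?\<gamma> - 2 * ?b)) * (dpow g (?\<gamma> - 2 * ?b) * J (mat_adj g ** g)) =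
        dpow g (- (?\<gamma> - 2 * ?b)) * (dpow g (- 2 * q) * J (mat 1))" by simp
    then have "J (mat_adj g ** g) = (dpow g (- (?\<gamma> - 2 * ?b)) * dpow g (- 2 * q)) * J (mat 1)"
      unfolding dpow_cancel(2)[OF d] by (simp only: mult.assoc)
    also have "dpow g (- (?\<gamma> - 2 * ?b)) * dpow g (- 2 * q) = dpow g (2 * e)"
      unfolding dpow_plus[symmetric] by (rule arg_cong[where f = "dpow g"]) (simp add: e_def field_simps)
    finally show ?thesis .
  qed
  have J_PD: "J S = dpow S e * J (mat 1)" if "S \<in> PD \<beta>" for S
    using PD_eq_gram[OF that] J_gram by (metis dpow_gram)
  define R where "R f = (\<integral>\<^sup>+S. pdens \<beta> w S * pdens \<beta> r (mat 1 - S) * f S \<partial>?S)" for f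
  \<comment> \<open>Needed because \<open>(B + mat_adj B) + (B - mat_adj B)\<close> is twice
    \<open>B\<close>.\<close>
  have half: "dpow ((1/2) *\<^sub>R X) s = ennreal (((1/2) ^ CARD('n)) powr s) * dpow X s" for X :: "'n cmat" and s
  proof -
    have "cmod (det ((1/2) *\<^sub>R X)) = (1/2) ^ CARD('n) * cmod (det X)"
      unfolding mat_of_real_mult(1)[symmetric, of "1/2" X] by (simp add: det_mul det_mat norm_mult norm_power norm_divide power_divide)
    then show ?thesis by (simp add: dpow_def powr_mult ennreal_mult)
  qed
  define k where "k = ennreal (((1/2) ^ CARD('n)) powr (- q))"
  have step: "?c0 * (\<integral>\<^sup>+Q. f (Mmap (corner Q)) \<partial>M) = (ennreal c1 * k * J (mat 1)) * R f"
    if f[measurable]: "f \<in> borel_measurable borel" for f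
  proof -
    define \<Psi> where "\<Psi> A = pdens \<beta> r (mat 1 - mat_adj A ** A) * f (Mmap A)" for A
    have \<Psi>[measurable (raw)]: "(\<lambda>x. \<Psi> (u x)) \<in> borel_measurable N"
      if [measurable]: "u \<in> borel_measurable N" for u and N :: "'z measure"
      unfolding \<Psi>_def by measurable
    define F where "F S K = pdens \<beta> r (S - mat 1) * (f (matrix_inv S) * dpow (S + K) (- q))" for S K
    have F[measurable (raw)]: "(\<lambda>x. F (u x) (v x)) \<in> borel_measurable N"
      if [measurable]: "u \<in> borel_measurable N" "v \<in> borel_measurable N" for u v and N :: "'z measure"
      unfolding F_def by measurable
    have "(\<integral>\<^sup>+Q. f (Mmap (corner Q)) \<partial>M) = ennreal c1 * (\<integral>\<^sup>+A. \<Psi> A \<partial>?L)"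
      unfolding \<Psi>_def by (rule c1(2)) measurable
    also have "(\<integral>\<^sup>+A. \<Psi> A \<partial>?L) = (\<integral>\<^sup>+C. \<Psi> (C + (- mat 1)) \<partial>?L)"
      by (rule L.leb_translate[symmetric]) (simp_all add: VM_minus VM_1 \<Psi>)
    also have "\<dots> = (\<integral>\<^sup>+C. dpow C ?b * \<Psi> (C - mat 1) \<partial>?H)"
      by (subst LM_eq_HM[OF \<beta>]) simp_all
    also have "\<dots> = (\<integral>\<^sup>+B. dpow (matrix_inv B) ?b * \<Psi> (matrix_inv B - mat 1) \<partial>?H)"
      by (rule HM_inv[OF \<beta>, of "\<lambda>C. dpow C ?b * \<Psi> (C - mat 1)", symmetric]) measurable
    also have "\<dots> = (\<integral>\<^sup>+B. dpow B (- ?b) * (dpow (matrix_inv B) ?b * \<Psi> (matrix_inv B - mat 1)) \<partial>?L)"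
      by (rule nn_integral_HM) measurable
    also have "\<dots> = (\<integral>\<^sup>+B. k * F (B + mat_adj B) (B - mat_adj B) \<partial>?L)"
    proof (rule nn_integral_cong_AE)
      show "AE B in ?L. dpow B (- ?b) * (dpow (matrix_inv B) ?b * \<Psi> (matrix_inv B - mat 1)) = k * F (B + mat_adj B) (B - mat_adj B)"
        using AE_LM_GLF[OF \<beta>]
      proof eventually_elim
        case (elim B)
        let ?A = "matrix_inv B - mat 1" and ?T = "B + mat_adj B"
        have d: "det B \<noteq> 0" using elim by (simp add: GLF_def)
        have BB: "B ** matrix_inv B = mat 1" "mat_adj (matrix_inv B) ** mat_adj B = mat 1"
          using matrix_inv(1)[OF d] by (simp_all flip: mat_adj_mult)
        have "mat_adj (matrix_inv B) ** (?T - mat 1) ** matrix_inv B = mat_adj (matrix_inv B) ** (B ** matrix_inv B)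
            + (mat_adj (matrix_inv B) ** mat_adj B) ** matrix_inv B - mat_adj (matrix_inv B) ** matrix_inv B"
          by (simp add: matrix_add_ldistrib matrix_mult_add_rdistrib matrix_mult_diff_ldistrib
              matrix_mult_diff_rdistrib matrix_mul_assoc)
        then have "mat 1 - mat_adj ?A ** ?A = mat_adj (matrix_inv B) ** (?T - mat 1) ** matrix_inv B"
          unfolding BB by (simp add: mat_adj_diff matrix_mult_diff_ldistrib matrix_mult_diff_rdistrib)
        then have "pdens \<beta> r (mat 1 - mat_adj ?A ** ?A) = dpow B (- (2 * r)) * pdens \<beta> r (?T - mat 1)"
          by (simp add: pdens_congruence[OF GLF_inv[OF elim]] dpow_inv[OF d])
        \<comment> \<open>\<open>Mmap_inv\<close> requires an invertible \<open>?T\<close>. Where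
          \<open>?T - mat 1\<close> is in the cone this holds, and elsewhere both sides
          vanish.\<close>
        moreover have "pdens \<beta> r (?T - mat 1) * f (Mmap ?A) = pdens \<beta> r (?T - mat 1) * f (matrix_inv ?T)"
        proof (cases "?T - mat 1 \<in> PD \<beta>")
          case True
          then have "det ?T \<noteq> 0" using PD_minus_1_imp[of ?T \<beta>] by (auto simp: PD_def)
          then show ?thesis by (simp add: Mmap_inv[OF d])
        qed (simp add: pdens_def)
        ultimately have \<Psi>A: "\<Psi> ?A = dpow B (- (2 * r)) * (pdens \<beta> r (?T - mat 1) * f (matrix_inv ?T))"
          unfolding \<Psi>_def by (simp only: mult.assoc)
        have "dpow B (- ?b) * (dpow B (- ?b) * dpow B (- (2 * r))) = dpow B (- q)"
          unfolding dpow_plus[symmetric] by (rule arg_cong[where f = "dpow B"]) (simp add: q_def)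
        moreover have "dpow B (- q) = k * dpow (?T + (B - mat_adj B)) (- q)"
        proof -
          have "?T + (B - mat_adj B) = B + B" by simp
          then have "(1/2) *\<^sub>R (?T + (B - mat_adj B)) = B" by (simp add: scaleR_add_right scaleR_add_left[symmetric])
          then show ?thesis using half[of "?T + (B - mat_adj B)" "- q"] by (simp add: k_def)
        qed
        ultimately have "dpow B (- ?b) * (dpow B (- ?b) * dpow B (- (2 * r))) = k * dpow (?T + (B - mat_adj B)) (- q)"
          by (simp only:)
        then have "(dpow B (- ?b) * (dpow B (- ?b) * dpow B (- (2 * r)))) * (pdens \<beta> r (?T - mat 1) * f (matrix_inv ?T)) =
            k * F ?T (B - mat_adj B)"
          unfolding F_def by (simp only: ac_simps)
        then show ?case unfolding \<Psi>A dpow_inv[OF d] by (simp only: mult.assoc)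
      qed
    qed
    also have "\<dots> = k * (\<integral>\<^sup>+B. F (B + mat_adj B) (B - mat_adj B) \<partial>?L)"
      by (rule nn_integral_cmult) (simp add: measurable_LM)
    finally have 1: "(\<integral>\<^sup>+Q. f (Mmap (corner Q)) \<partial>M) = ennreal c1 * (k * (\<integral>\<^sup>+B. F (B + mat_adj B) (B - mat_adj B) \<partial>?L))" .
    \<comment> \<open>Once \<open>S\<close> is an independent variable, only the last factor of
      \<open>F\<close> depends on the skew-Hermitian part, and its integral is
      \<open>J S\<close>.\<close>
    have "?c0 * (\<integral>\<^sup>+B. F (B + mat_adj B) (B - mat_adj B) \<partial>?L) =
        (\<integral>\<^sup>+S. \<integral>\<^sup>+B. \<psi> (B + mat_adj B) * F S (B - mat_adj B) \<partial>?L \<partial>?S)"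
      by (rule LM_herm_skew_swap[OF \<beta> \<psi>]) measurable
    also have "\<dots> = (\<integral>\<^sup>+S. indicator (PD \<beta>) S * (dpow S e * (pdens \<beta> r (S - mat 1) * f (matrix_inv S)) * J (mat 1)) \<partial>?S)"
    proof (rule nn_integral_cong)
      fix S
      have "(\<integral>\<^sup>+B. \<psi> (B + mat_adj B) * F S (B - mat_adj B) \<partial>?L) =
         (\<integral>\<^sup>+B. (pdens \<beta> r (S - mat 1) * f (matrix_inv S)) * (\<psi> (B + mat_adj B) * dpow (S + (B - mat_adj B)) (- q)) \<partial>?L)"
        unfolding F_def by (simp only: ac_simps)
      also have "\<dots> = (pdens \<beta> r (S - mat 1) * f (matrix_inv S)) * J S"
        unfolding J_def by (rule nn_integral_cmult) (simp add: measurable_LM)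
      also have "\<dots> = indicator (PD \<beta>) S * (dpow S e * (pdens \<beta> r (S - mat 1) * f (matrix_inv S)) * J (mat 1))"
      proof (cases "S \<in> PD \<beta>")
        case True
        then show ?thesis by (simp add: J_PD ac_simps)
      next
        case False
        then have "S - mat 1 \<notin> PD \<beta>" using PD_minus_1_imp by blast
        then show ?thesis using False by (simp add: pdens_def)
      qed
      finally show "(\<integral>\<^sup>+B. \<psi> (B + mat_adj B) * F S (B - mat_adj B) \<partial>?L) =
        indicator (PD \<beta>) S * (dpow S e * (pdens \<beta> r (S - mat 1) * f (matrix_inv S)) * J (mat 1))" .
    qed
    also have "\<dots> = ennreal c2 * (\<integral>\<^sup>+g. dpow g ?\<gamma> * (dpow (mat_adj g ** g) e *
        (pdens \<beta> r (mat_adj g ** g - mat 1) * f (matrix_inv (mat_adj g ** g))) * J (mat 1)) \<partial>?H)"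
      by (rule c2(2)) measurable
    also have "\<dots> = ennreal c2 * (\<integral>\<^sup>+g. dpow (mat_adj g ** g) (?\<gamma> / 2 + e) *
        (pdens \<beta> r (mat_adj g ** g - mat 1) * f (matrix_inv (mat_adj g ** g))) * J (mat 1) \<partial>?H)"
    proof -
      show ?thesis by (simp only: gram_half dpow_plus mult.assoc)
    qed
    also have "(\<integral>\<^sup>+g. dpow (mat_adj g ** g) (?\<gamma> / 2 + e) *
        (pdens \<beta> r (mat_adj g ** g - mat 1) * f (matrix_inv (mat_adj g ** g))) * J (mat 1) \<partial>?H) =
      (\<integral>\<^sup>+g. dpow (matrix_inv (mat_adj g ** g)) (?\<gamma> / 2 + e) *
        (pdens \<beta> r (matrix_inv (mat_adj g ** g) - mat 1) * f (matrix_inv (matrix_inv (mat_adj g ** g)))) * J (mat 1) \<partial>?H)"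
      by (rule HM_gram_inv[OF \<beta>, of "\<lambda>S. dpow S (?\<gamma> / 2 + e) * (pdens \<beta> r (S - mat 1) * f (matrix_inv S)) * J (mat 1)"]) measurable
    also have "\<dots> = (\<integral>\<^sup>+g. dpow g ?\<gamma> * (dpow (mat_adj g ** g) w * (pdens \<beta> r (mat 1 - mat_adj g ** g) * f (mat_adj g ** g)) * J (mat 1)) \<partial>?H)"
    proof (rule nn_integral_cong_AE)
      show "AE g in ?H. dpow (matrix_inv (mat_adj g ** g)) (?\<gamma> / 2 + e) *
        (pdens \<beta> r (matrix_inv (mat_adj g ** g) - mat 1) * f (matrix_inv (matrix_inv (mat_adj g ** g)))) * J (mat 1) =
        dpow g ?\<gamma> * (dpow (mat_adj g ** g) w * (pdens \<beta> r (mat 1 - mat_adj g ** g) * f (mat_adj g ** g)) * J (mat 1))"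
        using AE_HM_GLF[OF \<beta>]
      proof eventually_elim
        case (elim g)
        let ?M = "mat_adj g ** g"
        have dM: "det ?M \<noteq> 0" using elim by (simp add: GLF_def det_mul det_mat_adj)
        have "dpow g ?\<gamma> * dpow ?M w = dpow ?M (- (?\<gamma> / 2 + e)) * dpow ?M (- r)"
          unfolding dpow_plus[symmetric] ex by (simp only: dpow_plus gram_half)
        then show ?case
          unfolding matrix_inv_inv[OF dM] pdens_inv_diff[OF elim] dpow_inv[OF dM]
          by (simp only: mult.assoc[symmetric])
      qed
    qed
    also have "ennreal c2 * \<dots> = (\<integral>\<^sup>+S. indicator (PD \<beta>) S * (dpow S w * (pdens \<beta> r (mat 1 - S) * f S) * J (mat 1)) \<partial>?S)"
      by (rule c2(2)[symmetric]) measurable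
    also have "\<dots> = (\<integral>\<^sup>+S. pdens \<beta> w S * pdens \<beta> r (mat 1 - S) * f S * J (mat 1) \<partial>?S)"
      by (simp only: pdens_def[of \<beta> w] mult.assoc)
    also have "\<dots> = R f * J (mat 1)"
      unfolding R_def by (rule nn_integral_multc) measurable
    finally have 2: "?c0 * (\<integral>\<^sup>+B. F (B + mat_adj B) (B - mat_adj B) \<partial>?L) = R f * J (mat 1)" .
    have "?c0 * (\<integral>\<^sup>+Q. f (Mmap (corner Q)) \<partial>M) = ennreal c1 * (k * (?c0 * (\<integral>\<^sup>+B. F (B + mat_adj B) (B - mat_adj B) \<partial>?L)))"
      unfolding 1 by (simp only: ac_simps)
    then show ?thesis unfolding 2 by (simp only: ac_simps)
  qed
  obtain x where x: "?c0 = ennreal x" "x > 0"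
    using c0 by (cases ?c0) auto
  define D where "D = ennreal (1 / x) * (ennreal c1 * k * J (mat 1))"
  have law: "(\<integral>\<^sup>+Q. f (Mmap (corner Q)) \<partial>M) = D * R f" if "f \<in> borel_measurable borel" for f
  proof -
    have "ennreal (1 / x) * (?c0 * (\<integral>\<^sup>+Q. f (Mmap (corner Q)) \<partial>M)) = D * R f"
      unfolding step[OF that] D_def by (simp only: mult.assoc)
    moreover have "ennreal (1 / x) * ?c0 = 1" using x by (simp add: ennreal_mult[symmetric])
    ultimately show ?thesis by (simp add: mult.assoc[symmetric])
  qed
  \<comment> \<open>Total mass one forces the collected constant \<open>D\<close>, and with it the
    unknown \<open>J (mat 1)\<close>, to be positive and finite; no convergence estimate is
    made.\<close>
  have one: "D * R (\<lambda>_. 1) = 1"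
    using law[of "\<lambda>_. 1"] by (simp add: emeasure_M)
  have "D \<noteq> 0" using one by auto
  moreover have "D \<noteq> \<top>"
  proof
    assume "D = \<top>"
    then show False using one by (cases "R (\<lambda>_. 1) = 0") (auto simp: ennreal_top_mult)
  qed
  ultimately obtain y where y: "D = ennreal y" "y > 0" by (cases D) (auto simp: less_le)
  show ?thesis
    by (rule that[OF y(2)]) (use law y R_def in simp)
qed

lemma PD_Re_det:
  fixes S :: "complex^'n^'n"
  assumes "S \<in> PD \<beta>" shows "Re (det S) = cmod (det S)"
proof -
  obtain g :: "complex^'n^'n" where "S = mat_adj g ** g" using PD_eq_gram[OF assms] by metis
  then have "det S = of_real ((cmod (det g))\<^sup>2)"
    by (simp add: det_mul det_mat_adj complex_norm_square mult.commute del: of_real_power)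
  then show ?thesis by (simp del: of_real_power)
qed

lemma borel_measurable_jacobi_density[measurable]: "jacobi_density \<beta> T \<in> borel_measurable borel"
proof -
  have "closed {M :: complex^'a^'a. nonneg_def M}"
  proof -
    have "{M :: complex^'a^'a. nonneg_def M} = (\<Inter>x. {M. Im (herm_form M x) = 0} \<inter> {M. 0 \<le> Re (herm_form M x)})"
      by (auto simp: nonneg_def_def)
    moreover have "closed ({M :: complex^'a^'a. Im (herm_form M x) = 0} \<inter> {M. 0 \<le> Re (herm_form M x)})" for x
      unfolding herm_form_def by (intro closed_Int closed_Collect_eq closed_Collect_le continuous_intros)
    ultimately show ?thesis by auto
  qed
  then have "{M :: complex^'a^'a. nonneg_def M} \<in> sets borel" by (rule borel_closed)
  then have [measurable]: "Measurable.pred borel (nonneg_def :: complex^'a^'a \<Rightarrow> bool)" by (simp add: pred_def)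
  show ?thesis unfolding jacobi_density_def Let_def by measurable
qed

text \<open>The closed conditions of \<open>jacobi_density\<close> and the open cone differ only
  where a determinant vanishes, and there \<open>0 powr r = 0\<close> for every exponent.\<close>

lemma jacobi_density_eq_pdens:
  fixes S :: "complex^'n^'n"
  assumes S: "S \<in> Herm \<beta>"
    and w: "w = real \<beta> / 2 * (real T - real CARD('n)) + real \<beta> - 2"
    and r: "r = real \<beta> / 2 * (real T - 2 * real CARD('n) + 1) - 1"
  shows "ennreal (jacobi_density \<beta> T S) = pdens \<beta> w S * pdens \<beta> r (mat 1 - S)"
proof -
  have S': "mat 1 - S \<in> Herm \<beta>" by (rule subspace_diff[OF subspace_Herm Herm_1 S])
  have iff: "X \<in> PD \<beta> \<longleftrightarrow> nonneg_def X \<and> det X \<noteq> 0" if "X \<in> Herm \<beta>" for X :: "complex^'n^'n"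
    using that PD_nonneg_def[OF that] by (auto simp: Herm_def)
  show ?thesis
  proof (cases "S \<in> PD \<beta> \<and> mat 1 - S \<in> PD \<beta>")
    case True
    then show ?thesis
      using iff[OF S] iff[OF S'] unfolding w r
      by (simp add: jacobi_density_def Let_def pdens_def dpow_def PD_Re_det ennreal_mult)
  next
    case False
    then have "jacobi_density \<beta> T S = 0" using iff[OF S] iff[OF S'] by (auto simp: jacobi_density_def Let_def)
    then show ?thesis using False by (auto simp: pdens_def)
  qed
qed

theorem theorem5:
  fixes \<beta> :: nat
    and \<mu> :: "(complex^('n::{finite,linorder} + 'k::finite)^('n + 'k)) measure"
  assumes "\<beta> \<in> {1, 2}"
    and "CARD('k) \<ge> CARD('n)"
    and "is_haar_prob (haar_group \<beta>) \<mu>"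
  shows "\<exists>c>0. distr \<mu> borel (\<lambda>Q. Mmap (corner Q)) =
           density (herm_lebesgue \<beta>)
             (\<lambda>M. ennreal (c * jacobi_density \<beta> CARD('n + 'k) M))"
proof -
  let ?T = "CARD('n + 'k)" and ?S = "herm_lebesgue \<beta> :: 'n cmat measure" and ?M = "distr \<mu> borel (\<lambda>Q. Q)"
  define w where "w = real \<beta> / 2 * (real ?T - real CARD('n)) + real \<beta> - 2"
  define r where "r = real \<beta> / 2 * (real ?T - 2 * real CARD('n) + 1) - 1"
  have haar: "haar_measure (haar_group \<beta>) ?M" by (rule haar_measure_of_is_haar_prob[OF assms(1,3)])
  interpret haar_measure "haar_group \<beta>" ?M by (rule haar)
  interpret S: leb_on "Herm \<beta>" ?S "real (card (herm_param_index \<beta> :: ('n \<times> 'n) set))"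
    using assms(1) by (rule leb_herm_lebesgue)
  have "2 * r = real \<beta> * CARD('k) - (real \<beta> * (real CARD('n) - 1) + 2)"
    "2 * w = real \<beta> * CARD('k) + 2 * real \<beta> - 4"
    by (simp_all add: r_def w_def algebra_simps)
  then obtain c :: real where c: "c > 0" "\<And>f :: 'n cmat \<Rightarrow> ennreal. f \<in> borel_measurable borel \<Longrightarrow>
      (\<integral>\<^sup>+Q. f (Mmap (corner Q)) \<partial>?M) =
      ennreal c * (\<integral>\<^sup>+S. pdens \<beta> w S * pdens \<beta> r (mat 1 - S) * f S \<partial>?S)"
    using Mmap_law[OF assms(1,2) haar] by blast
  have m[measurable]: "(\<lambda>Q. Mmap (corner Q)) \<in> borel \<rightarrow>\<^sub>M (borel :: 'n cmat measure)"
    unfolding corner_eq by measurable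
  let ?D = "density ?S (\<lambda>M. ennreal (c * jacobi_density \<beta> ?T M))"
  have "distr ?M borel (\<lambda>Q. Mmap (corner Q)) = ?D"
  proof (rule measure_eqI)
    show "sets (distr ?M borel (\<lambda>Q. Mmap (corner Q))) = sets ?D" by (simp add: S.sets_leb)
    fix A assume "A \<in> sets (distr ?M borel (\<lambda>Q. Mmap (corner Q)))"
    then have A[measurable]: "A \<in> sets borel" by simp
    have iA: "(indicator A :: 'n cmat \<Rightarrow> ennreal) \<in> borel_measurable borel" by (rule borel_measurable_indicator[OF A])
    have "emeasure (distr ?M borel (\<lambda>Q. Mmap (corner Q))) A = (\<integral>\<^sup>+S. indicator A S \<partial>distr ?M borel (\<lambda>Q. Mmap (corner Q)))"
      by simp
    also have "\<dots> = (\<integral>\<^sup>+Q. indicator A (Mmap (corner Q)) \<partial>?M)"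
      by (rule nn_integral_distr) (use iA in measurable)
    also have "\<dots> = ennreal c * (\<integral>\<^sup>+S. pdens \<beta> w S * pdens \<beta> r (mat 1 - S) * indicator A S \<partial>?S)"
      by (rule c(2)[OF iA])
    also have "\<dots> = (\<integral>\<^sup>+S. ennreal c * (pdens \<beta> w S * pdens \<beta> r (mat 1 - S) * indicator A S) \<partial>?S)"
      by (rule nn_integral_cmult[symmetric]) measurable
    also have "\<dots> = (\<integral>\<^sup>+S. ennreal (c * jacobi_density \<beta> ?T S) * indicator A S \<partial>?S)"
    proof (rule nn_integral_cong_AE)
      \<comment> \<open>Equality can fail off \<open>Herm \<beta>\<close>: for
        \<open>\<beta> = 1\<close>, \<open>nonneg_def\<close> also admits Hermitian matrices that
        are not real. The measure does not charge them.\<close>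
      show "AE S in ?S. ennreal c * (pdens \<beta> w S * pdens \<beta> r (mat 1 - S) * indicator A S) =
          ennreal (c * jacobi_density \<beta> ?T S) * indicator A S"
        using S.AE_leb
      proof eventually_elim
        case (elim S)
        have "ennreal (c * jacobi_density \<beta> ?T S) = ennreal c * (pdens \<beta> w S * pdens \<beta> r (mat 1 - S))"
          unfolding jacobi_density_eq_pdens[OF elim w_def r_def, symmetric] using c(1) by (intro ennreal_mult') simp
        then show ?case by (simp only: mult.assoc)
      qed
    qed
    also have "\<dots> = emeasure ?D A"
      by (rule emeasure_density[symmetric]) measurable
    finally show "emeasure (distr ?M borel (\<lambda>Q. Mmap (corner Q))) A = emeasure ?D A" .
  qed
  then have "distr \<mu> borel (\<lambda>Q. Mmap (corner Q)) = ?D"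
    using distr_is_haar_prob[OF assms(3) m] by simp
  then show ?thesis using c(1) by blast
qed

end
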